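(* Let $G$ be a peripherally 2-colorable graph and let $G^*$ be the inner dual of $G$. Let $\mathcal{H}(R(G))$ be the set of nontrivial hypercubes of the resonance graph $R(G)$, $\mathcal{RS}(G)$ the set of nonempty resonant sets of $G$, and $\mathcal{IS}(G^* )$ the set of nonempty independent sets of $G^*$. Let $f:\mathcal{H}(R(G))\to\mathcal{RS}(G)$ be the map sending a hypercube $Q$ to the set of face-labels of the $\Theta$-classes of $Q$, and let $g:\mathcal{RS}(G)\to\mathcal{IS}(G^* )$ be the map sending a resonant set $S$ of $G$ to the corresponding set $S^*$ of vertices of $G^*$. Define $h:\mathcal{H}(R(G))\to\mathcal{IS}(G^* )$ by $h(Q)=g(f(Q))$. Then $h$ induces a bijection between the set of maximal hypercubes of $R(G)$ and the set of maximal independent sets of $G^*$. Under this bijection a $k$-dimensional maximal hypercube $Q$ of $R(G)$ ($k$ a positive integer) is mapped to a maximal independent set $h(Q)$ of $G^*$ of cardinality $k$ with the property that each vertex of $h(Q)$ corresponds to the face-label of a unique $\Theta$-class of $Q$.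
   Context: All graphs are finite. An edge of a graph with a perfect matching is allowed if it lies in some perfect matching. A graph (with a perfect matching) is elementary if all its allowed edges form a connected subgraph. Exterior vertices of a plane graph are those on the periphery of its infinite face. A plane elementary bipartite graph $G$ different from $K_2$ is peripherally 2-colorable if every vertex of $G$ has degree 2 or 3, all vertices of degree 3 (if any) are exterior vertices, and $G$ can be properly colored black and white (adjacent vertices get different colors) so that the vertices of degree 3 (if any) are alternately black and white along the clockwise orientation of the periphery of $G$. The inner dual $G^*$ of a plane graph $G$ has the finite faces of $G$ as vertices, two being adjacent if the two faces have an edge in common. A face is $M$-resonant, for a perfect matching $M$, if its periphery is an $M$-alternating cycle. A resonant set of $G$ is a set of pairwise vertex disjoint finite faces of $G$ that are all $M$-resonant for a common perfect matching $M$ of $G$. For peripherally 2-colorable $G$, a nonempty resonant set of $G$, viewed as a set of vertices of $G^*$, is an independent set of $G^*$. Resonance graph: the vertices of $R(G)$ are the perfect matchings of $G$; two perfect matchings are adjacent if their symmetric difference is the edge set of exactly one cycle which is the periphery of a finite face $s$ of $G$; then that edge has face-label $s$. The hypercube $Q_k$ is the Cartesian product of $k$ copies of $K_2$. A hypercube of $R(G)$ is a subgraph isomorphic to some $Q_k$; it is nontrivial if $k\ge1$, and maximal if it is not contained in any other hypercube of $R(G)$. The $\Theta$-classes of a $k$-dimensional hypercube are its $k$ classes of parallel edges. For a hypercube $Q$ of $R(G)$ all edges of a $\Theta$-class of $Q$ have the same face-label, called the face-label of that $\Theta$-class; the set of face-labels of the $\Theta$-classes of a $k$-dimensional hypercube,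 $k\ge 1$, is a resonant set of cardinality $k$. A maximal independent set is an independent set not properly contained in another independent set. *)

theory Defs
  imports "HOL-Analysis.Analysis"
begin

section \<open>Finite simple graphs\<close>

record 'a ugraph =
  verts :: "'a set"
  edges :: "'a set set"

definition simple_graph :: "('a, 'm) ugraph_scheme \<Rightarrow> bool" where
  "simple_graph G \<longleftrightarrow> finite (verts G) \<and> (\<forall>e\<in>edges G. e \<subseteq> verts G \<and> card e = 2)"

definition degree :: "('a, 'm) ugraph_scheme \<Rightarrow> 'a \<Rightarrow> nat" where
  "degree G v = card {e \<in> edges G. v \<in> e}"

definition connected_graph :: "('a, 'm) ugraph_scheme \<Rightarrow> bool" where
  "connected_graph G \<longleftrightarrow> verts G \<noteq> {} \<and>
     (\<forall>u\<in>verts G. \<forall>v\<in>verts G. (u, v) \<in> {(x, y). {x, y} \<in> edges G}\<^sup>*)"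

definition subgraph :: "'a ugraph \<Rightarrow> 'a ugraph \<Rightarrow> bool" where
  "subgraph H G \<longleftrightarrow> simple_graph H \<and> verts H \<subseteq> verts G \<and> edges H \<subseteq> edges G"

definition graph_iso ::
    "('a \<Rightarrow> 'b) \<Rightarrow> ('a, 'm) ugraph_scheme \<Rightarrow> ('b, 'n) ugraph_scheme \<Rightarrow> bool" where
  "graph_iso \<phi> G H \<longleftrightarrow> bij_betw \<phi> (verts G) (verts H) \<and>
     (\<forall>u\<in>verts G. \<forall>v\<in>verts G. {u, v} \<in> edges G \<longleftrightarrow> {\<phi> u, \<phi> v} \<in> edges H)"

definition independent_set :: "('a, 'm) ugraph_scheme \<Rightarrow> 'a set \<Rightarrow> bool" where
  "independent_set G I \<longleftrightarrow> I \<subseteq> verts G \<and> (\<forall>u\<in>I. \<forall>v\<in>I. {u, v} \<notin> edges G)"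

definition nonempty_independent_sets :: "('a, 'm) ugraph_scheme \<Rightarrow> 'a set set" where
  "nonempty_independent_sets G = {I. independent_set G I \<and> I \<noteq> {}}"

definition maximal_independent_sets :: "('a, 'm) ugraph_scheme \<Rightarrow> 'a set set" where
  "maximal_independent_sets G =
     {I. independent_set G I \<and> (\<forall>J. independent_set G J \<longrightarrow> \<not> I \<subset> J)}"

definition proper_2_coloring :: "('a, 'm) ugraph_scheme \<Rightarrow> ('a \<Rightarrow> bool) \<Rightarrow> bool" where
  "proper_2_coloring G c \<longleftrightarrow> (\<forall>u v. {u, v} \<in> edges G \<longrightarrow> c u \<noteq> c v)"

definition bipartite :: "('a, 'm) ugraph_scheme \<Rightarrow> bool" where
  "bipartite G \<longleftrightarrow> (\<exists>c. proper_2_coloring G c)"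

text \<open>A cycle is given by the cyclic sequence of its vertices.\<close>

definition cycle_edges :: "'a list \<Rightarrow> 'a set set" where
  "cycle_edges vs = {{vs ! i, vs ! (Suc i mod length vs)} | i. i < length vs}"

definition is_cycle :: "('a, 'm) ugraph_scheme \<Rightarrow> 'a list \<Rightarrow> bool" where
  "is_cycle G vs \<longleftrightarrow> 3 \<le> length vs \<and> distinct vs \<and> set vs \<subseteq> verts G \<and> cycle_edges vs \<subseteq> edges G"


section \<open>Perfect matchings and elementary graphs\<close>

definition perfect_matching :: "('a, 'm) ugraph_scheme \<Rightarrow> 'a set set \<Rightarrow> bool" where
  "perfect_matching G M \<longleftrightarrow> M \<subseteq> edges G \<and> (\<forall>v\<in>verts G. \<exists>!e. e \<in> M \<and> v \<in> e)"

definition allowed_edges :: "('a, 'm) ugraph_scheme \<Rightarrow> 'a set set" where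
  "allowed_edges G = {e \<in> edges G. \<exists>M. perfect_matching G M \<and> e \<in> M}"

definition elementary :: "('a, 'm) ugraph_scheme \<Rightarrow> bool" where
  "elementary G \<longleftrightarrow> (\<exists>M. perfect_matching G M) \<and>
     connected_graph \<lparr>verts = \<Union>(allowed_edges G), edges = allowed_edges G\<rparr>"

definition alternating_cycle ::
    "('a, 'm) ugraph_scheme \<Rightarrow> 'a set set \<Rightarrow> 'a list \<Rightarrow> bool" where
  "alternating_cycle G M vs \<longleftrightarrow> is_cycle G vs \<and>
     (\<forall>i<length vs.
        ({vs ! i, vs ! (Suc i mod length vs)} \<in> M) \<noteq>
        ({vs ! (Suc i mod length vs), vs ! (Suc (Suc i) mod length vs)} \<in> M))"


section \<open>Hypercubes\<close>

definition K2 :: "bool ugraph" where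
  "K2 = \<lparr>verts = {False, True}, edges = {{False, True}}\<rparr>"

definition cartesian_power :: "'a ugraph \<Rightarrow> nat \<Rightarrow> 'a list ugraph" where
  "cartesian_power X k =
     \<lparr>verts = {xs. length xs = k \<and> set xs \<subseteq> verts X},
      edges = {{xs, ys} | xs ys.
         length xs = k \<and> set xs \<subseteq> verts X \<and> length ys = k \<and> set ys \<subseteq> verts X \<and>
         (\<exists>i<k. {xs ! i, ys ! i} \<in> edges X \<and> (\<forall>j<k. j \<noteq> i \<longrightarrow> xs ! j = ys ! j))}\<rparr>"

definition hypercube :: "nat \<Rightarrow> bool list ugraph" where
  "hypercube k = cartesian_power K2 k"

definition is_hypercube_of :: "'a ugraph \<Rightarrow> nat \<Rightarrow> 'a ugraph \<Rightarrow> bool" where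
  "is_hypercube_of R k Q \<longleftrightarrow> subgraph Q R \<and> (\<exists>\<phi>. graph_iso \<phi> Q (hypercube k))"

definition nontrivial_hypercubes :: "'a ugraph \<Rightarrow> 'a ugraph set" where
  "nontrivial_hypercubes R = {Q. \<exists>k\<ge>1. is_hypercube_of R k Q}"

definition maximal_hypercubes :: "'a ugraph \<Rightarrow> 'a ugraph set" where
  "maximal_hypercubes R = {Q. (\<exists>k. is_hypercube_of R k Q) \<and>
     (\<forall>k' Q'. is_hypercube_of R k' Q' \<and> subgraph Q Q' \<longrightarrow> Q' = Q)}"

text \<open>
  The class of parallel edges in direction \<open>i\<close> consists of the edges whose ends differ in
  coordinate \<open>i\<close>.  Automorphisms of a hypercube permute the directions, so the set of all classes
  does not depend on the isomorphism \<open>\<phi>\<close>.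
\<close>

definition theta_classes :: "'a ugraph \<Rightarrow> 'a set set set" where
  "theta_classes Q = {T. \<exists>k \<phi> i. graph_iso \<phi> Q (hypercube k) \<and> i < k \<and>
     T = {{x, y} | x y. {x, y} \<in> edges Q \<and> \<phi> x ! i \<noteq> \<phi> y ! i}}"


section \<open>Plane graphs\<close>

text \<open>
  Vertices are points of the plane, identified with the complex numbers; \<open>curve G e\<close> is the
  point set of the arc that represents the edge \<open>e\<close> (its value is irrelevant for non-edges).
\<close>

record embedded_graph = "complex ugraph" +
  curve :: "complex set \<Rightarrow> complex set"

definition plane_graph :: "embedded_graph \<Rightarrow> bool" where
  "plane_graph G \<longleftrightarrow> simple_graph G \<and>
     (\<forall>e\<in>edges G. (\<exists>\<gamma>. arc \<gamma> \<and> path_image \<gamma> = curve G e \<and> {pathstart \<gamma>, pathfinish \<gamma>} = e)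
        \<and> curve G e \<inter> verts G = e) \<and>
     (\<forall>e\<in>edges G. \<forall>e'\<in>edges G. e \<noteq> e' \<longrightarrow> curve G e \<inter> curve G e' \<subseteq> verts G)"

definition drawing :: "embedded_graph \<Rightarrow> complex set" where
  "drawing G = verts G \<union> (\<Union>e\<in>edges G. curve G e)"

definition faces :: "embedded_graph \<Rightarrow> complex set set" where
  "faces G = components (- drawing G)"

definition finite_faces :: "embedded_graph \<Rightarrow> complex set set" where
  "finite_faces G = {s \<in> faces G. bounded s}"

text \<open>The drawing of a finite graph is compact, so exactly one face is unbounded.\<close>

definition infinite_face :: "embedded_graph \<Rightarrow> complex set" where
  "infinite_face G = (THE s. s \<in> faces G \<and> \<not> bounded s)"

definition boundary_verts :: "embedded_graph \<Rightarrow> complex set \<Rightarrow> complex set" where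
  "boundary_verts G s = verts G \<inter> frontier s"

definition boundary_edges :: "embedded_graph \<Rightarrow> complex set \<Rightarrow> complex set set" where
  "boundary_edges G s = {e \<in> edges G. curve G e \<subseteq> frontier s}"

text \<open>The periphery of the face \<open>s\<close> is the cycle \<open>vs\<close>.\<close>

definition periphery_cycle :: "embedded_graph \<Rightarrow> complex set \<Rightarrow> complex list \<Rightarrow> bool" where
  "periphery_cycle G s vs \<longleftrightarrow> is_cycle G vs \<and>
     set vs = boundary_verts G s \<and> cycle_edges vs = boundary_edges G s"

definition exterior_verts :: "embedded_graph \<Rightarrow> complex set" where
  "exterior_verts G = boundary_verts G (infinite_face G)"

definition inner_dual :: "embedded_graph \<Rightarrow> complex set ugraph" where
  "inner_dual G =
     \<lparr>verts = finite_faces G,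
      edges = {{s, t} | s t. s \<in> finite_faces G \<and> t \<in> finite_faces G \<and> s \<noteq> t \<and>
                 boundary_edges G s \<inter> boundary_edges G t \<noteq> {}}\<rparr>"

text \<open>
  Cyclically consecutive elements of \<open>ds\<close> get different colors.  This does not depend on the
  direction in which \<open>ds\<close> is read, nor on where the reading starts.
\<close>

definition cyclically_alternating :: "('a \<Rightarrow> bool) \<Rightarrow> 'a list \<Rightarrow> bool" where
  "cyclically_alternating c ds \<longleftrightarrow>
     (\<forall>i<length ds. c (ds ! i) \<noteq> c (ds ! (Suc i mod length ds)))"

text \<open>
  An elementary bipartite graph other than \<open>K2\<close> is 2-connected, so the periphery of its infinite
  face is a cycle, which has a sequence \<open>vs\<close> as below.  It may be traversed clockwise or
  anticlockwise, since alternation does not depend on the direction.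
\<close>

definition peripherally_2_colorable :: "embedded_graph \<Rightarrow> bool" where
  "peripherally_2_colorable G \<longleftrightarrow>
     plane_graph G \<and> bipartite G \<and> elementary G \<and> \<not> (\<exists>\<phi>. graph_iso \<phi> G K2) \<and>
     (\<forall>v\<in>verts G. degree G v = 2 \<or> degree G v = 3) \<and>
     (\<forall>v\<in>verts G. degree G v = 3 \<longrightarrow> v \<in> exterior_verts G) \<and>
     (\<exists>c vs. proper_2_coloring G c \<and> periphery_cycle G (infinite_face G) vs \<and>
        cyclically_alternating c (filter (\<lambda>v. degree G v = 3) vs))"


section \<open>Resonant sets and the resonance graph\<close>

definition resonant_face :: "embedded_graph \<Rightarrow> complex set set \<Rightarrow> complex set \<Rightarrow> bool" where
  "resonant_face G M s \<longleftrightarrow> (\<exists>vs. periphery_cycle G s vs \<and> alternating_cycle G M vs)"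

definition resonant_set :: "embedded_graph \<Rightarrow> complex set set \<Rightarrow> bool" where
  "resonant_set G S \<longleftrightarrow> S \<subseteq> finite_faces G \<and>
     (\<forall>s\<in>S. \<forall>t\<in>S. s \<noteq> t \<longrightarrow> boundary_verts G s \<inter> boundary_verts G t = {}) \<and>
     (\<exists>M. perfect_matching G M \<and> (\<forall>s\<in>S. resonant_face G M s))"

definition nonempty_resonant_sets :: "embedded_graph \<Rightarrow> complex set set set" where
  "nonempty_resonant_sets G = {S. resonant_set G S \<and> S \<noteq> {}}"

text \<open>\<open>e\<close> is an edge of the resonance graph with face-label \<open>s\<close>.\<close>

definition resonance_edge :: "embedded_graph \<Rightarrow> complex set set set \<Rightarrow> complex set \<Rightarrow> bool" where
  "resonance_edge G e s \<longleftrightarrow> s \<in> finite_faces G \<and>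
     (\<exists>M N vs. perfect_matching G M \<and> perfect_matching G N \<and> e = {M, N} \<and>
        periphery_cycle G s vs \<and> sym_diff M N = cycle_edges vs)"

definition resonance_graph :: "embedded_graph \<Rightarrow> complex set set ugraph" where
  "resonance_graph G =
     \<lparr>verts = {M. perfect_matching G M}, edges = {e. \<exists>s. resonance_edge G e s}\<rparr>"

text \<open>\<open>s\<close> is the common face-label of all edges in the \<open>\<Theta>\<close>-class \<open>T\<close>.\<close>

definition class_label :: "embedded_graph \<Rightarrow> complex set set set set \<Rightarrow> complex set \<Rightarrow> bool" where
  "class_label G T s \<longleftrightarrow> s \<in> finite_faces G \<and> (\<forall>e\<in>T. resonance_edge G e s)"

definition hypercube_labels :: "embedded_graph \<Rightarrow> complex set set ugraph \<Rightarrow> complex set set" where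
  "hypercube_labels G Q = {s. \<exists>T\<in>theta_classes Q. class_label G T s}"

text \<open>
  The vertices of the inner dual are the finite faces themselves, so the set of vertices that
  corresponds to a set of finite faces is that set.
\<close>

definition dual_vertices :: "embedded_graph \<Rightarrow> complex set set \<Rightarrow> complex set set" where
  "dual_vertices G S = {v \<in> verts (inner_dual G). v \<in> S}"

end

theory Submission
  imports Defs
begin

text \<open>
  The periphery is a cycle, and all other edges lie on paths, called chords below, which join two
  vertices of degree 3 of the periphery and whose inner vertices have degree 2
  (\<open>chord_decomposition\<close>).  By Janiszewski's theorem a chord is drawn inside the periphery
  (\<open>chord_inside\<close>).  Cutting the inside along one chord after the other, by the theta curve theorem,
  shows that the finite faces are bounded by cycles, that an edge of the periphery lies on one of
  these cycles and any other edge on two, and that every even edge set is the sum modulo 2 of the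
  boundaries of a set of finite faces (\<open>face_cycles_step\<close>, \<open>face_system\<close>).  This set is unique
  (\<open>mod2_sum_inj\<close>).

  The two ends of a chord have an even number of vertices of degree 3 between them on the periphery,
  because chords do not cross.  As the colors alternate, the ends have different colors, so every
  chord has an odd number of edges; the same holds for the segments of the periphery between
  consecutive vertices of degree 3.  Therefore a perfect matching \<open>M0\<close> exists that leaves every vertex
  of degree 3 along its chord (\<open>ex_root_matching\<close>).  The boundary of a finite face passes alternately
  along chords and segments of the periphery, so every finite face is resonant for \<open>M0\<close>.

  For any perfect matching \<open>M\<close>, the sum of \<open>M0\<close> and \<open>M\<close> is even, hence the sum of the boundaries of a
  set \<open>J\<close> of finite faces.  If two faces in \<open>J\<close> were adjacent, they would meet at the end of a chord,
  and \<open>M\<close> would contain both edges of the periphery there.  So \<open>J\<close> is an independent set of the inner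
  dual.  Conversely, exchanging the edges of \<open>M0\<close> along the faces of an independent set gives a perfect
  matching.  Thus perfect matchings correspond to independent sets, and an edge of the resonance graph
  with face-label \<open>s\<close> adds or removes the element \<open>s\<close> (\<open>matching_of_surj\<close>, \<open>matching_of_perfect\<close>,
  \<open>matching_of_flip_iff\<close>).

  In other words, the resonance graph is the covering graph of the simplicial complex of independent
  sets.  A hypercube in such a graph consists of all sets between some \<open>A\<close> and \<open>A \<union> S\<close>, where \<open>S\<close> is
  the set of its labels (\<open>hypercube_is_interval\<close>).  It is maximal if and only if \<open>A\<close> is empty and \<open>S\<close>
  is a maximal independent set (\<open>maximal_hypercubes_eq\<close>), and \<open>h\<close> maps it to \<open>S\<close>.
\<close>

section \<open>Paths and cycles as vertex lists\<close>

definition path_edges :: "'a list \<Rightarrow> 'a set set" where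
  "path_edges xs = {{xs ! i, xs ! Suc i} | i. Suc i < length xs}"

lemma path_edges_Nil [simp]: "path_edges [] = {}"
  and path_edges_single [simp]: "path_edges [x] = {}"
  by (auto simp: path_edges_def)

lemma path_edges_Cons [simp]: "path_edges (x # y # zs) = insert {x, y} (path_edges (y # zs))"
proof -
  have "path_edges (x # y # zs) =
      (\<lambda>i. {(x # y # zs) ! i, (x # y # zs) ! Suc i}) ` {i. Suc i < length (x # y # zs)}"
    by (auto simp: path_edges_def)
  also have "{i. Suc i < length (x # y # zs)} = insert 0 (Suc ` {i. Suc i < length (y # zs)})"
    by (auto simp: image_iff less_Suc_eq_0_disj)
  finally show ?thesis
    by (simp add: image_image path_edges_def setcompr_eq_image)
qed

lemma path_edges_append:
  "path_edges (xs @ x # ys) = path_edges (xs @ [x]) \<union> path_edges (x # ys)"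
proof (induction xs)
  case (Cons a xs)
  then show ?case by (cases xs) auto
qed simp

lemma path_edges_rev: "path_edges (rev xs) = path_edges xs"
proof (induction xs)
  case (Cons x xs)
  show ?case
  proof (cases xs)
    case (Cons y zs)
    have "path_edges (rev (x # y # zs)) = path_edges (rev zs @ [y]) \<union> path_edges [y, x]"
      using path_edges_append[of "rev zs" y "[x]"] by simp
    also have "\<dots> = path_edges (x # y # zs)"
      using Cons.IH \<open>xs = y # zs\<close> by (auto simp: insert_commute)
    finally show ?thesis using \<open>xs = y # zs\<close> by simp
  qed simp
qed simp

lemma Union_path_edges: "length xs \<ge> 2 \<Longrightarrow> \<Union> (path_edges xs) = set xs"
proof (induction xs rule: induct_list012)
  case (3 x y zs)
  then show ?case by (cases zs) auto
qed auto

lemma Union_path_edges_subset: "\<Union> (path_edges xs) \<subseteq> set xs"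
  by (auto simp: path_edges_def)

lemma finite_path_edges [simp]: "finite (path_edges xs)"
  by (induction xs rule: induct_list012) auto

lemma cycle_edges_eq_path_edges:
  assumes "vs \<noteq> []"
  shows "cycle_edges vs = path_edges (vs @ [hd vs])"
proof -
  have "(vs @ [hd vs]) ! i = vs ! i" "(vs @ [hd vs]) ! Suc i = vs ! (Suc i mod length vs)"
    if "i < length vs" for i
    using that assms by (cases "Suc i = length vs"; simp add: nth_append hd_conv_nth)+
  then have "{vs ! i, vs ! (Suc i mod length vs)} = {(vs @ [hd vs]) ! i, (vs @ [hd vs]) ! Suc i}"
    if "i < length vs" for i
    using that by simp
  then show ?thesis unfolding cycle_edges_def path_edges_def setcompr_eq_image
    by (intro image_cong) simp_all
qed

lemma cycle_edges_split:
  "cycle_edges (xs @ u # ys @ v # zs) = path_edges (u # ys @ [v]) \<union> path_edges (v # zs @ xs @ [u])"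
proof (cases xs)
  case Nil
  then have "cycle_edges (xs @ u # ys @ v # zs) = path_edges ((u # ys) @ v # (zs @ [u]))"
    by (simp add: cycle_edges_eq_path_edges)
  then show ?thesis using path_edges_append[of "u # ys" v "zs @ [u]"] Nil by simp
next
  case (Cons a as)
  have "cycle_edges (xs @ u # ys @ v # zs) = path_edges (xs @ u # (ys @ v # zs @ [a]))"
    using Cons by (simp add: cycle_edges_eq_path_edges)
  also have "\<dots> = path_edges (xs @ [u]) \<union> path_edges ((u # ys) @ v # (zs @ [a]))"
    by (subst path_edges_append) simp
  also have "\<dots> = path_edges (a # as @ [u]) \<union> (path_edges (u # ys @ [v]) \<union> path_edges ((v # zs) @ [a]))"
    using path_edges_append[of "u # ys" v "zs @ [a]"] Cons by simp
  also have "\<dots> = path_edges (u # ys @ [v]) \<union> path_edges ((v # zs) @ a # (as @ [u]))"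
    using path_edges_append[of "v # zs" a "as @ [u]"] by auto
  finally show ?thesis using Cons by simp
qed

lemma cycle_edges_rotate: "xs @ ys \<noteq> [] \<Longrightarrow> cycle_edges (xs @ ys) = cycle_edges (ys @ xs)"
proof (cases xs; cases ys)
  fix a as b bs assume *: "xs = a # as" "ys = b # bs"
  have "cycle_edges ([] @ a # as @ b # bs) = cycle_edges ([] @ b # bs @ a # as)"
    unfolding cycle_edges_split by auto
  then show ?thesis using * by simp
qed auto

lemma is_cycle_rotate: "is_cycle G (xs @ ys) \<longleftrightarrow> is_cycle G (ys @ xs)"
proof (cases "xs @ ys = []")
  case False
  then show ?thesis
    using cycle_edges_rotate[OF False] by (auto simp: is_cycle_def)
qed simp

lemma cycle_edges_at:
  assumes "distinct (v # w)" "length w \<ge> 2"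
  shows "{e \<in> cycle_edges (v # w). v \<in> e} = {{v, hd w}, {v, last w}}"
    and "{v, hd w} \<noteq> {v, last w}"
proof -
  obtain a b c where w: "w = a # b @ [c]"
    using assms(2) by (metis One_nat_def Suc_1 append_butlast_last_id length_0_conv length_Cons
        list.exhaust not_less_eq_eq le_zero_eq)
  have "cycle_edges (v # w) = path_edges (v # (w @ [v]))"
    by (simp add: cycle_edges_eq_path_edges)
  also have "\<dots> = insert {v, a} (path_edges ((a # b) @ c # [v]))"
    by (simp add: w)
  also have "\<dots> = insert {v, a} (insert {v, c} (path_edges w))"
    using path_edges_append[of "a # b" c "[v]"] by (auto simp: w insert_commute)
  finally have "cycle_edges (v # w) = insert {v, a} (insert {v, c} (path_edges w))" .
  moreover have "v \<notin> e" if "e \<in> path_edges w" for e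
    using that assms Union_path_edges_subset[of w] by auto
  ultimately show "{e \<in> cycle_edges (v # w). v \<in> e} = {{v, hd w}, {v, last w}}"
    by (auto simp: w)
  show "{v, hd w} \<noteq> {v, last w}"
    using assms by (auto simp: w doubleton_eq_iff)
qed

lemma Union_cycle_edges: "is_cycle G vs \<Longrightarrow> \<Union> (cycle_edges vs) = set vs"
proof -
  assume "is_cycle G vs"
  then have "length vs \<ge> 3" by (simp add: is_cycle_def)
  then have "vs \<noteq> []" "length (vs @ [hd vs]) \<ge> 2" by auto
  then show ?thesis using Union_path_edges[of "vs @ [hd vs]"] cycle_edges_eq_path_edges[of vs]
    by auto
qed

lemma cycle_edges_at_card:
  assumes "is_cycle G vs"
  shows "card {e \<in> cycle_edges vs. v \<in> e} = (if v \<in> set vs then 2 else 0)"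
proof (cases "v \<in> set vs")
  case True
  then obtain xs ys where vs: "vs = xs @ v # ys" by (meson split_list)
  then have eq: "cycle_edges vs = cycle_edges (v # (ys @ xs))"
    using cycle_edges_rotate[of xs "v # ys"] by simp
  have "distinct (v # (ys @ xs))" "length (ys @ xs) \<ge> 2"
    using assms vs by (auto simp: is_cycle_def)
  from cycle_edges_at[OF this] show ?thesis unfolding eq using True by simp
next
  case False
  then have "{e \<in> cycle_edges vs. v \<in> e} = {}"
    using Union_cycle_edges[OF assms] by auto
  then show ?thesis using False by (simp only: card.empty if_False)
qed

lemma path_end_edge:
  assumes "distinct (u # ys @ [v])" "{u, v} \<in> path_edges (u # ys @ [v])"
  shows "ys = []"
proof (rule ccontr)
  assume "ys \<noteq> []"
  then obtain a as where ys: "ys = a # as" by (cases ys) auto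
  then have "{u, v} \<in> insert {u, a} (path_edges (a # as @ [v]))" using assms by simp
  moreover have "{u, v} \<noteq> {u, a}" using assms ys by (auto simp: doubleton_eq_iff)
  ultimately have "u \<in> \<Union> (path_edges (a # as @ [v]))" by auto
  then show False using Union_path_edges_subset[of "a # as @ [v]"] assms ys by auto
qed

lemma path_edges_disjoint:
  assumes "distinct (u # ys @ v # ws)" "length (u # ys @ v # ws) \<ge> 3"
  shows "path_edges (u # ys @ [v]) \<inter> path_edges (v # ws @ [u]) = {}"
proof (rule ccontr)
  assume "\<not> ?thesis"
  then obtain e where e: "e \<in> path_edges (u # ys @ [v])" "e \<in> path_edges (v # ws @ [u])" by blast
  then have "e \<subseteq> {u, v}"
    using Union_path_edges_subset[of "u # ys @ [v]"] Union_path_edges_subset[of "v # ws @ [u]"] assms(1)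
    by fastforce
  moreover obtain i where "Suc i < length (u # ys @ [v])" "e = {(u # ys @ [v]) ! i, (u # ys @ [v]) ! Suc i}"
    using e(1) unfolding path_edges_def by blast
  moreover have "distinct (u # ys @ [v])" using assms by auto
  ultimately have "card e = 2"
    by (metis Suc_lessD card_2_iff n_not_Suc_n nth_eq_iff_index_eq)
  with \<open>e \<subseteq> {u, v}\<close> have "e = {u, v}"
    using assms by (intro card_subset_eq) auto
  then have "ys = []" "ws = []"
    using path_end_edge[of u ys v] path_end_edge[of v ws u] e assms by (auto simp: insert_commute)
  then show False using assms by simp
qed

lemma path_edges_in_at:
  assumes "distinct xs" "Suc (Suc i) < length xs"
  shows "{xs ! i, xs ! Suc i} \<noteq> {xs ! Suc i, xs ! Suc (Suc i)}"
  using assms by (auto simp: doubleton_eq_iff nth_eq_iff_index_eq)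

text \<open>Membership passes from each edge of the path to the next one.  The hypothesis holds for even
  edge sets if the inner vertices of the path have degree 2.\<close>

lemma path_all_or_none:
  assumes step: "\<And>i. Suc (Suc i) < length xs \<Longrightarrow>
      {xs ! i, xs ! Suc i} \<in> Z \<longleftrightarrow> {xs ! Suc i, xs ! Suc (Suc i)} \<in> Z"
    and e: "e \<in> path_edges xs" "e \<in> Z"
  shows "path_edges xs \<subseteq> Z"
proof -
  have const: "{xs ! i, xs ! Suc i} \<in> Z \<longleftrightarrow> {xs ! 0, xs ! Suc 0} \<in> Z" if "Suc i < length xs" for i
    using that by (induction i) (use step in auto)
  with e have "{xs ! 0, xs ! Suc 0} \<in> Z" by (auto simp: path_edges_def)
  with const show ?thesis by (auto simp: path_edges_def)
qed

section \<open>Curves drawn by paths and cycles\<close>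

definition drawn :: "embedded_graph \<Rightarrow> complex set set \<Rightarrow> complex set" where
  "drawn G X = (\<Union>e\<in>X. curve G e)"

lemma drawn_Un: "drawn G (X \<union> Y) = drawn G X \<union> drawn G Y"
  and drawn_mono: "X \<subseteq> Y \<Longrightarrow> drawn G X \<subseteq> drawn G Y"
  and drawn_insert: "drawn G (insert e X) = curve G e \<union> drawn G X"
  by (auto simp: drawn_def)

locale plane =
  fixes G :: embedded_graph
  assumes plane: "plane_graph G"
begin

lemma simple: "simple_graph G"
  using plane by (simp add: plane_graph_def)

lemma finite_verts: "finite (verts G)"
  and edge_subset: "e \<in> edges G \<Longrightarrow> e \<subseteq> verts G"
  and edge_card: "e \<in> edges G \<Longrightarrow> card e = 2"
  using simple by (auto simp: simple_graph_def)

lemma finite_edges: "finite (edges G)"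
  using finite_verts edge_subset by (meson PowI finite_Pow_iff rev_finite_subset subsetI)

lemma curve_arc:
  assumes "{x, y} \<in> edges G"
  obtains \<gamma> where "arc \<gamma>" "path_image \<gamma> = curve G {x, y}" "pathstart \<gamma> = x" "pathfinish \<gamma> = y"
proof -
  obtain \<gamma> where \<gamma>: "arc \<gamma>" "path_image \<gamma> = curve G {x, y}" "{pathstart \<gamma>, pathfinish \<gamma>} = {x, y}"
    using plane assms unfolding plane_graph_def by meson
  show thesis
  proof (cases "pathstart \<gamma> = x")
    case True
    then show ?thesis using \<gamma> that by (auto simp: doubleton_eq_iff)
  next
    case False
    then have "pathstart (reversepath \<gamma>) = x" "pathfinish (reversepath \<gamma>) = y"
      using \<gamma>(3) by (auto simp: doubleton_eq_iff)
    then show ?thesis using \<gamma> that[of "reversepath \<gamma>"] by (simp add: arc_reversepath)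
  qed
qed

lemma curve_verts: "e \<in> edges G \<Longrightarrow> curve G e \<inter> verts G = e"
  using plane by (auto simp: plane_graph_def)

lemma curve_inter:
  "e \<in> edges G \<Longrightarrow> e' \<in> edges G \<Longrightarrow> e \<noteq> e' \<Longrightarrow> curve G e \<inter> curve G e' \<subseteq> e \<inter> e'"
proof -
  assume e: "e \<in> edges G" "e' \<in> edges G" "e \<noteq> e'"
  have "curve G e \<inter> curve G e' \<subseteq> verts G"
    using plane e unfolding plane_graph_def by meson
  then show ?thesis using curve_verts[OF e(1)] curve_verts[OF e(2)] by blast
qed

lemma drawn_verts: "X \<subseteq> edges G \<Longrightarrow> drawn G X \<inter> verts G = \<Union> X"
  using curve_verts by (fastforce simp: drawn_def)

lemma drawn_inter:
  assumes "X \<subseteq> edges G" "Y \<subseteq> edges G" "X \<inter> Y = {}"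
  shows "drawn G X \<inter> drawn G Y = \<Union> X \<inter> \<Union> Y"
proof
  show "drawn G X \<inter> drawn G Y \<subseteq> \<Union> X \<inter> \<Union> Y"
  proof
    fix z assume "z \<in> drawn G X \<inter> drawn G Y"
    then obtain e e' where e: "e \<in> X" "e' \<in> Y" "z \<in> curve G e \<inter> curve G e'"
      by (auto simp: drawn_def)
    moreover from e assms have "e \<noteq> e'" "e \<in> edges G" "e' \<in> edges G" by auto
    ultimately show "z \<in> \<Union> X \<inter> \<Union> Y" using curve_inter[of e e'] by blast
  qed
  show "\<Union> X \<inter> \<Union> Y \<subseteq> drawn G X \<inter> drawn G Y"
    using drawn_verts[OF assms(1)] drawn_verts[OF assms(2)] by blast
qed

text \<open>An arc is uncountable, so it has a point that is not a vertex, and such a point lies on no other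
  curve.\<close>

lemma curve_subset_drawn_iff:
  assumes "e \<in> edges G" "X \<subseteq> edges G"
  shows "curve G e \<subseteq> drawn G X \<longleftrightarrow> e \<in> X"
proof
  assume sub: "curve G e \<subseteq> drawn G X"
  obtain x y where "e = {x, y}" using edge_card[OF assms(1)] by (auto simp: card_2_iff)
  then obtain \<gamma> where \<gamma>: "arc \<gamma>" "path_image \<gamma> = curve G e"
    using curve_arc assms(1) by metis
  then have "infinite (curve G e)"
    by (metis arc_image_uncountable uncountable_infinite)
  then obtain z where z: "z \<in> curve G e" "z \<notin> verts G"
    using finite_verts by (meson finite_subset subsetI)
  then obtain e' where e': "e' \<in> X" "z \<in> curve G e'" using sub by (auto simp: drawn_def)
  then have "e = e'"
    using z curve_inter[of e e'] assms edge_subset[of e] by blast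
  then show "e \<in> X" using e' by simp
qed (auto simp: drawn_def)

lemma compact_drawn:
  assumes "X \<subseteq> edges G"
  shows "compact (drawn G X)"
proof -
  have "compact (curve G e)" if "e \<in> X" for e
  proof -
    have "card e = 2" using edge_card assms that by blast
    then obtain x y where "e = {x, y}" by (auto simp: card_2_iff)
    then show ?thesis using curve_arc[of x y] compact_arc_image assms that by (metis subsetD)
  qed
  then show ?thesis unfolding drawn_def
    using assms finite_edges by (intro compact_UN) (auto intro: finite_subset)
qed

lemma path_arc:
  assumes "distinct xs" "length xs \<ge> 2" "path_edges xs \<subseteq> edges G"
  shows "\<exists>\<gamma>. arc \<gamma> \<and> path_image \<gamma> = drawn G (path_edges xs) \<and> pathstart \<gamma> = hd xs \<and> pathfinish \<gamma> = last xs"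
  using assms
proof (induction xs rule: induct_list012)
  case (3 x y zs)
  obtain \<gamma> where \<gamma>: "arc \<gamma>" "path_image \<gamma> = curve G {x, y}" "pathstart \<gamma> = x" "pathfinish \<gamma> = y"
    using curve_arc[of x y] 3 by auto
  show ?case
  proof (cases zs)
    case Nil
    then show ?thesis using \<gamma> by (auto simp: drawn_def)
  next
    case (Cons z zs')
    then obtain \<delta> where \<delta>: "arc \<delta>" "path_image \<delta> = drawn G (path_edges (y # zs))"
      "pathstart \<delta> = y" "pathfinish \<delta> = last (y # zs)"
      using 3 by auto
    have U: "\<Union> (path_edges (y # zs)) = set (y # zs)" using Cons by (intro Union_path_edges) simp
    have "{x, y} \<notin> path_edges (y # zs)" using U 3 by auto
    then have "drawn G {{x, y}} \<inter> drawn G (path_edges (y # zs)) = {x, y} \<inter> set (y # zs)"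
      using drawn_inter[of "{{x, y}}" "path_edges (y # zs)"] 3 U by auto
    then have "path_image \<gamma> \<inter> path_image \<delta> \<subseteq> {pathstart \<delta>}"
      using \<gamma> \<delta> 3 by (auto simp: drawn_def)
    then have "arc (\<gamma> +++ \<delta>)" using arc_join \<gamma> \<delta> by metis
    then show ?thesis
      using \<gamma> \<delta> by (intro exI[of _ "\<gamma> +++ \<delta>"]) (auto simp: path_image_join drawn_insert)
  qed
qed auto

end

section \<open>Chords of the periphery\<close>

text \<open>The assumption \<open>edge_closed\<close> says that the graph is connected, in the form in which it is
  applied below: to edge sets rather than to walks.\<close>

locale chorded_cycle =
  fixes G :: "('a, 'm) ugraph_scheme" and cs :: "'a list"
  assumes simple_graph: "simple_graph G"
    and outer_cycle: "is_cycle G cs"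
    and edge_closed: "\<lbrakk>X \<subseteq> edges G; X \<noteq> {};
      \<And>e e' v. e \<in> X \<Longrightarrow> e' \<in> edges G \<Longrightarrow> v \<in> e \<Longrightarrow> v \<in> e' \<Longrightarrow> e' \<in> X\<rbrakk> \<Longrightarrow> X = edges G"
    and degree: "v \<in> verts G \<Longrightarrow> degree G v = 2 \<or> degree G v = 3"
    and degree_3: "v \<in> verts G \<Longrightarrow> degree G v = 3 \<Longrightarrow> v \<in> set cs"
begin

abbreviation C :: "'a set set" where "C \<equiv> cycle_edges cs"

abbreviation star :: "'a \<Rightarrow> 'a set set" where "star v \<equiv> {e \<in> edges G. v \<in> e}"

definition chord :: "'a list \<Rightarrow> bool" where
  "chord P \<longleftrightarrow> (\<exists>u ps v. P = u # ps @ [v] \<and> distinct P \<and> path_edges P \<subseteq> edges G - C \<and>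
     u \<in> set cs \<and> v \<in> set cs \<and> set ps \<inter> set cs = {})"

lemma finite_V: "finite (verts G)" and edge_V: "e \<in> edges G \<Longrightarrow> e \<subseteq> verts G"
  and edge_card_2: "e \<in> edges G \<Longrightarrow> card e = 2"
  using simple_graph by (auto simp: simple_graph_def)

lemma finite_E: "finite (edges G)"
  using finite_V edge_V by (meson PowI finite_Pow_iff rev_finite_subset subsetI)

lemma C_subset: "C \<subseteq> edges G" and cs_subset: "set cs \<subseteq> verts G"
  using outer_cycle by (auto simp: is_cycle_def)

lemma Union_C: "\<Union> C = set cs"
  using Union_cycle_edges outer_cycle .

lemma C_nonempty: "C \<noteq> {}"
proof -
  have "cs \<noteq> []" using outer_cycle by (auto simp: is_cycle_def)
  then show ?thesis using Union_C by auto
qed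

lemma star_off_cycle:
  assumes "v \<in> verts G" "v \<notin> set cs"
  shows "card (star v) = 2" "star v \<inter> C = {}"
proof -
  show "card (star v) = 2" using degree degree_3 assms by (auto simp: degree_def)
  show "star v \<inter> C = {}" using assms Union_C by blast
qed

lemma star_inter_C: "v \<in> set cs \<Longrightarrow> card (star v \<inter> C) = 2"
proof -
  assume "v \<in> set cs"
  moreover have "star v \<inter> C = {e \<in> C. v \<in> e}" using C_subset by auto
  ultimately show ?thesis using cycle_edges_at_card[OF outer_cycle] by simp
qed

lemma star_diff_C: "v \<in> set cs \<Longrightarrow> card (star v - C) = degree G v - 2"
  using star_inter_C[of v] card_Diff_subset_Int[of "star v" C] finite_E by (simp add: degree_def)

lemma two_off_cycle_edges_eq:
  assumes "v \<in> set cs" "e \<in> star v - C" "e' \<in> star v - C"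
  shows "e = e'"
proof -
  have "card (star v - C) \<le> 1"
  proof -
    have "v \<in> verts G" using assms(1) cs_subset by blast
    then have "degree G v \<le> 3" using degree by fastforce
    then show ?thesis using star_diff_C[OF assms(1)] by linarith
  qed
  then show ?thesis
    using assms(2,3) finite_E by (auto simp: card_le_Suc0_iff_eq)
qed

text \<open>An inner vertex of a chord has degree 2, and an end of a chord has only one edge off the
  periphery.\<close>

lemma chord_saturated:
  assumes P: "chord P" and x: "x \<in> set P" and e: "e \<in> edges G" "x \<in> e" "e \<notin> C"
  shows "e \<in> path_edges P"
proof -
  obtain u ps v where P': "P = u # ps @ [v]" "distinct P" "path_edges P \<subseteq> edges G - C"
     "u \<in> set cs" "v \<in> set cs" "set ps \<inter> set cs = {}"
    using P unfolding chord_def by blast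
  have U: "\<Union> (path_edges P) = set P" by (rule Union_path_edges) (simp add: P'(1))
  show ?thesis
  proof (cases "x \<in> set cs")
    case True
    obtain e' where e': "e' \<in> path_edges P" "x \<in> e'" using U x by blast
    then have "e' \<in> star x - C" using P'(3) by auto
    moreover have "e \<in> star x - C" using e by auto
    ultimately have "e' = e" by (rule two_off_cycle_edges_eq[OF True])
    then show ?thesis using e'(1) by simp
  next
    case False
    then have "x \<in> set ps" using x P' by auto
    then obtain i where i: "i < length ps" "x = ps ! i" by (auto simp: in_set_conv_nth)
    have xi: "x = P ! Suc i" and len: "Suc (Suc i) < length P"
      using i by (auto simp: P'(1) nth_append)
    let ?a = "{P ! i, P ! Suc i}" and ?b = "{P ! Suc i, P ! Suc (Suc i)}"
    have ne: "?a \<noteq> ?b" using path_edges_in_at[OF P'(2) len] .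
    have mem: "?a \<in> path_edges P" "?b \<in> path_edges P" using len by (auto simp: path_edges_def)
    have "x \<in> verts G" using e edge_V by blast
    then have "card (star x) = 2" using star_off_cycle False by blast
    moreover have "{?a, ?b} \<subseteq> star x" using mem P'(3) xi by auto
    moreover have "card {?a, ?b} = 2" using ne by simp
    ultimately have "star x = {?a, ?b}" using finite_E by (intro card_subset_eq[symmetric]) auto
    moreover have "e \<in> star x" using e by simp
    ultimately have "e = ?a \<or> e = ?b" by blast
    then show ?thesis using mem by metis
  qed
qed

lemma chord_disjoint:
  assumes "chord P" "chord Q" "path_edges P \<inter> path_edges Q = {}"
  shows "set P \<inter> set Q = {}"
proof (rule ccontr)
  assume "\<not> ?thesis"
  then obtain x where x: "x \<in> set P" "x \<in> set Q" by blast
  have "length P \<ge> 2" "path_edges P \<subseteq> edges G - C" using assms(1) by (auto simp: chord_def)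
  moreover from this x obtain e where "e \<in> path_edges P" "x \<in> e"
    using Union_path_edges[of P] by auto
  ultimately have "e \<in> path_edges P" "x \<in> e" "e \<in> edges G" "e \<notin> C" by auto
  then show False using chord_saturated[OF assms(2) x(2)] assms(3) by blast
qed

text \<open>Walking from a degree 3 vertex along its edge off the periphery, the walk is forced at every
  vertex of degree 2, so it neither ends nor meets itself before it returns to the periphery.\<close>

lemma chord_starting_with:
  assumes x0: "x0 \<in> set cs" and e0: "{x0, y} \<in> edges G - C"
  shows "\<exists>P. chord P \<and> {x0, y} \<in> path_edges P"
proof (cases "y \<in> set cs")
  case True
  have "x0 \<noteq> y" using e0 edge_card_2[of "{x0, y}"] by auto
  then have "chord (x0 # [] @ [y])" unfolding chord_def using e0 x0 True
    by (intro exI[of _ x0] exI[of _ "[]"] exI[of _ y]) auto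
  then show ?thesis by (intro exI[of _ "[x0, y]"]) simp
next
  case False
  define L where "L = {xs. distinct (x0 # y # xs) \<and> set (y # xs) \<inter> set cs = {} \<and>
    path_edges (x0 # y # xs) \<subseteq> edges G - C}"
  have "x0 \<noteq> y" using e0 edge_card_2[of "{x0, y}"] by auto
  then have L0: "[] \<in> L" using e0 False by (simp add: L_def)
  have bound: "length xs \<le> card (verts G)" if "xs \<in> L" for xs
  proof -
    have "set (x0 # y # xs) = \<Union> (path_edges (x0 # y # xs))" by (rule Union_path_edges[symmetric]) simp
    also have "\<dots> \<subseteq> verts G" using that edge_V by (auto simp: L_def)
    finally have "card (set xs) \<le> card (verts G)" using finite_V by (intro card_mono) auto
    then show ?thesis using that by (simp add: L_def distinct_card)
  qed
  obtain xs where xs: "xs \<in> L" and max: "\<And>zs. zs \<in> L \<Longrightarrow> length zs \<le> length xs"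
  proof -
    have "\<exists>xs. xs \<in> L \<and> (\<forall>zs. zs \<in> L \<longrightarrow> length zs \<le> length xs)"
      by (rule ex_has_greatest_nat[of "\<lambda>xs. xs \<in> L" "[]" length "Suc (card (verts G))"])
        (use L0 bound in \<open>auto simp: less_Suc_eq_le\<close>)
    then show thesis using that by blast
  qed
  define P where "P = x0 # y # xs"
  have P: "distinct P" "set (tl P) \<inter> set cs = {}" "path_edges P \<subseteq> edges G - C" "length P \<ge> 2"
    using xs by (auto simp: L_def P_def)
  define w where "w = P ! (length P - 2)"
  define z where "z = last P"
  have z_nth: "z = P ! (length P - 1)" using P(4) by (simp add: z_def last_conv_nth P_def)
  have "z \<in> set (tl P)" by (simp add: z_def P_def)
  then have z_off: "z \<notin> set cs" using P(2) by blast
  have wz: "{w, z} \<in> path_edges P"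
    unfolding path_edges_def w_def z_nth using P(4)
    by (intro CollectI exI[of _ "length P - 2"]) (use P(4) in \<open>auto simp: numeral_2_eq_2 Suc_diff_Suc\<close>)
  then have wzE: "{w, z} \<in> edges G" "{w, z} \<notin> C" using P(3) by auto
  then have zV: "z \<in> verts G" using edge_V by blast
  have "card (star z) = 2" using star_off_cycle zV z_off by blast
  moreover have "{w, z} \<in> star z" using wzE by simp
  ultimately obtain e where e: "e \<in> star z" "e \<noteq> {w, z}"
    by (metis (no_types, lifting) card_2_iff' )
  then obtain t where t: "e = {z, t}" "t \<noteq> z"
    using edge_card_2[of e] by (auto simp: card_2_iff doubleton_eq_iff)
  have tw: "t \<noteq> w" using e t by (auto simp: insert_commute)
  have tE: "{z, t} \<in> edges G - C" using e t star_off_cycle[OF zV z_off] by auto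
  have tnew: "t \<notin> set P" 
  proof
    assume "t \<in> set P"
    then obtain i where i: "i < length P" "t = P ! i" by (auto simp: in_set_conv_nth)
    show False
    proof (cases i)
      case 0
      then have "t = x0" using i by (simp add: P_def)
      then have "{z, t} = {x0, y}" using two_off_cycle_edges_eq[OF x0, of "{z, t}" "{x0, y}"] tE e0 by auto
      then have "z = y" using \<open>t = x0\<close> t by (auto simp: doubleton_eq_iff)
      then have "xs = []" using P(1) by (auto simp: z_def P_def last_ConsR split: if_splits)
      then show False using tw \<open>t = x0\<close> by (simp add: w_def P_def)
    next
      case (Suc j)
      have "t \<noteq> z" "t \<noteq> w" using t tw by auto
      have "Suc i < length P - 1"
      proof -
        have "i \<noteq> length P - 1" "i \<noteq> length P - 2"
          using i(2) \<open>t \<noteq> z\<close> \<open>t \<noteq> w\<close> by (auto simp: z_nth w_def)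
        then show ?thesis using i(1) P(4) by linarith
      qed
      let ?a = "{P ! j, P ! Suc j}" and ?b = "{P ! Suc j, P ! Suc (Suc j)}"
      have len: "Suc (Suc j) < length P - 1" using \<open>Suc i < length P - 1\<close> Suc by simp
      then have "?a \<noteq> ?b" using path_edges_in_at[OF P(1)] by auto
      have mem: "?a \<in> path_edges P" "?b \<in> path_edges P" using len by (auto simp: path_edges_def)
      have zab: "z \<notin> ?a" "z \<notin> ?b"
        unfolding z_nth using P(1) len by (auto simp: nth_eq_iff_index_eq)
      have "t \<in> set (tl P)" using i Suc nth_mem[of j "y # xs"] by (simp add: P_def)
      then have "t \<notin> set cs" using P(2) by blast
      moreover have "t \<in> verts G" using tE edge_V by blast
      ultimately have "card (star t) = 2" using star_off_cycle by blast
      moreover have "{?a, ?b, {z, t}} \<subseteq> star t" using mem P(3) tE i Suc by auto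
      moreover have "card {?a, ?b, {z, t}} = 3" using \<open>?a \<noteq> ?b\<close> zab by (auto simp: card_insert_if)
      ultimately show False using finite_E card_mono[of "star t" "{?a, ?b, {z, t}}"] by simp
    qed
  qed
  have app: "path_edges (P @ [t]) = insert {z, t} (path_edges P)"
  proof -
    have P_eq: "P = butlast P @ [z]" by (simp add: z_def P_def)
    have "path_edges (P @ [t]) = path_edges (butlast P @ z # [t])" by (subst P_eq) simp
    also have "\<dots> = insert {z, t} (path_edges P)"
      using path_edges_append[of "butlast P" z "[t]"] P_eq by simp
    finally show ?thesis .
  qed
  have appE: "path_edges (x0 # y # xs @ [t]) \<subseteq> edges G - C"
    using app P(3) tE by (simp add: P_def del: path_edges_Cons)
  have "t \<in> set cs"
  proof (rule ccontr)
    assume "t \<notin> set cs"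
    then have "xs @ [t] \<in> L" using xs tnew appE by (auto simp: L_def P_def simp del: path_edges_Cons)
    then show False using max by fastforce
  qed
  then have "chord (x0 # (y # xs) @ [t])"
    unfolding chord_def using x0 tnew appE P(1,2)
    by (intro exI[of _ x0] exI[of _ "y # xs"] exI[of _ t]) (auto simp: P_def simp del: path_edges_Cons)
  then show ?thesis by (intro exI[of _ "x0 # (y # xs) @ [t]"]) simp
qed

definition chord_family :: "'a list set \<Rightarrow> bool" where
  "chord_family \<P> \<longleftrightarrow> (\<forall>P\<in>\<P>. chord P) \<and>
     (\<forall>P\<in>\<P>. \<forall>Q\<in>\<P>. P \<noteq> Q \<longrightarrow> path_edges P \<inter> path_edges Q = {})"

lemma chord_family_finite: "chord_family \<P> \<Longrightarrow> finite \<P>"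
proof (rule finite_subset)
  assume *: "chord_family \<P>"
  show "\<P> \<subseteq> {xs. set xs \<subseteq> verts G \<and> length xs \<le> card (verts G)}"
  proof
    fix P assume "P \<in> \<P>"
    then have "distinct P" "path_edges P \<subseteq> edges G" "length P \<ge> 2"
      using * by (auto simp: chord_family_def chord_def)
    then show "P \<in> {xs. set xs \<subseteq> verts G \<and> length xs \<le> card (verts G)}"
      using Union_path_edges[of P] edge_V card_mono[OF finite_V, of "set P"] by (auto simp: distinct_card)
  qed
qed (rule finite_lists_length_le[OF finite_V])

text \<open>Take a family of edge-disjoint chords that covers as many edges as possible.  By saturation, an
  uncovered edge next to the covered ones starts at the periphery, so it lies on a further chord.\<close>

lemma chord_decomposition:
  obtains \<P> where "chord_family \<P>" "edges G = C \<union> \<Union> (path_edges ` \<P>)"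
proof -
  have sub: "\<Union> (path_edges ` \<P>) \<subseteq> edges G" if "chord_family \<P>" for \<P>
    using that unfolding chord_family_def chord_def by blast
  have bound: "card (\<Union> (path_edges ` \<P>)) \<le> card (edges G)" if "chord_family \<P>" for \<P>
    by (rule card_mono[OF finite_E sub[OF that]])
  have "chord_family {}" by (simp add: chord_family_def)
  then obtain \<P> where \<P>: "chord_family \<P>"
    and max: "\<And>\<Q>. chord_family \<Q> \<Longrightarrow> card (\<Union> (path_edges ` \<Q>)) \<le> card (\<Union> (path_edges ` \<P>))"
  proof -
    have "\<exists>\<P>. chord_family \<P> \<and> (\<forall>\<Q>. chord_family \<Q> \<longrightarrow>
        card (\<Union> (path_edges ` \<Q>)) \<le> card (\<Union> (path_edges ` \<P>)))"
      by (rule ex_has_greatest_nat[of chord_family "{}" "\<lambda>\<P>. card (\<Union> (path_edges ` \<P>))" "Suc (card (edges G))"])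
        (use bound \<open>chord_family {}\<close> in \<open>auto simp: less_Suc_eq_le\<close>)
    then show thesis using that by blast
  qed
  let ?X = "C \<union> \<Union> (path_edges ` \<P>)"
  have "?X = edges G"
  proof (rule ccontr)
    assume ne: "?X \<noteq> edges G"
    have sat: "e' \<in> ?X" if hyp: "e \<in> ?X" "e' \<in> edges G" "v \<in> e" "v \<in> e'" "v \<notin> set cs" for e e' v
    proof -
      have "e \<notin> C" "e' \<notin> C" using hyp Union_C by auto
      then obtain P where "P \<in> \<P>" "e \<in> path_edges P" using hyp(1) by auto
      moreover from this have "v \<in> set P" using Union_path_edges_subset[of P] hyp by auto
      ultimately show ?thesis
        using chord_saturated[of P v e'] \<P> hyp \<open>e' \<notin> C\<close> by (auto simp: chord_family_def)
    qed
    have "\<exists>e e' v. e \<in> ?X \<and> e' \<in> edges G \<and> v \<in> e \<and> v \<in> e' \<and> e' \<notin> ?X"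
      using edge_closed[of ?X] ne C_nonempty sub[OF \<P>] C_subset by blast
    then obtain e' v where e': "e' \<in> edges G" "v \<in> e'" "e' \<notin> ?X" "v \<in> set cs"
      using sat by metis
    then obtain y where y: "e' = {v, y}"
      using edge_card_2[of e'] by (auto simp: card_2_iff)
    obtain P where P: "chord P" "{v, y} \<in> path_edges P"
      using chord_starting_with[of v y] e' y by auto
    have disj: "path_edges P \<inter> path_edges Q = {}" if Q: "Q \<in> \<P>" for Q
    proof (rule ccontr)
      assume "path_edges P \<inter> path_edges Q \<noteq> {}"
      \<comment> \<open>By saturation, membership in \<open>Q\<close> passes along \<open>P\<close> from a common edge to the edge \<open>e'\<close>.\<close>
      then obtain f where f: "f \<in> path_edges P" "f \<in> path_edges Q" by blast
      have chQ: "chord Q" using Q \<P> by (simp add: chord_family_def)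
      have PE: "path_edges P \<subseteq> edges G - C" using P by (auto simp: chord_def)
      have "path_edges P \<subseteq> path_edges Q"
      proof (rule path_all_or_none[OF _ f])
        fix i assume i: "Suc (Suc i) < length P"
        have mem: "{P ! i, P ! Suc i} \<in> path_edges P" "{P ! Suc i, P ! Suc (Suc i)} \<in> path_edges P"
          using i by (auto simp: path_edges_def)
        have in_Q: "P ! Suc i \<in> set Q" if "g \<in> path_edges Q" "P ! Suc i \<in> g" for g
          using that Union_path_edges_subset[of Q] by auto
        show "{P ! i, P ! Suc i} \<in> path_edges Q \<longleftrightarrow> {P ! Suc i, P ! Suc (Suc i)} \<in> path_edges Q"
          using chord_saturated[OF chQ in_Q] mem PE by (meson DiffD1 DiffD2 insertCI subsetD)
      qed
      then show False using P(2) y Q e'(3) by blast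
    qed
    have "chord_family (insert P \<P>)"
      using \<P> P(1) disj by (auto simp: chord_family_def)
    then have "card (\<Union> (path_edges ` insert P \<P>)) \<le> card (\<Union> (path_edges ` \<P>))" by (rule max)
    moreover have "\<Union> (path_edges ` \<P>) \<subset> \<Union> (path_edges ` insert P \<P>)" using P(2) y e'(3) by auto
    ultimately show False
      using psubset_card_mono[of "\<Union> (path_edges ` insert P \<P>)" "\<Union> (path_edges ` \<P>)"]
        chord_family_finite[OF \<open>chord_family (insert P \<P>)\<close>] by (simp add: finite_UN)
  qed
  with \<P> show thesis using that by metis
qed

end

section \<open>Sums modulo 2 and even edge sets\<close>

definition mod2_sum :: "('f \<Rightarrow> 'e set) \<Rightarrow> 'f set \<Rightarrow> 'e set" where
  "mod2_sum B J = {e. odd (card {s \<in> J. e \<in> B s})}"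

lemma odd_card_sym_diff:
  assumes "finite A" "finite B"
  shows "odd (card (sym_diff A B)) \<longleftrightarrow> odd (card A) \<noteq> odd (card B)"
proof -
  have "card (sym_diff A B) = card (A - B) + card (B - A)"
    using assms by (intro card_Un_disjoint) auto
  moreover have "card A = card (A - B) + card (A \<inter> B)" "card B = card (B - A) + card (A \<inter> B)"
    using assms by (subst card_Un_disjoint[symmetric]; auto intro: arg_cong[of _ _ card])+
  ultimately show ?thesis by presburger
qed

lemma mod2_sum_sym_diff:
  assumes "finite I" "finite J"
  shows "mod2_sum B (sym_diff I J) = sym_diff (mod2_sum B I) (mod2_sum B J)"
proof -
  have "{s \<in> sym_diff I J. e \<in> B s} = sym_diff {s \<in> I. e \<in> B s} {s \<in> J. e \<in> B s}" for e
    by blast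
  then show ?thesis
    using assms unfolding mod2_sum_def by (auto simp: odd_card_sym_diff)
qed

lemma mod2_sum_empty [simp]: "mod2_sum B {} = {}"
  and mod2_sum_singleton [simp]: "mod2_sum B {s} = B s"
proof -
  have "{t \<in> {s}. e \<in> B t} = (if e \<in> B s then {s} else {})" for e by auto
  then show "mod2_sum B {s} = B s" by (simp add: mod2_sum_def)
qed (simp add: mod2_sum_def)

lemma mod2_sum_insert:
  assumes "finite J" "s \<notin> J"
  shows "mod2_sum B (insert s J) = sym_diff (B s) (mod2_sum B J)"
proof -
  have "insert s J = sym_diff {s} J" using assms by auto
  then show ?thesis using mod2_sum_sym_diff[of "{s}" J B] assms by simp
qed

lemma mod2_sum_remove:
  assumes "finite J" "s \<in> J"
  shows "mod2_sum B (J - {s}) = sym_diff (B s) (mod2_sum B J)"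
proof -
  have "J - {s} = sym_diff {s} J" using assms by auto
  then show ?thesis using mod2_sum_sym_diff[of "{s}" J B] assms by simp
qed

lemma mod2_sum_subset: "(\<And>s. s \<in> J \<Longrightarrow> B s \<subseteq> X) \<Longrightarrow> mod2_sum B J \<subseteq> X"
proof
  fix e assume *: "\<And>s. s \<in> J \<Longrightarrow> B s \<subseteq> X" "e \<in> mod2_sum B J"
  then have "{s \<in> J. e \<in> B s} \<noteq> {}" by (auto simp: mod2_sum_def simp del: Collect_empty_eq)
  then show "e \<in> X" using * by blast
qed

definition even_edges :: "'a set set \<Rightarrow> bool" where
  "even_edges Z \<longleftrightarrow> finite Z \<and> (\<forall>v. even (card {e \<in> Z. v \<in> e}))"

lemma even_edges_sym_diff:
  assumes "even_edges Y" "even_edges Z"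
  shows "even_edges (sym_diff Y Z)"
proof -
  have fin: "finite Y" "finite Z" using assms by (auto simp: even_edges_def)
  have "{e \<in> sym_diff Y Z. v \<in> e} = sym_diff {e \<in> Y. v \<in> e} {e \<in> Z. v \<in> e}" for v by blast
  moreover have "even (card (sym_diff {e \<in> Y. v \<in> e} {e \<in> Z. v \<in> e}))" for v
    using odd_card_sym_diff[of "{e \<in> Y. v \<in> e}" "{e \<in> Z. v \<in> e}"] assms fin
    by (simp add: even_edges_def)
  ultimately show ?thesis using fin by (simp add: even_edges_def)
qed

lemma even_edges_cycle: "is_cycle G vs \<Longrightarrow> even_edges (cycle_edges vs)"
  unfolding even_edges_def using cycle_edges_at_card[of G vs]
  by (auto simp: cycle_edges_def)

lemma even_edges_all_or_none:
  assumes P: "path_edges P \<subseteq> X" and Z: "even_edges Z" "Z \<subseteq> X" "f \<in> path_edges P" "f \<in> Z"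
    and inner: "\<And>i. Suc (Suc i) < length P \<Longrightarrow> card {e \<in> X. P ! Suc i \<in> e} = 2 \<and>
      {P ! i, P ! Suc i} \<noteq> {P ! Suc i, P ! Suc (Suc i)}"
  shows "path_edges P \<subseteq> Z"
proof (rule path_all_or_none[OF _ Z(3,4)])
  fix i assume i: "Suc (Suc i) < length P"
  let ?a = "{P ! i, P ! Suc i}" and ?b = "{P ! Suc i, P ! Suc (Suc i)}"
  have "?a \<in> path_edges P" "?b \<in> path_edges P"
    using i by (auto simp: path_edges_def)
  then have "{?a, ?b} \<subseteq> {e \<in> X. P ! Suc i \<in> e}" using P by auto
  moreover have "card {?a, ?b} = 2" "card {e \<in> X. P ! Suc i \<in> e} = 2" using inner[OF i] by simp_all
  ultimately have "{?a, ?b} = {e \<in> X. P ! Suc i \<in> e}"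
    by (intro card_subset_eq) (auto intro: card_ge_0_finite)
  then have "{e \<in> Z. P ! Suc i \<in> e} = {?a, ?b} \<inter> Z"
    using Z(2) by blast
  then have "even (card ({?a, ?b} \<inter> Z))" using Z(1) unfolding even_edges_def by metis
  then show "?a \<in> Z \<longleftrightarrow> ?b \<in> Z"
    using inner[OF i] by (cases "?a \<in> Z"; cases "?b \<in> Z") (simp_all add: Int_insert_left)
qed

text \<open>At an inner vertex of a chord the two edges of the chord are all edges, so an even set contains
  both or none.\<close>

lemma (in chorded_cycle) chord_subset_even:
  assumes "chord P" "even_edges Z" "Z \<subseteq> edges G" "Z \<inter> path_edges P \<noteq> {}"
  shows "path_edges P \<subseteq> Z"
proof -
  obtain u ps v where P: "P = u # ps @ [v]" "distinct P" "path_edges P \<subseteq> edges G - C"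
     "set ps \<inter> set cs = {}"
    using assms(1) unfolding chord_def by blast
  obtain f where f: "f \<in> Z" "f \<in> path_edges P" using assms(4) by blast
  have U: "\<Union> (path_edges P) = set P" by (rule Union_path_edges) (simp add: P(1))
  show ?thesis
  proof (rule even_edges_all_or_none[where X = "edges G" and f = f])
    fix i assume i: "Suc (Suc i) < length P"
    have "P ! Suc i \<in> set ps" using i by (auto simp: P(1) nth_append)
    moreover from this have "P ! Suc i \<in> \<Union> (path_edges P)" unfolding U by (simp add: P(1))
    ultimately have "P ! Suc i \<in> verts G" "P ! Suc i \<notin> set cs"
      using P(3,4) edge_V by blast+
    then show "card (star (P ! Suc i)) = 2 \<and> {P ! i, P ! Suc i} \<noteq> {P ! Suc i, P ! Suc (Suc i)}"
      using star_off_cycle(1) path_edges_in_at[OF P(2) i] by blast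
  qed (use assms P f in auto)
qed

section \<open>Arcs of a cycle\<close>

lemma cycle_arcs:
  assumes "is_cycle G (u # ys @ v # ws)"
  shows "cycle_edges (u # ys @ v # ws) = path_edges (u # ys @ [v]) \<union> path_edges (v # ws @ [u])"
    and "path_edges (u # ys @ [v]) \<inter> path_edges (v # ws @ [u]) = {}"
proof -
  show "cycle_edges (u # ys @ v # ws) = path_edges (u # ys @ [v]) \<union> path_edges (v # ws @ [u])"
    using cycle_edges_split[of "[]" u ys v ws] by simp
  show "path_edges (u # ys @ [v]) \<inter> path_edges (v # ws @ [u]) = {}"
    using assms by (intro path_edges_disjoint) (auto simp: is_cycle_def)
qed

text \<open>At most one of the three paths of the theta graph is a single edge, because the graph is simple;
  so the two closed walks through \<open>ps\<close> have at least three vertices.\<close>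

lemma theta_cycles:
  assumes simple: "simple_graph G"
    and cyc: "is_cycle G (u # ys @ v # ws)"
    and P: "distinct (u # ps @ [v])" "set ps \<inter> set (u # ys @ v # ws) = {}"
      "path_edges (u # ps @ [v]) \<subseteq> edges G - cycle_edges (u # ys @ v # ws)"
  shows "is_cycle G (u # ys @ v # rev ps)"
    and "cycle_edges (u # ys @ v # rev ps) = path_edges (u # ys @ [v]) \<union> path_edges (u # ps @ [v])"
    and "is_cycle G (v # ws @ u # ps)"
    and "cycle_edges (v # ws @ u # ps) = path_edges (v # ws @ [u]) \<union> path_edges (u # ps @ [v])"
proof -
  have rev: "path_edges (v # rev ps @ [u]) = path_edges (u # ps @ [v])"
    using path_edges_rev[of "u # ps @ [v]"] by simp
  show 1: "cycle_edges (u # ys @ v # rev ps) = path_edges (u # ys @ [v]) \<union> path_edges (u # ps @ [v])"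
    using cycle_edges_split[of "[]" u ys v "rev ps"] rev by simp
  show 2: "cycle_edges (v # ws @ u # ps) = path_edges (v # ws @ [u]) \<union> path_edges (u # ps @ [v])"
    using cycle_edges_split[of "[]" v ws u ps] by simp
  note parts = cycle_arcs(1)[OF cyc]
  have sub: "path_edges (u # ys @ [v]) \<union> path_edges (v # ws @ [u]) \<subseteq> edges G"
    using cyc parts by (auto simp: is_cycle_def)
  have "set (u # ps @ [v]) = \<Union> (path_edges (u # ps @ [v]))"
    by (rule Union_path_edges[symmetric]) simp
  also have "\<dots> \<subseteq> verts G" using P(3) simple unfolding simple_graph_def by blast
  finally have "set ps \<subseteq> verts G" by simp
  moreover have "ps \<noteq> []" if "ys = []"
    using that P(3) parts by auto
  moreover have "ps \<noteq> []" if "ws = []"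
    using that P(3) parts by (auto simp: insert_commute)
  ultimately show "is_cycle G (u # ys @ v # rev ps)" "is_cycle G (v # ws @ u # ps)"
    unfolding is_cycle_def 1 2 using cyc P sub
    by (auto simp: is_cycle_def Suc_le_eq simp del: path_edges_Cons; cases ps; auto)+
qed

lemma cycle_star:
  assumes cyc: "is_cycle G vs" and ij: "i < length vs" "Suc i mod length vs = j"
  defines "E \<equiv> \<lambda>k. {vs ! k, vs ! (Suc k mod length vs)}"
  shows "{e \<in> cycle_edges vs. vs ! j \<in> e} = {E i, E j}" "E i \<noteq> E j"
proof -
  let ?n = "length vs"
  have n: "?n \<ge> 3" "distinct vs" using cyc by (auto simp: is_cycle_def)
  have "Suc i mod ?n < ?n" using n by (intro mod_less_divisor) linarith
  then have j: "j < ?n" using ij by simp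
  have pred: "k = i" if "k < ?n" "Suc k mod ?n = j" for k
    using that ij by (auto simp: mod_Suc split: if_splits)
  have "{e \<in> cycle_edges vs. vs ! j \<in> e} \<subseteq> {E i, E j}"
  proof
    fix e assume "e \<in> {e \<in> cycle_edges vs. vs ! j \<in> e}"
    then obtain k where k: "k < ?n" "e = E k" "vs ! j \<in> E k"
      by (auto simp: cycle_edges_def E_def)
    have "Suc k mod ?n < ?n" using n by (intro mod_less_divisor) linarith
    then have "j = k \<or> j = Suc k mod ?n"
      using k(1,3) j n(2) by (auto simp: E_def nth_eq_iff_index_eq)
    then show "e \<in> {E i, E j}" using pred k by blast
  qed
  moreover have "card {e \<in> cycle_edges vs. vs ! j \<in> e} = 2"
    using cycle_edges_at_card[OF cyc] j by simp
  ultimately show "E i \<noteq> E j" "{e \<in> cycle_edges vs. vs ! j \<in> e} = {E i, E j}"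
  proof -
    assume sub: "{e \<in> cycle_edges vs. vs ! j \<in> e} \<subseteq> {E i, E j}"
      and two: "card {e \<in> cycle_edges vs. vs ! j \<in> e} = 2"
    have "2 \<le> card {E i, E j}" using card_mono[OF _ sub] two by simp
    then show "E i \<noteq> E j" by auto
    then show "{e \<in> cycle_edges vs. vs ! j \<in> e} = {E i, E j}"
      using sub two by (intro card_subset_eq) auto
  qed
qed

lemma rotate_to_ends:
  assumes "is_cycle G vs" "u \<in> set vs" "v \<in> set vs" "u \<noteq> v"
  obtains ys ws where "is_cycle G (u # ys @ v # ws)" "cycle_edges (u # ys @ v # ws) = cycle_edges vs"
    "set (u # ys @ v # ws) = set vs"
proof -
  obtain as bs where vs: "vs = as @ u # bs" using assms(2) by (meson split_list)
  then have "v \<in> set (bs @ as)" using assms(3,4) by auto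
  then obtain ys ws where *: "bs @ as = ys @ v # ws" by (meson split_list)
  have "is_cycle G (u # ys @ v # ws)"
    using assms(1) is_cycle_rotate[of G as "u # bs"] * vs by simp
  moreover have "cycle_edges (u # ys @ v # ws) = cycle_edges vs"
    using cycle_edges_rotate[of as "u # bs"] * vs by simp
  moreover have "set (u # ys @ v # ws) = set vs"
    using arg_cong[OF *, of set] vs by auto
  ultimately show thesis using that by blast
qed

section \<open>Jordan curves drawn by cycles\<close>

context plane
begin

lemma arc_inter:
  assumes "X \<subseteq> edges G" "Y \<subseteq> edges G" "X \<inter> Y = {}"
    "\<Union> X \<inter> \<Union> Y = {u, v}"
  shows "drawn G X \<inter> drawn G Y = {u, v}"
  using drawn_inter[OF assms(1-3)] assms(4) by simp

lemma cycle_parts: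
  assumes "is_cycle G (u # ys @ v # ws)"
  shows "cycle_edges (u # ys @ v # ws) = path_edges (u # ys @ [v]) \<union> path_edges (v # ws @ [u])"
    and "path_edges (u # ys @ [v]) \<inter> path_edges (v # ws @ [u]) = {}"
    and "drawn G (path_edges (u # ys @ [v])) \<inter> drawn G (path_edges (v # ws @ [u])) = {u, v}"
proof -
  show eq: "cycle_edges (u # ys @ v # ws) = path_edges (u # ys @ [v]) \<union> path_edges (v # ws @ [u])"
    and dis: "path_edges (u # ys @ [v]) \<inter> path_edges (v # ws @ [u]) = {}"
    using cycle_arcs[OF assms] .
  have "\<Union> (path_edges (u # ys @ [v])) = set (u # ys @ [v])"
    "\<Union> (path_edges (v # ws @ [u])) = set (v # ws @ [u])"
    by (intro Union_path_edges; simp)+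
  then show "drawn G (path_edges (u # ys @ [v])) \<inter> drawn G (path_edges (v # ws @ [u])) = {u, v}"
    using assms eq dis by (intro arc_inter) (auto simp: is_cycle_def)
qed

lemma cycle_loop:
  assumes "is_cycle G vs"
  shows "\<exists>c. simple_path c \<and> pathfinish c = pathstart c \<and> path_image c = drawn G (cycle_edges vs)"
proof -
  obtain u v ws where vs: "vs = u # [] @ v # ws"
    using assms by (cases vs; cases "tl vs") (auto simp: is_cycle_def)
  note cyc = assms[unfolded vs]
  have E: "path_edges (u # [] @ [v]) \<subseteq> edges G" "path_edges (v # ws @ [u]) \<subseteq> edges G"
    using cyc cycle_parts(1)[OF cyc] by (auto simp: is_cycle_def)
  have "distinct (u # [] @ v # ws)" using cyc by (simp only: is_cycle_def)
  then obtain c1 c2 where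
    c1: "arc c1" "path_image c1 = drawn G (path_edges (u # [] @ [v]))" "pathstart c1 = u" "pathfinish c1 = v"
    and c2: "arc c2" "path_image c2 = drawn G (path_edges (v # ws @ [u]))" "pathstart c2 = v" "pathfinish c2 = u"
    using path_arc[OF _ _ E(1)] path_arc[OF _ _ E(2)] by (auto simp del: path_edges_Cons)
  have "simple_path (c1 +++ c2)"
    using c1 c2 cycle_parts(3)[OF cyc] by (intro simple_path_join_loop) (auto simp del: path_edges_Cons)
  moreover have "path_image (c1 +++ c2) = drawn G (cycle_edges vs)"
    using c1 c2 unfolding vs cycle_parts(1)[OF cyc] drawn_Un by (subst path_image_join) simp_all
  ultimately show ?thesis using c1 c2 by (intro exI[of _ "c1 +++ c2"]) simp
qed

lemma jordan:
  assumes "is_cycle G vs"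
  defines "K \<equiv> drawn G (cycle_edges vs)"
  shows "inside K \<noteq> {}" "open (inside K)" "connected (inside K)" "bounded (inside K)"
    "open (outside K)" "connected (outside K)" "\<not> bounded (outside K)"
    "inside K \<inter> outside K = {}" "inside K \<union> outside K = - K"
    "frontier (inside K) = K" "frontier (outside K) = K"
  using cycle_loop[OF assms(1)] Jordan_inside_outside unfolding K_def by metis+

text \<open>An instance of \<open>split_inside_simple_closed_curve\<close> for three arcs that are drawn by paths.\<close>

lemma theta_split:
  assumes cyc: "is_cycle G (u # ys @ v # ws)"
    and P: "distinct (u # ps @ [v])" "set ps \<inter> set (u # ys @ v # ws) = {}"
      "path_edges (u # ps @ [v]) \<subseteq> edges G - cycle_edges (u # ys @ v # ws)"
    and meets: "drawn G (path_edges (u # ps @ [v])) \<inter> inside (drawn G (cycle_edges (u # ys @ v # ws))) \<noteq> {}"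
  shows "inside (drawn G (cycle_edges (u # ys @ v # rev ps))) \<inter> inside (drawn G (cycle_edges (v # ws @ u # ps))) = {}"
    and "inside (drawn G (cycle_edges (u # ys @ v # rev ps))) \<union> inside (drawn G (cycle_edges (v # ws @ u # ps))) \<union>
        (drawn G (path_edges (u # ps @ [v])) - {u, v}) = inside (drawn G (cycle_edges (u # ys @ v # ws)))"
proof -
  let ?A = "path_edges (u # ys @ [v])" and ?B = "path_edges (v # ws @ [u])" and ?P = "path_edges (u # ps @ [v])"
  note parts = cycle_parts[OF cyc]
  have E: "?A \<subseteq> edges G" "?B \<subseteq> edges G" "?P \<subseteq> edges G"
    using cyc parts(1) P(3) by (auto simp: is_cycle_def simp del: path_edges_Cons)
  have dis: "?A \<inter> ?P = {}" "?B \<inter> ?P = {}" using P(3) parts(1) by auto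
  have U: "\<Union> ?A = set (u # ys @ [v])" "\<Union> ?B = set (v # ws @ [u])" "\<Union> ?P = set (u # ps @ [v])"
    by (intro Union_path_edges; simp)+
  have B_rev: "path_edges (u # rev ws @ [v]) = ?B"
    using path_edges_rev[of "v # ws @ [u]"] by simp
  have dist: "distinct (u # ys @ v # ws)" using cyc by (simp only: is_cycle_def)
  then have uv: "u \<noteq> v" by auto
  obtain c1 where c1: "arc c1" "path_image c1 = drawn G ?A" "pathstart c1 = u" "pathfinish c1 = v"
    using path_arc[OF _ _ E(1)] dist by (auto simp del: path_edges_Cons)
  obtain c2 where c2: "arc c2" "path_image c2 = drawn G ?B" "pathstart c2 = u" "pathfinish c2 = v"
    using path_arc[of "u # rev ws @ [v]"] E(2) B_rev dist by (auto simp del: path_edges_Cons)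
  obtain c where c: "arc c" "path_image c = drawn G ?P" "pathstart c = u" "pathfinish c = v"
    using path_arc[OF _ _ E(3)] P(1) by (auto simp del: path_edges_Cons)
  have AP: "drawn G ?A \<inter> drawn G ?P = {u, v}"
    using E dis(1) U P(2) by (intro arc_inter) auto
  have BP: "drawn G ?B \<inter> drawn G ?P = {u, v}"
    using E dis(2) U P(2) by (intro arc_inter) auto
  note eqs = theta_cycles(2)[OF simple cyc P] theta_cycles(4)[OF simple cyc P] parts(1) drawn_Un
  have "inside (drawn G ?A \<union> drawn G ?P) \<inter> inside (drawn G ?B \<union> drawn G ?P) = {} \<and>
    inside (drawn G ?A \<union> drawn G ?P) \<union> inside (drawn G ?B \<union> drawn G ?P) \<union> (drawn G ?P - {u, v})
      = inside (drawn G ?A \<union> drawn G ?B)"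
    by (rule split_inside_simple_closed_curve[of c1 u v c2 c])
      (use c1 c2 c uv AP BP parts(3) meets in \<open>simp_all add: arc_imp_simple_path eqs del: path_edges_Cons\<close>)
  then show "inside (drawn G (cycle_edges (u # ys @ v # rev ps))) \<inter> inside (drawn G (cycle_edges (v # ws @ u # ps))) = {}"
    and "inside (drawn G (cycle_edges (u # ys @ v # rev ps))) \<union> inside (drawn G (cycle_edges (v # ws @ u # ps))) \<union>
        (drawn G (path_edges (u # ps @ [v])) - {u, v}) = inside (drawn G (cycle_edges (u # ys @ v # ws)))"
    unfolding eqs by blast+
qed

lemma path_endless_connected:
  assumes "distinct (u # ps @ [v])" "path_edges (u # ps @ [v]) \<subseteq> edges G"
  shows "connected (drawn G (path_edges (u # ps @ [v])) - {u, v})"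
    and "drawn G (path_edges (u # ps @ [v])) \<subseteq> closure (drawn G (path_edges (u # ps @ [v])) - {u, v})"
    and "drawn G (path_edges (u # ps @ [v])) - {u, v} \<noteq> {}"
    and "connected (drawn G (path_edges (u # ps @ [v])))"
proof -
  let ?K = "drawn G (path_edges (u # ps @ [v]))"
  obtain c where c: "arc c" "path_image c = ?K" "pathstart c = u" "pathfinish c = v"
    using path_arc[OF assms(1) _ assms(2)] by (auto simp del: path_edges_Cons)
  show "connected (?K - {u, v})"
    using connected_simple_path_endless[of c] c by (simp add: arc_imp_simple_path)
  show con: "connected ?K" using c connected_path_image[of c] by (simp add: arc_imp_path)
  have "infinite ?K" using arc_image_uncountable[OF c(1)] c(2) uncountable_infinite by metis
  then show "?K - {u, v} \<noteq> {}" by (metis finite.simps finite_Diff2)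
  show "?K \<subseteq> closure (?K - {u, v})"
  proof
    fix z assume z: "z \<in> ?K"
    have "z islimpt ?K"
      using connected_imp_perfect[OF con z] \<open>infinite ?K\<close> by (metis finite.emptyI finite_insert)
    then have "z islimpt insert u (insert v (?K - {u, v}))" by (rule islimpt_subset) auto
    then show "z \<in> closure (?K - {u, v})" by (simp add: closure_def islimpt_insert)
  qed
qed

end

section \<open>Cutting the interior of the periphery along chords\<close>

text \<open>The set \<open>U\<close> stands for the infinite face.  That the periphery lies in its closure is what keeps
  chords from being drawn outside.\<close>

locale plane_chorded = plane G + chorded_cycle G cs for G :: embedded_graph and cs +
  fixes U :: "complex set"
  assumes U_connected: "connected U" and U_unbounded: "\<not> bounded U"
    and U_disjoint: "U \<inter> drawn G (edges G) = {}"
    and U_touches: "drawn G (cycle_edges cs) \<subseteq> closure U"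
begin

lemma U_outside:
  assumes "X \<subseteq> edges G"
  shows "U \<subseteq> outside (drawn G X)"
proof
  fix x assume x: "x \<in> U"
  have "U \<subseteq> - drawn G X" using U_disjoint drawn_mono[OF assms] by blast
  then have "U \<subseteq> connected_component_set (- drawn G X) x"
    using x U_connected by (intro connected_component_maximal)
  then have "\<not> bounded (connected_component_set (- drawn G X) x)"
    using U_unbounded bounded_subset by blast
  then show "x \<in> outside (drawn G X)"
    using x \<open>U \<subseteq> - drawn G X\<close> by (auto simp: outside_def)
qed

text \<open>If a chord \<open>P\<close> ran outside the periphery, each arc of the periphery would together with \<open>P\<close>
  form a curve that leaves the other arc outside, because the infinite face touches both arcs.  By
  Janiszewski's theorem neither curve, and hence not their union, would separate the inside of the
  periphery from the infinite face.\<close>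

lemma chord_inside:
  assumes "chord P"
  obtains u ps v where "P = u # ps @ [v]" "distinct P" "path_edges P \<subseteq> edges G - C"
    "u \<in> set cs" "v \<in> set cs" "set ps \<inter> set cs = {}" "drawn G (path_edges P) - {u, v} \<subseteq> inside (drawn G C)"
proof -
  obtain u ps v where P: "P = u # ps @ [v]" "distinct P" "path_edges P \<subseteq> edges G - C"
     "u \<in> set cs" "v \<in> set cs" "set ps \<inter> set cs = {}"
    using assms unfolding chord_def by blast
  then have "u \<noteq> v" by auto
  then obtain ys ws where cyc: "is_cycle G (u # ys @ v # ws)" and C: "cycle_edges (u # ys @ v # ws) = C"
    "set (u # ys @ v # ws) = set cs"
    using rotate_to_ends[OF outer_cycle P(4,5)] by blast
  let ?A = "path_edges (u # ys @ [v])" and ?B = "path_edges (v # ws @ [u])" and ?P = "path_edges P"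
  note parts = cycle_parts[OF cyc, unfolded C]
  note th = theta_cycles[OF simple cyc, of ps, unfolded C, folded P(1), OF P(2,6,3)]
  have E: "?A \<subseteq> edges G" "?B \<subseteq> edges G" "?P \<subseteq> edges G" using parts(1) C_subset P(3) by auto
  note C_jordan = jordan[OF outer_cycle]
  have endless: "connected (drawn G ?P - {u, v})" "drawn G ?P - {u, v} \<noteq> {}"
    "connected (drawn G ?P)"
    using path_endless_connected[of u ps v] P E by simp_all
  have PC: "drawn G ?P \<inter> drawn G C = {u, v}"
  proof (rule arc_inter)
    have "\<Union> ?P = set P" by (rule Union_path_edges) (simp add: P(1))
    then show "\<Union> ?P \<inter> \<Union> C = {u, v}" using P Union_C by auto
  qed (use P C_subset in auto)
  have "drawn G ?P - {u, v} \<subseteq> inside (drawn G C)"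
  proof (rule ccontr)
    assume not_in: "\<not> ?thesis"
    have "(drawn G ?P - {u, v}) \<inter> inside (drawn G C) = {}"
    proof -
      have "(drawn G ?P - {u, v}) \<inter> frontier (inside (drawn G C)) = {}"
        using PC C_jordan(10) by blast
      then show ?thesis
        using connected_Int_frontier[OF endless(1), of "inside (drawn G C)"] not_in by blast
    qed
    moreover have "drawn G C \<inter> inside (drawn G C) = {}" using inside_no_overlap[of "drawn G C"] by blast
    ultimately have P_out: "drawn G ?P \<inter> inside (drawn G C) = {}" using PC by blast
    obtain x where x: "x \<in> inside (drawn G C)" using C_jordan(1) by blast
    obtain y where y: "y \<in> U" using U_unbounded by force
    \<comment> \<open>Here \<open>X\<close> is one arc of the periphery and \<open>z\<close> is an inner point of the other arc.\<close>
    have not_separated: "connected_component (- drawn G (X \<union> ?P)) x y"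
      if D: "is_cycle G vs" "cycle_edges vs = X \<union> ?P" and X: "X \<subseteq> C"
        and Y: "z \<in> drawn G C" "z \<notin> drawn G (X \<union> ?P)" for vs X z
    proof -
      let ?K = "drawn G (X \<union> ?P)"
      note K = jordan[OF D(1), unfolded D(2)]
      have XE: "X \<union> ?P \<subseteq> edges G" using X C_subset E by auto
      have "z \<in> closure U" using U_touches Y by blast
      then have "z \<in> closure (outside ?K)" using U_outside[OF XE] closure_mono by blast
      then have "z \<in> outside ?K"
        using Y(2) K(5,11) by (simp add: closure_Un_frontier)
      moreover have "z \<in> closure (inside (drawn G C))" using Y(1) C_jordan(10) by (simp add: closure_Un_frontier)
      ultimately have "inside (drawn G C) \<inter> outside ?K \<noteq> {}"
        using K(5) open_Int_closure_eq_empty[of "outside ?K" "inside (drawn G C)"] by blast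
      moreover have "inside (drawn G C) \<inter> ?K = {}"
        using P_out \<open>drawn G C \<inter> inside (drawn G C) = {}\<close> drawn_mono[OF X, of G] by (auto simp: drawn_Un)
      ultimately have "inside (drawn G C) \<subseteq> outside ?K"
        using connected_Int_frontier[OF C_jordan(3), of "outside ?K"] K(11) by blast
      then have "x \<in> outside ?K" "y \<in> outside ?K" using x y U_outside[OF XE] by auto
      moreover have "outside ?K \<subseteq> - ?K" using K(9) by blast
      ultimately show ?thesis using K(6) by (meson connected_component_def)
    qed
    have drC: "drawn G C = drawn G ?A \<union> drawn G ?B" using parts(1) by (simp add: drawn_Un)
    have arc_point: "\<exists>z. z \<in> drawn G X \<and> z \<notin> {u, v}" if "X \<subseteq> edges G" "X \<noteq> {}" for X
    proof -
      from that obtain e where e: "e \<in> X" "e \<in> edges G" by blast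
      obtain a b where ab: "e = {a, b}" "a \<noteq> b" using edge_card[OF e(2)] by (auto simp: card_2_iff)
      then have "drawn G (path_edges (a # [] @ [b])) - {a, b} \<noteq> {}"
        using e by (intro path_endless_connected(3)) auto
      then obtain z where z: "z \<in> curve G e" "z \<notin> e" using ab by (auto simp: drawn_def)
      then have "z \<notin> verts G" using curve_verts[OF e(2)] by blast
      moreover have "{u, v} \<subseteq> verts G" using P(4,5) cs_subset by auto
      ultimately show ?thesis using z e by (auto simp: drawn_def)
    qed
    have AP: "drawn G ?A \<inter> drawn G ?P \<subseteq> {u, v}" and BP: "drawn G ?B \<inter> drawn G ?P \<subseteq> {u, v}"
      using PC drC by auto
    have ne: "?A \<noteq> {}" "?B \<noteq> {}" by (cases ys; cases ws; simp)+
    obtain z where "z \<in> drawn G ?B" "z \<notin> {u, v}" using arc_point E(2) ne(2) by blast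
    then have 1: "connected_component (- drawn G (?A \<union> ?P)) x y"
      using BP parts(1,3) drC by (intro not_separated[OF th(1,2), of z]) (auto simp: drawn_Un)
    obtain z' where "z' \<in> drawn G ?A" "z' \<notin> {u, v}" using arc_point E(1) ne(1) by blast
    then have 2: "connected_component (- drawn G (?B \<union> ?P)) x y"
      using AP parts(1,3) drC by (intro not_separated[OF th(3,4), of z']) (auto simp: drawn_Un)
    have "drawn G (?A \<union> ?P) \<inter> drawn G (?B \<union> ?P) = drawn G ?P"
      using parts(3) PC by (auto simp: drawn_Un)
    then have "connected_component (- (drawn G (?A \<union> ?P) \<union> drawn G (?B \<union> ?P))) x y"
      using E endless(3) by (intro Janiszewski[OF _ _ _ 1 2]) (auto intro!: compact_drawn compact_imp_closed)
    then have "connected_component (- drawn G C) x y"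
      by (rule connected_component_of_subset) (auto simp: drC drawn_Un)
    then have "y \<in> inside (drawn G C)" using x by (rule inside_same_component)
    moreover have "y \<in> outside (drawn G C)" using U_outside[OF C_subset] y by blast
    ultimately show False using C_jordan(8) by blast
  qed
  then show thesis using that P by blast
qed

text \<open>The invariant of the cutting process: \<open>\<D>\<close> holds the boundaries of the faces inside the periphery
  when the edges in \<open>X\<close> have been drawn.  By the last clause they generate the cycle space of \<open>X\<close>.\<close>

definition face_cycles :: "complex set set \<Rightarrow> complex set set set \<Rightarrow> bool" where
  "face_cycles X \<D> \<longleftrightarrow> finite \<D> \<and> (\<forall>D\<in>\<D>. D \<subseteq> X \<and> (\<exists>vs. is_cycle G vs \<and> cycle_edges vs = D)) \<and>
     inside (drawn G C) - drawn G X = (\<Union>D\<in>\<D>. inside (drawn G D)) \<and>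
     (\<forall>D\<in>\<D>. \<forall>D'\<in>\<D>. D \<noteq> D' \<longrightarrow> inside (drawn G D) \<inter> inside (drawn G D') = {}) \<and>
     (\<forall>e\<in>X. card {D \<in> \<D>. e \<in> D} = (if e \<in> C then 1 else 2)) \<and>
     (\<forall>Z. Z \<subseteq> X \<longrightarrow> even_edges Z \<longrightarrow> (\<exists>J\<subseteq>\<D>. Z = mod2_sum (\<lambda>D. D) J))"

lemma face_cycles_base: "face_cycles C {C}"
  unfolding face_cycles_def
proof (intro conjI allI impI ballI)
  fix Z assume Z: "Z \<subseteq> C" "even_edges Z"
  have "Z = {} \<or> Z = C"
  proof (rule ccontr)
    assume not: "\<not> ?thesis"
    then obtain f where f: "f \<in> Z" by blast
    have len: "length cs \<ge> 3" and dist: "distinct cs" using outer_cycle by (auto simp: is_cycle_def)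
    then have C: "C = path_edges (cs @ [hd cs])" by (intro cycle_edges_eq_path_edges) auto
    have "path_edges (cs @ [hd cs]) \<subseteq> Z"
    proof (rule even_edges_all_or_none[where X = C and f = f])
      fix i assume "Suc (Suc i) < length (cs @ [hd cs])"
      then have i: "Suc i < length cs" by simp
      let ?l = "cs @ [hd cs]"
      have "hd cs = cs ! 0" using len by (intro hd_conv_nth) auto
      note hd = this
      have nth: "?l ! i = cs ! i" "?l ! Suc i = cs ! Suc i"
        "?l ! Suc (Suc i) = (if Suc (Suc i) = length cs then cs ! 0 else cs ! Suc (Suc i))"
        using i hd by (auto simp: nth_append)
      have "cs ! i \<noteq> ?l ! Suc (Suc i)" "cs ! i \<noteq> cs ! Suc i"
      proof -
        have inj: "cs ! i \<noteq> cs ! j" if "j < length cs" "j \<noteq> i" for j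
          using nth_eq_iff_index_eq[OF dist, of i j] that i by simp
        show "cs ! i \<noteq> cs ! Suc i" using inj[of "Suc i"] i by simp
        show "cs ! i \<noteq> ?l ! Suc (Suc i)"
        proof (cases "Suc (Suc i) = length cs")
          case True
          then have "i \<noteq> 0" "0 < length cs" using len by auto
          then show ?thesis using inj[of 0] True nth(3) by simp
        next
          case False
          then show ?thesis using inj[of "Suc (Suc i)"] i by (simp add: nth)
        qed
      qed
      then have "{?l ! i, ?l ! Suc i} \<noteq> {?l ! Suc i, ?l ! Suc (Suc i)}"
        unfolding nth(1,2) by (auto simp: doubleton_eq_iff)
      then show "card {e \<in> C. ?l ! Suc i \<in> e} = 2 \<and> {?l ! i, ?l ! Suc i} \<noteq> {?l ! Suc i, ?l ! Suc (Suc i)}"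
        using cycle_edges_at_card[OF outer_cycle] i by (simp add: nth(2))
    qed (use Z f C in auto)
    then show False using not Z C by auto
  qed
  then show "\<exists>J\<subseteq>{C}. Z = mod2_sum (\<lambda>D. D) J"
  proof
    assume "Z = {}" then show ?thesis by (intro exI[of _ "{}"]) simp
  next
    assume "Z = C" then show ?thesis by (intro exI[of _ "{C}"]) simp
  qed
next
  show "inside (drawn G C) - drawn G C = (\<Union>D\<in>{C}. inside (drawn G D))"
    using inside_no_overlap[of "drawn G C"] by blast
next
  fix e assume "e \<in> C"
  then have "{D \<in> {C}. e \<in> D} = {C}" by auto
  then show "card {D \<in> {C}. e \<in> D} = (if e \<in> C then 1 else 2)" using \<open>e \<in> C\<close> by simp
qed (use outer_cycle in auto)

text \<open>The chord runs through a single old face, so by the theta curve theorem it splits that face into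
  two.  An even set that contains the chord becomes a subset of \<open>X\<close> when the boundary of one of the
  two parts is added to it.\<close>

lemma face_cycles_step:
  assumes fc: "face_cycles X \<D>" and X: "X \<subseteq> edges G" "C \<subseteq> X" and P: "chord P" "path_edges P \<inter> X = {}"
    "set P \<inter> \<Union> X \<subseteq> set cs"
  shows "\<exists>\<D>'. face_cycles (X \<union> path_edges P) \<D>'"
proof -
  have fin: "finite \<D>" and cyc: "\<And>D. D \<in> \<D> \<Longrightarrow> D \<subseteq> X" "\<And>D. D \<in> \<D> \<Longrightarrow> \<exists>vs. is_cycle G vs \<and> cycle_edges vs = D"
    and cover: "inside (drawn G C) - drawn G X = (\<Union>D\<in>\<D>. inside (drawn G D))"
    and disj: "\<And>D D'. D \<in> \<D> \<Longrightarrow> D' \<in> \<D> \<Longrightarrow> D \<noteq> D' \<Longrightarrow> inside (drawn G D) \<inter> inside (drawn G D') = {}"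
    and count: "\<And>e. e \<in> X \<Longrightarrow> card {D \<in> \<D>. e \<in> D} = (if e \<in> C then 1 else 2)"
    and span: "\<And>Z. Z \<subseteq> X \<Longrightarrow> even_edges Z \<Longrightarrow> \<exists>J\<subseteq>\<D>. Z = mod2_sum (\<lambda>D. D) J"
    using fc unfolding face_cycles_def by simp_all
  obtain u ps v where P': "P = u # ps @ [v]" "distinct P" "path_edges P \<subseteq> edges G - C"
    "u \<in> set cs" "v \<in> set cs" "set ps \<inter> set cs = {}" "drawn G (path_edges P) - {u, v} \<subseteq> inside (drawn G C)"
    using chord_inside[OF P(1)] by blast
  let ?P = "path_edges P"
  let ?Po = "drawn G ?P - {u, v}"
  have PE: "?P \<subseteq> edges G" using P'(3) by blast
  have UP: "\<Union> ?P = set P" by (rule Union_path_edges) (simp add: P'(1))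
  have endless: "connected ?Po" "drawn G ?P \<subseteq> closure ?Po" "?Po \<noteq> {}"
    using path_endless_connected[of u ps v] P' PE by simp_all
  have uvP: "{u, v} \<subseteq> drawn G ?P" using drawn_verts[OF PE] UP P'(1) by auto
  have "set P \<inter> set cs \<subseteq> {u, v}" using P'(1,6) by auto
  then have "\<Union> ?P \<inter> \<Union> X \<subseteq> {u, v}" unfolding UP using P(3) by blast
  then have PX: "drawn G ?P \<inter> drawn G X \<subseteq> {u, v}"
    using drawn_inter[OF PE X(1) P(2)] by simp
  then have "?Po \<subseteq> (\<Union>D\<in>\<D>. inside (drawn G D))"
    using P'(7) unfolding cover[symmetric] by blast
  then obtain D z where D: "D \<in> \<D>" "z \<in> ?Po" "z \<in> inside (drawn G D)"
    using endless(3) by blast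
  obtain vs where vs: "is_cycle G vs" "cycle_edges vs = D" using cyc(2)[OF D(1)] by blast
  note J = jordan[OF vs(1), unfolded vs(2)]
  have DX: "D \<subseteq> X" using cyc(1) D(1) by blast
  have drD: "drawn G D \<subseteq> drawn G X" using DX by (rule drawn_mono)
  have Po_D: "?Po \<subseteq> inside (drawn G D)"
    using connected_Int_frontier[OF endless(1), of "inside (drawn G D)"] D(2,3) J(10) PX drD by blast
  have "drawn G ?P \<subseteq> closure (inside (drawn G D))"
    using endless(2) closure_mono[OF Po_D] by blast
  then have "{u, v} \<subseteq> inside (drawn G D) \<union> drawn G D"
    using uvP J(10) by (auto simp: closure_Un_frontier)
  moreover have uvC: "{u, v} \<subseteq> drawn G C" using drawn_verts[OF C_subset] Union_C P'(4,5) by auto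
  moreover have inD: "inside (drawn G D) \<inter> drawn G X = {}"
    using cover D(1) by blast
  ultimately have "{u, v} \<subseteq> drawn G D" using drawn_mono[OF X(2), of G] by blast
  moreover have "{u, v} \<subseteq> verts G" using P'(4,5) cs_subset by auto
  ultimately have "{u, v} \<subseteq> \<Union> D" using drawn_verts[of D] DX X(1) by blast
  then have uv_vs: "u \<in> set vs" "v \<in> set vs" using Union_cycle_edges[OF vs(1)] vs(2) by auto
  have "u \<noteq> v" using P'(1,2) by auto
  then obtain ys ws where D_cyc: "is_cycle G (u # ys @ v # ws)" "cycle_edges (u # ys @ v # ws) = D"
    "set (u # ys @ v # ws) = set vs"
    using rotate_to_ends[OF vs(1) uv_vs] vs(2) by blast
  have ps_vs: "set ps \<inter> set vs = {}"
    using Union_cycle_edges[OF vs(1)] vs(2) DX P(3) P'(1,6) by auto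
  have PD: "?P \<subseteq> edges G - D" using PE P(2) DX by blast
  note th = theta_cycles[OF simple D_cyc(1), of ps, unfolded D_cyc(2,3), folded P'(1), OF P'(2) ps_vs PD]
  have meets: "drawn G ?P \<inter> inside (drawn G D) \<noteq> {}" using D(2,3) by blast
  note split = theta_split[OF D_cyc(1), of ps, unfolded D_cyc(2,3), folded P'(1), OF P'(2) ps_vs PD meets]
  note parts = cycle_parts[OF D_cyc(1), unfolded D_cyc(2)]
  define A where "A = path_edges (u # ys @ [v])"
  define B where "B = path_edges (v # ws @ [u])"
  define D1 where "D1 = A \<union> ?P"
  define D2 where "D2 = B \<union> ?P"
  have AB: "D = A \<union> B" "A \<inter> B = {}" using parts(1,2) by (simp_all add: A_def B_def)
  have cyc12: "\<exists>vs. is_cycle G vs \<and> cycle_edges vs = D1" "\<exists>vs. is_cycle G vs \<and> cycle_edges vs = D2"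
    using th unfolding D1_def D2_def A_def B_def by blast+
  have split1: "inside (drawn G D1) \<inter> inside (drawn G D2) = {}"
    and split2: "inside (drawn G D1) \<union> inside (drawn G D2) \<union> ?Po = inside (drawn G D)"
    using split th(2,4) unfolding D1_def D2_def A_def B_def by metis+
  have no_overlap: "inside (drawn G D1) \<inter> drawn G ?P = {}" "inside (drawn G D2) \<inter> drawn G ?P = {}"
  proof -
    have "drawn G ?P \<subseteq> drawn G D1" "drawn G ?P \<subseteq> drawn G D2" by (simp_all add: D1_def D2_def drawn_mono)
    then show "inside (drawn G D1) \<inter> drawn G ?P = {}" "inside (drawn G D2) \<inter> drawn G ?P = {}"
      using inside_no_overlap[of "drawn G D1"] inside_no_overlap[of "drawn G D2"] by blast+
  qed
  have Pne: "?P \<noteq> {}" using uvP by (auto simp: drawn_def)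
  have AX: "A \<inter> ?P = {}" "B \<inter> ?P = {}" using AB DX P(2) by auto
  have ABne: "A \<noteq> {}" "B \<noteq> {}" unfolding A_def B_def by (cases ys; cases ws; simp)+
  have new: "D1 \<notin> \<D>" "D2 \<notin> \<D>" "D1 \<noteq> D2"
    using Pne cyc(1) P(2) AB(2) AX ABne unfolding D1_def D2_def by blast+
  let ?D' = "insert D1 (insert D2 (\<D> - {D}))"
  have toggle: "sym_diff D1 D2 = D"
    unfolding D1_def D2_def using AB AX by blast
  have span_X: "\<exists>J\<subseteq>?D'. Z = mod2_sum (\<lambda>D. D) J" if Z: "Z \<subseteq> X" "even_edges Z" for Z
  proof -
    obtain J where J: "J \<subseteq> \<D>" "Z = mod2_sum (\<lambda>D. D) J" using span[OF Z] by blast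
    have finJ: "finite J" using J(1) fin by (rule finite_subset)
    show ?thesis
    proof (cases "D \<in> J")
      case False
      then show ?thesis using J by (intro exI[of _ J]) auto
    next
      case True
      let ?J = "insert D1 (insert D2 (J - {D}))"
      have "mod2_sum (\<lambda>D. D) ?J = sym_diff D1 (sym_diff D2 (mod2_sum (\<lambda>D. D) (J - {D})))"
      proof -
        have notin: "D1 \<notin> insert D2 (J - {D})" "D2 \<notin> J - {D}" using J(1) new by auto
        have "mod2_sum (\<lambda>D. D) (insert D2 (J - {D})) = sym_diff D2 (mod2_sum (\<lambda>D. D) (J - {D}))"
          using finJ notin(2) by (intro mod2_sum_insert) auto
        moreover have "mod2_sum (\<lambda>D. D) ?J = sym_diff D1 (mod2_sum (\<lambda>D. D) (insert D2 (J - {D})))"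
          using finJ notin(1) by (intro mod2_sum_insert) auto
        ultimately show ?thesis by metis
      qed
      also have "\<dots> = sym_diff D1 (sym_diff D2 (sym_diff D Z))"
        using mod2_sum_remove[OF finJ True, of "\<lambda>D. D"] J(2) by simp
      also have "\<dots> = sym_diff (sym_diff D1 D2) (sym_diff D Z)" by blast
      also have "\<dots> = Z" unfolding toggle by blast
      finally show ?thesis using J(1) by (intro exI[of _ ?J]) auto
    qed
  qed
  have "face_cycles (X \<union> ?P) ?D'"
    unfolding face_cycles_def
  proof (intro conjI ballI allI impI)
    show "finite ?D'" using fin by simp
    fix F assume F: "F \<in> ?D'"
    show "F \<subseteq> X \<union> ?P" using F cyc(1) DX AB unfolding D1_def D2_def by blast
    show "\<exists>vs. is_cycle G vs \<and> cycle_edges vs = F" using F cyc(2) cyc12 by blast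
    fix F' assume F': "F' \<in> ?D'" "F \<noteq> F'"
    have sub: "inside (drawn G D1) \<subseteq> inside (drawn G D)" "inside (drawn G D2) \<subseteq> inside (drawn G D)"
      using split2 by blast+
    have other: "inside (drawn G H) \<inter> inside (drawn G D) = {}" if "H \<in> \<D> - {D}" for H
      using disj[of H D] that D(1) by blast
    consider "F \<in> \<D> - {D}" "F' \<in> \<D> - {D}" | "F \<in> \<D> - {D}" "F' \<in> {D1, D2}"
      | "F \<in> {D1, D2}" "F' \<in> \<D> - {D}" | "F \<in> {D1, D2}" "F' \<in> {D1, D2}"
      using F F' by blast
    then show "inside (drawn G F) \<inter> inside (drawn G F') = {}"
    proof cases
      case 1 then show ?thesis using disj F' by blast
    next
      case 2 then show ?thesis using other sub by blast
    next
      case 3 then show ?thesis using other sub by blast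
    next
      case 4 then show ?thesis using split1 F' by blast
    qed
  next
    have "inside (drawn G C) - drawn G (X \<union> ?P) = (\<Union>H\<in>\<D>. inside (drawn G H)) - drawn G ?P"
      unfolding cover[symmetric] by (auto simp: drawn_Un)
    also have "\<dots> = (\<Union>H\<in>\<D> - {D}. inside (drawn G H)) \<union> (inside (drawn G D1) \<union> inside (drawn G D2))"
    proof -
      have "inside (drawn G D) - drawn G ?P = inside (drawn G D1) \<union> inside (drawn G D2)"
        using split2 no_overlap by blast
      moreover have "inside (drawn G H) \<inter> drawn G ?P = {}" if H: "H \<in> \<D> - {D}" for H
      proof -
        have "inside (drawn G H) \<inter> inside (drawn G D) = {}" using disj[of H D] H D(1) by blast
        moreover have "inside (drawn G H) \<inter> drawn G X = {}" using cover H by blast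
        moreover have "drawn G ?P \<subseteq> inside (drawn G D) \<union> drawn G X"
          using Po_D uvC drawn_mono[OF X(2), of G] by blast
        ultimately show ?thesis by blast
      qed
      ultimately show ?thesis using D(1) by blast
    qed
    also have "\<dots> = (\<Union>D\<in>?D'. inside (drawn G D))" by blast
    finally show "inside (drawn G C) - drawn G (X \<union> ?P) = (\<Union>D\<in>?D'. inside (drawn G D))" .
  next
    fix e assume e: "e \<in> X \<union> ?P"
    show "card {D \<in> ?D'. e \<in> D} = (if e \<in> C then 1 else 2)"
    proof (cases "e \<in> ?P")
      case True
      then have "{D \<in> ?D'. e \<in> D} = {D1, D2}"
        using cyc(1) P(2) unfolding D1_def D2_def by blast
      then show ?thesis using new(3) True P'(3) by auto
    next
      case False
      then have eX: "e \<in> X" using e by blast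
      have fin': "finite {H \<in> \<D> - {D}. e \<in> H}" using fin by simp
      have e12: "e \<in> D1 \<longleftrightarrow> e \<in> A" "e \<in> D2 \<longleftrightarrow> e \<in> B" using False by (auto simp: D1_def D2_def)
      consider "e \<notin> D" | "e \<in> A" "e \<notin> B" | "e \<in> B" "e \<notin> A" using AB by blast
      then have "card {D \<in> ?D'. e \<in> D} = card {D \<in> \<D>. e \<in> D}"
      proof cases
        case 1
        then have "{D \<in> ?D'. e \<in> D} = {D \<in> \<D>. e \<in> D}" using e12 AB by auto
        then show ?thesis by simp
      next
        case 2
        then have "{D \<in> ?D'. e \<in> D} = insert D1 {H \<in> \<D> - {D}. e \<in> H}"
          "{D \<in> \<D>. e \<in> D} = insert D {H \<in> \<D> - {D}. e \<in> H}" using e12 AB D(1) by auto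
        then show ?thesis using fin' new(1) by simp
      next
        case 3
        then have "{D \<in> ?D'. e \<in> D} = insert D2 {H \<in> \<D> - {D}. e \<in> H}"
          "{D \<in> \<D>. e \<in> D} = insert D {H \<in> \<D> - {D}. e \<in> H}" using e12 AB D(1) by auto
        then show ?thesis using fin' new(2) by simp
      qed
      then show ?thesis using count[OF eX] by simp
    qed
  next
    fix Z assume Z: "Z \<subseteq> X \<union> ?P" "even_edges Z"
    show "\<exists>J\<subseteq>?D'. Z = mod2_sum (\<lambda>D. D) J"
    proof (cases "Z \<inter> ?P = {}")
      case True
      then have "Z \<subseteq> X" using Z(1) by blast
      from span_X[OF this Z(2)] show ?thesis .
    next
      case False
      then have "?P \<subseteq> Z"
        using chord_subset_even[OF P(1) Z(2)] Z(1) X(1) PE False by blast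
      then have "sym_diff D1 Z \<subseteq> X" using Z(1) DX AB by (auto simp: D1_def)
      moreover have "even_edges D1" using even_edges_cycle cyc12(1) by blast
      then have "even_edges (sym_diff D1 Z)" using Z(2) by (rule even_edges_sym_diff)
      ultimately have "\<exists>J\<subseteq>?D'. sym_diff D1 Z = mod2_sum (\<lambda>D. D) J" by (rule span_X)
      then obtain J where J: "J \<subseteq> ?D'" "sym_diff D1 Z = mod2_sum (\<lambda>D. D) J" by blast
      have finJ: "finite J" using J(1) fin by (meson finite_Diff finite_insert finite_subset)
      have Z_eq: "Z = sym_diff D1 (mod2_sum (\<lambda>D. D) J)" unfolding J(2)[symmetric] by blast
      show ?thesis
      proof (cases "D1 \<in> J")
        case True
        have Z': "Z = mod2_sum (\<lambda>D. D) (J - {D1})"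
          unfolding mod2_sum_remove[OF finJ True, of "\<lambda>D. D"] by (rule Z_eq)
        have "J - {D1} \<subseteq> ?D'" using J(1) by blast
        with Z' show ?thesis by (intro exI[of _ "J - {D1}"] conjI)
      next
        case False
        have Z': "Z = mod2_sum (\<lambda>D. D) (insert D1 J)"
          unfolding mod2_sum_insert[OF finJ False, of "\<lambda>D. D"] by (rule Z_eq)
        have "insert D1 J \<subseteq> ?D'" using J(1) by blast
        with Z' show ?thesis by (intro exI[of _ "insert D1 J"] conjI)
      qed
    qed
  qed
  then show ?thesis by blast
qed

lemma ex_face_cycles:
  assumes \<P>: "chord_family \<P>" "edges G = C \<union> \<Union> (path_edges ` \<P>)"
  shows "\<exists>\<D>. face_cycles (edges G) \<D>"
proof -
  have "finite \<Q> \<Longrightarrow> \<Q> \<subseteq> \<P> \<Longrightarrow> \<exists>\<D>. face_cycles (C \<union> \<Union> (path_edges ` \<Q>)) \<D>" for \<Q>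
  proof (induction \<Q> rule: finite_induct)
    case empty
    then show ?case using face_cycles_base by auto
  next
    case (insert P \<Q>)
    let ?X = "C \<union> \<Union> (path_edges ` \<Q>)"
    have P: "chord P" using insert.prems \<P>(1) by (auto simp: chord_family_def)
    have PQ: "path_edges P \<inter> path_edges Q = {}" "chord Q" if "Q \<in> \<Q>" for Q
    proof -
      have "P \<in> \<P>" "Q \<in> \<P>" "P \<noteq> Q" using that insert.prems insert.hyps(2) by auto
      then show "path_edges P \<inter> path_edges Q = {}" "chord Q"
        using \<P>(1) by (simp_all add: chord_family_def)
    qed
    have "path_edges P \<inter> C = {}" using P by (auto simp: chord_def)
    then have "path_edges P \<inter> ?X = {}" using PQ by blast
    moreover have "set P \<inter> \<Union> ?X \<subseteq> set cs"
    proof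
      fix x assume x: "x \<in> set P \<inter> \<Union> ?X"
      have "x \<notin> \<Union> (path_edges Q)" if "Q \<in> \<Q>" for Q
        using chord_disjoint[OF P PQ(2,1)[OF that]] Union_path_edges_subset[of Q] x by blast
      then have "x \<in> \<Union> C" using x by blast
      then show "x \<in> set cs" using Union_C by simp
    qed
    moreover have "?X \<subseteq> edges G" using \<P>(2) insert.prems by blast
    moreover obtain \<D> where "face_cycles ?X \<D>" using insert by blast
    ultimately obtain \<D>' where "face_cycles (?X \<union> path_edges P) \<D>'"
      using face_cycles_step[of ?X \<D> P] P by blast
    moreover have "C \<union> \<Union> (path_edges ` insert P \<Q>) = ?X \<union> path_edges P" by auto
    ultimately show ?case by metis
  qed
  then show ?thesis using chord_family_finite[OF \<P>(1)] unfolding \<P>(2) by blast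
qed

end

section \<open>Faces and chords\<close>

text \<open>The edge sets \<open>B s\<close> that bound the finite faces carry all the information on the drawing that
  perfect matchings depend on.\<close>

locale face_system = chorded_cycle G cs for G :: "('a, 'm) ugraph_scheme" and cs +
  fixes F :: "'f set" and B :: "'f \<Rightarrow> 'a set set"
  assumes finite_F: "finite F"
    and face_cycle: "s \<in> F \<Longrightarrow> \<exists>vs. is_cycle G vs \<and> cycle_edges vs = B s"
    and face_count: "e \<in> edges G \<Longrightarrow> card {s \<in> F. e \<in> B s} = (if e \<in> C then 1 else 2)"
    and face_span: "Z \<subseteq> edges G \<Longrightarrow> even_edges Z \<Longrightarrow> \<exists>J\<subseteq>F. Z = mod2_sum B J"
begin

lemma B_subset: "s \<in> F \<Longrightarrow> B s \<subseteq> edges G"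
  using face_cycle by (metis is_cycle_def)

lemma B_even: "s \<in> F \<Longrightarrow> even_edges (B s)"
  using face_cycle even_edges_cycle by metis

lemma B_star: "s \<in> F \<Longrightarrow> v \<in> \<Union> (B s) \<Longrightarrow> card {e \<in> B s. v \<in> e} = 2"
proof -
  assume s: "s \<in> F" "v \<in> \<Union> (B s)"
  obtain vs where vs: "is_cycle G vs" "cycle_edges vs = B s" using face_cycle s(1) by blast
  then have "v \<in> set vs" using Union_cycle_edges[OF vs(1)] s(2) by simp
  then show ?thesis using cycle_edges_at_card[OF vs(1), of v] vs(2) by simp
qed

lemma B_nonempty: "s \<in> F \<Longrightarrow> B s \<noteq> {}"
proof -
  assume "s \<in> F"
  then obtain vs where vs: "is_cycle G vs" "cycle_edges vs = B s" using face_cycle by blast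
  then have "vs \<noteq> []" by (auto simp: is_cycle_def)
  then show ?thesis using Union_cycle_edges[OF vs(1)] vs(2) by auto
qed

lemma outer_edge_face_unique:
  assumes "e \<in> C" "s \<in> F" "t \<in> F" "e \<in> B s" "e \<in> B t"
  shows "s = t"
proof -
  have "card {s \<in> F. e \<in> B s} = 1" using face_count[of e] assms(1) C_subset by auto
  then obtain r where "{s \<in> F. e \<in> B s} = {r}" by (rule card_1_singletonE)
  moreover have "s \<in> {s \<in> F. e \<in> B s}" "t \<in> {s \<in> F. e \<in> B s}" using assms by auto
  ultimately show ?thesis by simp
qed

lemma outer_edge_mem_mod2_sum:
  assumes "e \<in> C" "s \<in> F" "e \<in> B s" "J \<subseteq> F"
  shows "e \<in> mod2_sum B J \<longleftrightarrow> s \<in> J"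
proof -
  have "{t \<in> J. e \<in> B t} = (if s \<in> J then {s} else {})"
    using outer_edge_face_unique[OF assms(1,2) _ assms(3)] assms(3,4) by auto
  then show ?thesis by (simp add: mod2_sum_def)
qed

lemma finite_star [simp]: "finite (star v)"
  using finite_E by simp

lemma star_bound: "v \<in> verts G \<Longrightarrow> card (star v) \<le> 3"
  using degree[of v] by (auto simp: degree_def)

lemma edge_at_vertex: "e \<in> edges G \<Longrightarrow> v \<in> e \<Longrightarrow> v \<in> verts G"
  using edge_V by blast

lemma B_star_subset: "s \<in> F \<Longrightarrow> {e \<in> B s. v \<in> e} \<subseteq> star v"
  using B_subset by blast

text \<open>Each of the two faces uses two of the at most three edges at the common vertex.\<close>

lemma faces_share_edge:
  assumes "s \<in> F" "t \<in> F" "v \<in> \<Union> (B s)" "v \<in> \<Union> (B t)"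
  shows "\<exists>e \<in> B s \<inter> B t. v \<in> e"
proof (rule ccontr)
  assume "\<not> ?thesis"
  then have disj: "{e \<in> B s. v \<in> e} \<inter> {e \<in> B t. v \<in> e} = {}" by blast
  have v: "v \<in> verts G" using assms(1,3) B_subset edge_V by blast
  have sub: "{e \<in> B s. v \<in> e} \<union> {e \<in> B t. v \<in> e} \<subseteq> star v"
    using B_star_subset assms(1,2) by blast
  have "card ({e \<in> B s. v \<in> e} \<union> {e \<in> B t. v \<in> e}) = 4"
    using B_star[OF assms(1,3)] B_star[OF assms(2,4)] disj finite_subset[OF sub]
    by (subst card_Un_disjoint) simp_all
  then show False using card_mono[OF finite_star sub] star_bound[OF v] by linarith
qed

lemma degree_2_star:
  assumes "s \<in> F" "v \<in> \<Union> (B s)" "degree G v \<noteq> 3"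
  shows "{e \<in> B s. v \<in> e} = star v"
proof (rule card_subset_eq)
  have "v \<in> verts G" using assms(1,2) B_subset edge_V by blast
  then have "card (star v) = 2" using degree[of v] assms(3) by (auto simp: degree_def)
  then show "card {e \<in> B s. v \<in> e} = card (star v)" using B_star assms by simp
qed (use B_star_subset assms in auto)

lemma degree_3_edges:
  assumes "v \<in> verts G" "degree G v = 3"
  obtains p where "star v - C = {p}"
proof -
  have "card (star v - C) = 1" using star_diff_C[of v] degree_3 assms by simp
  then show thesis by (rule card_1_singletonE) (rule that)
qed

text \<open>Otherwise the face would use both edges of the periphery at \<open>v\<close>.  But a face next to the chord
  uses one of them too, and an edge of the periphery lies on one finite face only.\<close>

lemma face_uses_chord:
  assumes s: "s \<in> F" "v \<in> \<Union> (B s)" and p: "p \<in> star v - C"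
  shows "p \<in> B s"
proof (cases "v \<in> set cs")
  case True
  show ?thesis
  proof (rule ccontr)
    assume no: "p \<notin> B s"
    have only: "e = p" if "e \<in> star v - C" for e using two_off_cycle_edges_eq[OF True that p] .
    have "{e \<in> B s. v \<in> e} \<subseteq> star v \<inter> C"
      using only no B_star_subset[OF s(1)] by blast
    then have all: "{e \<in> B s. v \<in> e} = star v \<inter> C"
      using B_star[OF s] star_inter_C[OF True] by (intro card_subset_eq) auto
    have "card {t \<in> F. p \<in> B t} \<noteq> 0" using face_count[of p] p by simp
    then obtain t where t: "t \<in> F" "p \<in> B t" by (auto simp: card_eq_0_iff)
    have "card {e \<in> B t. v \<in> e} = 2" using B_star[OF t(1)] t(2) p by blast
    then obtain e where e: "e \<in> B t" "v \<in> e" "e \<noteq> p"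
      unfolding card_2_iff by (metis (mono_tags, lifting) insertCI mem_Collect_eq)
    then have "e \<in> C" using only B_subset[OF t(1)] by blast
    moreover from this have "e \<in> B s" using all e B_subset[OF t(1)] by blast
    ultimately have "s = t" using outer_edge_face_unique s(1) t(1) e(1) by blast
    then show False using no t by simp
  qed
next
  case False
  then have "degree G v \<noteq> 3" using degree_3 p edge_at_vertex by blast
  then show ?thesis using degree_2_star[OF s] p by blast
qed

lemma degree_3_face_edges:
  assumes s: "s \<in> F" "v \<in> \<Union> (B s)" and v: "degree G v = 3"
  obtains p e where "p \<notin> C" "e \<in> C" "{f \<in> B s. v \<in> f} = {p, e}"
proof -
  have "v \<in> verts G" using s B_subset edge_V by blast
  then obtain p where p: "star v - C = {p}" using degree_3_edges v by blast
  have pB: "p \<in> {f \<in> B s. v \<in> f}" using face_uses_chord[OF s, of p] p by blast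
  moreover have "card {f \<in> B s. v \<in> f} = 2" using B_star[OF s] .
  ultimately obtain e where e: "{f \<in> B s. v \<in> f} = {p, e}" "e \<noteq> p"
    unfolding card_2_iff by (metis (no_types, lifting) insertE insert_commute singletonD)
  moreover have "e \<in> {f \<in> B s. v \<in> f}" unfolding e(1) by simp
  ultimately have "e \<in> star v" using B_star_subset[OF s(1), of v] by blast
  then have "e \<in> C" using e(2) p by blast
  then show thesis using that[of p e] e p by blast
qed

text \<open>If all vertices of the face had degree 2, its boundary would be a component of the graph, hence
  the whole graph, and thus contain the periphery.\<close>

lemma face_outer_edge:
  assumes s: "s \<in> F"
  obtains e where "e \<in> B s" "e \<in> C"
proof (cases "\<exists>v\<in>\<Union> (B s). degree G v = 3")
  case True
  then obtain v where "v \<in> \<Union> (B s)" "degree G v = 3" by blast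
  from degree_3_face_edges[OF s this] obtain p e where e: "e \<in> C" "{f \<in> B s. v \<in> f} = {p, e}" .
  have "e \<in> {f \<in> B s. v \<in> f}" unfolding e(2) by simp
  then show thesis using that e(1) by blast
next
  case False
  have "B s = edges G"
  proof (rule edge_closed[OF B_subset[OF s] B_nonempty[OF s]])
    fix e e' v assume *: "e \<in> B s" "e' \<in> edges G" "v \<in> e" "v \<in> e'"
    then have "{e \<in> B s. v \<in> e} = star v" using degree_2_star[OF s] False by blast
    then show "e' \<in> B s" using * by blast
  qed
  then show thesis using that C_nonempty C_subset by blast
qed

text \<open>The faces in \<open>J\<close> can be read off the sum at one edge of the periphery for each face.\<close>

lemma mod2_sum_inj: "inj_on (mod2_sum B) (Pow F)"
proof (rule inj_onI)
  fix I J assume IJ: "I \<in> Pow F" "J \<in> Pow F" "mod2_sum B I = mod2_sum B J"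
  have "s \<in> I \<longleftrightarrow> s \<in> J" if "s \<in> F" for s
    using face_outer_edge[OF that] outer_edge_mem_mod2_sum that IJ by (metis PowD)
  then show "I = J" using IJ by blast
qed

section \<open>The two ends of a chord\<close>

text \<open>At each end of a chord, a face next to the chord also uses an edge of the periphery, and that
  edge tells whether the face takes part in a sum.  This transports information from one end of the
  chord to the other.\<close>

lemma chord_faces_of_mod2_sum:
  assumes Q: "chord Q" and w: "w \<in> set Q" "w \<in> set cs" and s: "s \<in> F" "path_edges Q \<subseteq> B s"
    and J: "J \<subseteq> F"
  obtains e where "e \<in> star w \<inter> C" "e \<in> mod2_sum B J \<longleftrightarrow> s \<in> J"
proof -
  have len: "length Q \<ge> 2" and QE: "path_edges Q \<subseteq> edges G - C" using Q by (auto simp: chord_def)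
  obtain p where p: "p \<in> path_edges Q" "w \<in> p" using Union_path_edges[OF len] w(1) by blast
  then have "card {f \<in> B s. w \<in> f} = 2" using B_star[OF s(1), of w] s(2) by blast
  moreover have "p \<in> {f \<in> B s. w \<in> f}" using p s(2) by blast
  ultimately obtain e where e: "e \<in> B s" "w \<in> e" "e \<noteq> p"
    by (auto simp: card_2_iff)
  have eE: "e \<in> edges G" using e(1) B_subset s(1) by blast
  have pE: "p \<in> star w - C" using p QE by blast
  have "e \<in> C"
    using two_off_cycle_edges_eq[OF w(2) _ pE, of e] e eE by blast
  then show thesis using that[of e] e eE outer_edge_mem_mod2_sum[OF _ s(1) e(1) J] by blast
qed

lemma chord_has_face:
  assumes "chord Q"
  obtains s where "s \<in> F" "path_edges Q \<subseteq> B s"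
proof -
  have "length Q \<ge> 2" and QE: "path_edges Q \<subseteq> edges G - C" using assms by (auto simp: chord_def)
  then have "path_edges Q \<noteq> {}" using Union_path_edges[of Q] by (cases Q) auto
  then obtain p where p: "p \<in> path_edges Q" by blast
  then have "card {t \<in> F. p \<in> B t} \<noteq> 0" using face_count[of p] QE by auto
  then obtain s where s: "s \<in> F" "p \<in> B s" by (auto simp: card_eq_0_iff)
  then have "path_edges Q \<subseteq> B s"
    using chord_subset_even[OF assms B_even[OF s(1)] B_subset[OF s(1)]] p by blast
  then show thesis using that s by blast
qed

lemma chord_ends_same_side:
  assumes Q: "chord Q" and ab: "a \<in> set Q" "a \<in> set cs" "b \<in> set Q" "b \<in> set cs"
    and Z: "even_edges Z" "Z \<subseteq> edges G" and a: "star a \<inter> C \<subseteq> Z"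
  shows "star b \<inter> C \<inter> Z \<noteq> {}"
proof -
  obtain J where J: "J \<subseteq> F" "Z = mod2_sum B J" using face_span[OF Z(2,1)] by blast
  obtain s where s: "s \<in> F" "path_edges Q \<subseteq> B s" using chord_has_face[OF Q] .
  obtain e where e: "e \<in> star a \<inter> C" "e \<in> mod2_sum B J \<longleftrightarrow> s \<in> J"
    using chord_faces_of_mod2_sum[OF Q ab(1,2) s J(1)] .
  then have "s \<in> J" using a J(2) by blast
  obtain e' where "e' \<in> star b \<inter> C" "e' \<in> mod2_sum B J \<longleftrightarrow> s \<in> J"
    using chord_faces_of_mod2_sum[OF Q ab(3,4) s J(1)] .
  then show ?thesis using \<open>s \<in> J\<close> J(2) by blast
qed

text \<open>Chords do not cross: the chord \<open>P\<close> closes an arc of the periphery to a cycle, which is a sum of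
  face boundaries, so the chords that start inside the arc also end there.  They match up the
  vertices of degree 3 inside the arc.\<close>

lemma even_degree_3_inside_arc:
  assumes \<P>: "chord_family \<P>" "edges G = C \<union> \<Union> (path_edges ` \<P>)"
    and P: "P \<in> \<P>" "hd P = u" "last P = v"
    and cyc: "is_cycle G (u # ys @ v # ws)" "cycle_edges (u # ys @ v # ws) = C"
  shows "even (card {w \<in> set ys. degree G w = 3})"
proof -
  have chP: "chord P" using \<P>(1) P(1) by (simp add: chord_family_def)
  obtain ps where P': "P = u # ps @ [v]" "distinct P" "path_edges P \<subseteq> edges G - C"
    "set ps \<inter> set cs = {}"
    using chP P(2,3) unfolding chord_def by auto
  have set_cs: "set (u # ys @ v # ws) = set cs"
    using Union_cycle_edges[OF cyc(1)] Union_C cyc(2) by simp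
  have dist: "distinct (u # ys @ v # ws)" using cyc(1) by (simp only: is_cycle_def)
  let ?A = "path_edges (u # ys @ [v])" and ?A' = "path_edges (v # ws @ [u])"
  define Z where "Z = ?A \<union> path_edges P"
  have parts: "C = ?A \<union> ?A'" "?A \<inter> ?A' = {}" using cycle_arcs[OF cyc(1)] cyc(2) by simp_all
  have Z: "even_edges Z" "Z \<subseteq> edges G"
  proof -
    have "is_cycle G (u # ys @ v # rev ps)" "cycle_edges (u # ys @ v # rev ps) = Z"
      using theta_cycles(1,2)[OF simple_graph cyc(1), of ps, unfolded set_cs cyc(2), folded P'(1),
          OF P'(2,4,3)] by (simp_all add: Z_def)
    then show "even_edges Z" "Z \<subseteq> edges G" using even_edges_cycle unfolding is_cycle_def by metis+
  qed
  have UA: "\<Union> ?A = set (u # ys @ [v])" and UA': "\<Union> ?A' = set (v # ws @ [u])"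
    by (rule Union_path_edges; simp)+
  have CZ: "C \<inter> Z = ?A" using parts P'(3) by (auto simp: Z_def simp del: path_edges_Cons)
  have inside: "star w \<inter> C \<subseteq> Z" if "w \<in> set ys" for w
  proof -
    have "w \<notin> \<Union> ?A'" using that dist UA' by auto
    then have "star w \<inter> C \<subseteq> ?A" using parts(1) by blast
    then show ?thesis by (auto simp: Z_def)
  qed
  have outside: "star w \<inter> C \<inter> Z = {}" if "w \<notin> set ys" "w \<noteq> u" "w \<noteq> v" for w
  proof -
    have "w \<notin> \<Union> ?A" using that UA by auto
    then show ?thesis using CZ by blast
  qed
  define W where "W = {w \<in> set ys. degree G w = 3}"
  have end_3: "degree G w = 3" if "chord Q" "w \<in> set Q" "w \<in> set cs" for Q w
  proof -
    have "length Q \<ge> 2" "path_edges Q \<subseteq> edges G - C" using that(1) by (auto simp: chord_def)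
    with that(2) obtain p where "p \<in> star w - C" using Union_path_edges[of Q] by blast
    then have "card (star w - C) \<noteq> 0" by (auto simp: card_eq_0_iff)
    then have "degree G w \<noteq> 2" using star_diff_C[OF that(3)] by simp
    then show ?thesis using degree[of w] that(3) cs_subset by blast
  qed
  \<comment> \<open>The other end \<open>b\<close> of a chord from inside the arc has an edge of \<open>Z\<close> on the periphery, and it is
      not an end of \<open>P\<close>, because chords are disjoint.  So it lies inside the arc.\<close>
  have same: "b \<in> W" if Q: "Q \<in> \<P>" and "a \<in> W" "a \<in> set Q" "b \<in> set Q" "b \<in> set cs" for Q a b
  proof -
    have chQ: "chord Q" using \<P>(1) Q by (simp add: chord_family_def)
    have a: "a \<in> set ys" "a \<in> set cs" using \<open>a \<in> W\<close> set_cs by (auto simp: W_def)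
    have "a \<notin> set P" using a dist P'(1,4) by auto
    then have "Q \<noteq> P" using \<open>a \<in> set Q\<close> by blast
    then have "set P \<inter> set Q = {}"
      using \<P>(1) P(1) Q by (intro chord_disjoint[OF chP chQ]) (simp add: chord_family_def)
    then have "b \<noteq> u" "b \<noteq> v" using P'(1) \<open>b \<in> set Q\<close> by auto
    moreover have "star b \<inter> C \<inter> Z \<noteq> {}"
      using chord_ends_same_side[OF chQ \<open>a \<in> set Q\<close> a(2) that(4,5) Z inside[OF a(1)]] .
    ultimately have "b \<in> set ys" using outside by blast
    then show ?thesis using end_3[OF chQ that(4,5)] by (simp add: W_def)
  qed
  define \<Q> where "\<Q> = {Q \<in> \<P>. hd Q \<in> W}"
  have ends: "hd Q \<noteq> last Q" "hd Q \<in> set cs" "last Q \<in> set cs" "hd Q \<in> set Q" "last Q \<in> set Q"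
    "set Q \<inter> set cs = {hd Q, last Q}" if "Q \<in> \<P>" for Q
  proof -
    have "chord Q" using that \<P>(1) by (simp add: chord_family_def)
    then show "hd Q \<noteq> last Q" "hd Q \<in> set cs" "last Q \<in> set cs" "hd Q \<in> set Q" "last Q \<in> set Q"
      "set Q \<inter> set cs = {hd Q, last Q}" unfolding chord_def by auto
  qed
  have "W = (\<Union>Q\<in>\<Q>. {hd Q, last Q})"
  proof (intro equalityI subsetI)
    fix w assume w: "w \<in> W"
    then have wcs: "w \<in> set cs" "degree G w = 3" using set_cs by (auto simp: W_def)
    then have "w \<in> verts G" using cs_subset by blast
    then obtain p where "star w - C = {p}" using degree_3_edges wcs(2) by blast
    then have p: "p \<in> edges G" "w \<in> p" "p \<notin> C" by auto
    then obtain Q where Q: "Q \<in> \<P>" "p \<in> path_edges Q" unfolding \<P>(2) by blast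
    then have "w \<in> set Q" using Union_path_edges_subset[of Q] p(2) by blast
    note Q = Q(1) this
    then have "w \<in> {hd Q, last Q}" using ends(6)[OF Q(1)] wcs(1) by blast
    moreover have "hd Q \<in> W" using same[OF Q(1) w Q(2)] ends[OF Q(1)] by blast
    ultimately show "w \<in> (\<Union>Q\<in>\<Q>. {hd Q, last Q})" using Q(1) unfolding \<Q>_def by blast
  next
    fix w assume "w \<in> (\<Union>Q\<in>\<Q>. {hd Q, last Q})"
    then obtain Q where Q: "Q \<in> \<P>" "hd Q \<in> W" "w = hd Q \<or> w = last Q" unfolding \<Q>_def by blast
    then show "w \<in> W" using same[OF Q(1,2)] ends[OF Q(1)] by blast
  qed
  moreover have "card (\<Union>Q\<in>\<Q>. {hd Q, last Q}) = (\<Sum>Q\<in>\<Q>. card {hd Q, last Q})"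
  proof (rule card_UN_disjoint)
    show "finite \<Q>" using chord_family_finite[OF \<P>(1)] by (simp add: \<Q>_def)
    show "\<forall>Q\<in>\<Q>. \<forall>R\<in>\<Q>. Q \<noteq> R \<longrightarrow> {hd Q, last Q} \<inter> {hd R, last R} = {}"
    proof (intro ballI impI)
      fix Q R assume QR: "Q \<in> \<Q>" "R \<in> \<Q>" "Q \<noteq> R"
      then have QR': "Q \<in> \<P>" "R \<in> \<P>" by (simp_all add: \<Q>_def)
      have "set Q \<inter> set R = {}"
        using \<P>(1) QR' QR(3) by (intro chord_disjoint) (simp_all add: chord_family_def)
      then show "{hd Q, last Q} \<inter> {hd R, last R} = {}"
      proof -
        have "{hd Q, last Q} \<subseteq> set Q" "{hd R, last R} \<subseteq> set R"
          using ends(4,5)[OF QR'(1)] ends(4,5)[OF QR'(2)] by simp_all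
        with \<open>set Q \<inter> set R = {}\<close> show ?thesis by blast
      qed
    qed
  qed simp
  moreover have "(\<Sum>Q\<in>\<Q>. card {hd Q, last Q}) = 2 * card \<Q>"
    using ends(1) by (simp add: \<Q>_def)
  ultimately show ?thesis unfolding W_def by simp
qed

end

lemma cyclically_alternating_nth:
  assumes "cyclically_alternating c ds" "k < length ds"
  shows "c (ds ! k) \<longleftrightarrow> c (ds ! 0) \<noteq> odd k"
  using assms(2)
proof (induction k)
  case (Suc k)
  then have "c (ds ! k) \<noteq> c (ds ! (Suc k mod length ds))"
    using assms(1) unfolding cyclically_alternating_def by simp
  then show ?case using Suc by auto
qed simp

lemma cyclically_alternating_even:
  assumes "cyclically_alternating c ds"
  shows "even (length ds)"
proof (cases "ds = []")
  case False
  then have k: "length ds - 1 < length ds" by simp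
  then have "c (ds ! (length ds - 1)) \<noteq> c (ds ! (Suc (length ds - 1) mod length ds))"
    using assms unfolding cyclically_alternating_def by blast
  moreover have "Suc (length ds - 1) mod length ds = 0" using False by simp
  ultimately have "odd (length ds - 1)"
    using cyclically_alternating_nth[OF assms k] by auto
  then show ?thesis using False by simp
qed simp

lemma proper_2_coloring_path:
  assumes "proper_2_coloring G c" "path_edges P \<subseteq> edges G" "i < length P"
  shows "c (P ! i) \<longleftrightarrow> c (P ! 0) \<noteq> odd i"
  using assms(3)
proof (induction i)
  case (Suc i)
  then have "{P ! i, P ! Suc i} \<in> edges G" using assms(2) by (auto simp: path_edges_def)
  then have "c (P ! i) \<noteq> c (P ! Suc i)" using assms(1) by (simp add: proper_2_coloring_def)
  then show ?case using Suc by auto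
qed simp

section \<open>A perfect matching for which all faces are resonant\<close>

context face_system
begin

text \<open>The vertices of degree 3 between the two ends are even in number and have alternating colors.\<close>

lemma chord_ends_colors:
  assumes c: "proper_2_coloring G c" "cyclically_alternating c (filter (\<lambda>v. degree G v = 3) cs)"
    and \<P>: "chord_family \<P>" "edges G = C \<union> \<Union> (path_edges ` \<P>)" and P: "P \<in> \<P>"
  shows "c (hd P) \<noteq> c (last P)"
proof -
  let ?d = "\<lambda>v. degree G v = 3"
  let ?ds = "filter ?d cs"
  have chP: "chord P" using \<P>(1) P by (simp add: chord_family_def)
  then obtain u ps v where P': "P = u # ps @ [v]" "distinct P" "path_edges P \<subseteq> edges G - C"
    "u \<in> set cs" "v \<in> set cs" unfolding chord_def by blast
  have UP: "\<Union> (path_edges P) = set P" by (rule Union_path_edges) (simp add: P'(1))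
  have deg: "?d w" if w: "w \<in> set P" "w \<in> set cs" for w
  proof -
    from w obtain p where "p \<in> star w - C" using UP P'(3) by blast
    then have "card (star w - C) \<noteq> 0" by (auto simp: card_eq_0_iff)
    then have "degree G w \<noteq> 2" using star_diff_C[OF w(2)] by simp
    then show ?thesis using degree[of w] w(2) cs_subset by blast
  qed
  have uv: "?d u" "?d v" "u \<noteq> v" using deg P' by auto
  have dist: "distinct cs" using outer_cycle by (simp add: is_cycle_def)
  have len_card: "length (filter ?d ys) = card {w \<in> set ys. ?d w}" if "distinct ys" for ys
    using distinct_card[of "filter ?d ys"] that by simp
  have pos: "c a \<noteq> c b" if cs: "cs = xs @ a # ys @ b # zs" and ab: "?d a" "?d b"
    and ev: "even (length (filter ?d ys))" for xs a ys b zs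
  proof -
    let ?i = "length (filter ?d xs)" and ?j = "length (filter ?d (xs @ a # ys))"
    have ds: "?ds = filter ?d xs @ a # filter ?d ys @ b # filter ?d zs" using cs ab by simp
    have nth: "?ds ! ?i = a" "?ds ! ?j = b" "?i < length ?ds" "?j < length ?ds"
      unfolding ds using ab by (auto simp: nth_append)
    have "odd ?i \<noteq> odd ?j" using ev ab by simp
    then show ?thesis
      using cyclically_alternating_nth[OF c(2) nth(3)] cyclically_alternating_nth[OF c(2) nth(4)]
      unfolding nth(1,2) by blast
  qed
  obtain xs rs where cs1: "cs = xs @ u # rs" using P'(4) by (meson split_list)
  then consider "v \<in> set rs" | "v \<in> set xs" using P'(5) uv(3) by auto
  then have "c u \<noteq> c v"
  proof cases
    case 1
    then obtain ys zs where "rs = ys @ v # zs" by (meson split_list)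
    then have cs: "cs = xs @ u # ys @ v # zs" using cs1 by simp
    have "is_cycle G (u # ys @ v # (zs @ xs))"
      using outer_cycle is_cycle_rotate[of G xs "u # ys @ v # zs"] cs by simp
    moreover have "cycle_edges (u # ys @ v # (zs @ xs)) = C"
      using cycle_edges_rotate[of xs "u # ys @ v # zs"] cs by simp
    ultimately have "even (card {w \<in> set ys. ?d w})"
      using even_degree_3_inside_arc[OF \<P> P] P'(1) by simp
    then show ?thesis using pos[OF cs uv(1,2)] len_card[of ys] dist cs by simp
  next
    case 2
    then obtain zs ys where "xs = zs @ v # ys" by (meson split_list)
    then have cs: "cs = zs @ v # ys @ u # rs" using cs1 by simp
    have "is_cycle G (u # (rs @ zs) @ v # ys)"
      using outer_cycle is_cycle_rotate[of G "zs @ v # ys" "u # rs"] cs by simp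
    moreover have "cycle_edges (u # (rs @ zs) @ v # ys) = C"
      using cycle_edges_rotate[of "zs @ v # ys" "u # rs"] cs by simp
    ultimately have "even (card {w \<in> set (rs @ zs). ?d w})"
      using P'(1) by (intro even_degree_3_inside_arc[OF \<P> P, of u v "rs @ zs" ys]) simp_all
    moreover have "distinct (rs @ zs)" using dist cs by auto
    ultimately have "even (length (filter ?d (rs @ zs)))" by (simp only: len_card)
    moreover have "even (length ?ds)" using cyclically_alternating_even[OF c(2)] .
    ultimately have "even (length (filter ?d ys))" using cs uv by auto
    then show ?thesis using pos[OF cs uv(2,1)] by auto
  qed
  then show ?thesis using P'(1) by simp
qed

text \<open>Along the periphery, colors alternate at every step, and the colors of the vertices of degree 3
  alternate too.  So an edge can be taken or left according to the color of its first end relative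
  to the last vertex of degree 3 at or before that end: this changes exactly at the vertices of degree 2.\<close>

lemma outer_matching:
  assumes c: "proper_2_coloring G c" "cyclically_alternating c (filter (\<lambda>v. degree G v = 3) cs)"
  obtains N where "N \<subseteq> C" "\<And>v. v \<in> set cs \<Longrightarrow> degree G v = 2 \<Longrightarrow> \<exists>!e. e \<in> N \<and> v \<in> e"
    "\<And>v e. degree G v = 3 \<Longrightarrow> e \<in> N \<Longrightarrow> v \<notin> e"
proof -
  let ?d = "\<lambda>v. degree G v = 3"
  let ?ds = "filter ?d cs"
  let ?n = "length cs"
  let ?E = "\<lambda>k. {cs ! k, cs ! (Suc k mod ?n)}"
  have n: "?n \<ge> 3" "distinct cs" using outer_cycle by (auto simp: is_cycle_def)
  define q where "q m \<longleftrightarrow> odd (length (filter ?d (take m cs)))" for m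
  define st where "st k \<longleftrightarrow> (c (cs ! k) \<noteq> q (Suc k)) = c (?ds ! 0)" for k
  define N where "N = {?E k | k. k < ?n \<and> st k}"
  have q0: "\<not> q 0" by (simp add: q_def)
  have qn: "\<not> q ?n" using cyclically_alternating_even[OF c(2)] by (simp add: q_def)
  have q_Suc: "q (Suc k) \<longleftrightarrow> q k \<noteq> ?d (cs ! k)" if "k < ?n" for k
    using that by (simp add: q_def take_Suc_conv_app_nth)
  have edge: "?E k \<in> edges G" if "k < ?n" for k
    using that C_subset by (auto simp: cycle_edges_def)
  have at_deg_3: "c (cs ! k) \<longleftrightarrow> c (?ds ! 0) \<noteq> q k" if k: "k < ?n" "?d (cs ! k)" for k
  proof -
    let ?m = "length (filter ?d (take k cs))"
    have "cs = take k cs @ cs ! k # drop (Suc k) cs" using k(1) by (rule id_take_nth_drop)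
    then have "?ds = filter ?d (take k cs) @ cs ! k # filter ?d (drop (Suc k) cs)"
      using k(2) by (metis (mono_tags, lifting) filter.simps(2) filter_append)
    then have "?ds ! ?m = cs ! k" "?m < length ?ds" by (auto simp: nth_append)
    then show ?thesis using cyclically_alternating_nth[OF c(2), of ?m] by (simp add: q_def)
  qed
  have status: "st i \<longleftrightarrow> \<not> ?d (cs ! j) \<and> \<not> st j" "?d (cs ! j) \<Longrightarrow> \<not> st j"
    if ij: "i < ?n" "Suc i mod ?n = j" for i j
  proof -
    have "Suc i mod ?n < ?n" using n by (intro mod_less_divisor) linarith
    then have j: "j < ?n" using ij by simp
    have "q (Suc i) \<longleftrightarrow> q j"
      using ij q0 qn by (cases "Suc i = ?n") (auto simp: mod_Suc)
    moreover have "c (cs ! i) \<noteq> c (cs ! j)"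
      using edge[OF ij(1)] c(1) ij(2) by (auto simp: proper_2_coloring_def)
    ultimately show "st i \<longleftrightarrow> \<not> ?d (cs ! j) \<and> \<not> st j" "?d (cs ! j) \<Longrightarrow> \<not> st j"
      using q_Suc[OF j] at_deg_3[OF j] unfolding st_def by auto
  qed
  have at: "e \<in> N \<and> cs ! j \<in> e \<longleftrightarrow> (st i \<and> e = ?E i) \<or> (st j \<and> e = ?E j)"
    if ij: "i < ?n" "Suc i mod ?n = j" for i j e
  proof
    assume e: "e \<in> N \<and> cs ! j \<in> e"
    then obtain k where k: "k < ?n" "st k" "e = ?E k" by (auto simp: N_def)
    have less: "Suc k mod ?n < ?n" "Suc i mod ?n < ?n" using n by (intro mod_less_divisor; linarith)+
    then have "j = k \<or> j = Suc k mod ?n"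
      using k(1,3) e ij n(2) by (auto simp: nth_eq_iff_index_eq)
    moreover have "k = i" if "j = Suc k mod ?n"
      using that ij k(1) by (auto simp: mod_Suc split: if_splits)
    ultimately show "(st i \<and> e = ?E i) \<or> (st j \<and> e = ?E j)" using k by blast
  next
    have "Suc i mod ?n < ?n" using n by (intro mod_less_divisor) linarith
    then have j: "j < ?n" using ij by simp
    assume "(st i \<and> e = ?E i) \<or> (st j \<and> e = ?E j)"
    then show "e \<in> N \<and> cs ! j \<in> e" using ij j by (auto simp: N_def)
  qed
  have pred: "\<exists>i j. i < ?n \<and> Suc i mod ?n = j \<and> v = cs ! j" if "v \<in> set cs" for v
  proof -
    from that obtain j where j: "j < ?n" "v = cs ! j" by (auto simp: in_set_conv_nth)
    show ?thesis
    proof (cases j)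
      case 0
      then show ?thesis using j n by (intro exI[of _ "?n - 1"] exI[of _ j]) auto
    next
      case (Suc i)
      then show ?thesis using j by (intro exI[of _ i] exI[of _ j]) auto
    qed
  qed
  show thesis
  proof
    show NC: "N \<subseteq> C" by (auto simp: N_def cycle_edges_def)
    fix v assume v: "v \<in> set cs" "degree G v = 2"
    then obtain i j where ij: "i < ?n" "Suc i mod ?n = j" "v = cs ! j" using pred by blast
    have "st i \<longleftrightarrow> \<not> st j" using status[OF ij(1,2)] v ij(3) by simp
    then show "\<exists>!e. e \<in> N \<and> v \<in> e" unfolding ij(3) at[OF ij(1,2)] by blast
  next
    fix v e assume v: "degree G v = 3" "e \<in> N"
    show "v \<notin> e"
    proof
      assume "v \<in> e"
      moreover have "e \<in> C" using v(2) by (auto simp: N_def cycle_edges_def)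
      ultimately have "v \<in> set cs" using Union_C by blast
      then obtain i j where ij: "i < ?n" "Suc i mod ?n = j" "v = cs ! j" using pred by blast
      then show False using at[OF ij(1,2), of e] status[OF ij(1,2)] v \<open>v \<in> e\<close> by auto
    qed
  qed
qed

text \<open>Since the ends of a chord have different colors, the chord has an odd number of edges, so its
  edges can be taken alternately beginning and finishing with an end edge.  Off the chords the
  matching is the one on the periphery.\<close>

lemma ex_root_matching:
  assumes c: "proper_2_coloring G c" "cyclically_alternating c (filter (\<lambda>v. degree G v = 3) cs)"
  obtains M where "perfect_matching G M" "\<And>v e. degree G v = 3 \<Longrightarrow> e \<in> M \<Longrightarrow> v \<in> e \<Longrightarrow> e \<notin> C"
proof -
  obtain N where N: "N \<subseteq> C" "\<And>v. v \<in> set cs \<Longrightarrow> degree G v = 2 \<Longrightarrow> \<exists>!e. e \<in> N \<and> v \<in> e"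
    "\<And>v e. degree G v = 3 \<Longrightarrow> e \<in> N \<Longrightarrow> v \<notin> e"
    using outer_matching[OF c] by blast
  obtain \<P> where \<P>: "chord_family \<P>" "edges G = C \<union> \<Union> (path_edges ` \<P>)"
    using chord_decomposition by blast
  define alt where "alt P = {{P ! i, P ! Suc i} | i. even i \<and> Suc i < length P}" for P :: "'a list"
  define M where "M = N \<union> \<Union> (alt ` \<P>)"
  have alt_sub: "alt P \<subseteq> path_edges P" for P by (auto simp: alt_def path_edges_def)
  have ch: "chord P" if "P \<in> \<P>" for P using that \<P>(1) by (simp add: chord_family_def)
  have chE: "path_edges P \<subseteq> edges G - C" "distinct P" if "P \<in> \<P>" for P
    using ch[OF that] by (auto simp: chord_def)
  have even_len: "even (length P)" if P: "P \<in> \<P>" for P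
  proof -
    have len: "length P \<ge> 2" using ch[OF P] by (auto simp: chord_def)
    then have "P \<noteq> []" by auto
    have "c (P ! (length P - 1)) \<longleftrightarrow> c (P ! 0) \<noteq> odd (length P - 1)"
    proof (rule proper_2_coloring_path[OF c(1)])
      show "path_edges P \<subseteq> edges G" using chE(1)[OF P] by blast
      show "length P - 1 < length P" using len by linarith
    qed
    then have "odd (length P - 1)"
      using chord_ends_colors[OF c \<P> P] \<open>P \<noteq> []\<close> by (auto simp: hd_conv_nth last_conv_nth)
    then show ?thesis using len by simp
  qed
  have alt_at: "\<exists>!e. e \<in> alt P \<and> x \<in> e" if P: "P \<in> \<P>" and x: "x \<in> set P" for P x
  proof -
    obtain j where j: "j < length P" "x = P ! j" using x by (auto simp: in_set_conv_nth)
    define i where "i = (if even j then j else j - 1)"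
    have i: "even i" "Suc i < length P" "j = i \<or> j = Suc i"
    proof -
      show "even i" "j = i \<or> j = Suc i" by (auto simp: i_def elim: oddE)
      then show "Suc i < length P" using j(1) even_len[OF P] by (metis Suc_lessI even_Suc)
    qed
    have uniq: "k = i" if "even k" "Suc k < length P" "x = P ! k \<or> x = P ! Suc k" for k
    proof -
      have "j = k \<or> j = Suc k"
        using that(2,3) j chE(2)[OF P] by (auto simp: nth_eq_iff_index_eq)
      then show ?thesis using that(1) by (auto simp: i_def)
    qed
    show ?thesis
    proof (rule ex1I[of _ "{P ! i, P ! Suc i}"])
      show "{P ! i, P ! Suc i} \<in> alt P \<and> x \<in> {P ! i, P ! Suc i}"
        using i j(2) unfolding alt_def by blast
      fix e assume "e \<in> alt P \<and> x \<in> e"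
      then obtain k where "even k" "Suc k < length P" "e = {P ! k, P ! Suc k}" "x \<in> e"
        unfolding alt_def by blast
      then show "e = {P ! i, P ! Suc i}" using uniq[of k] by blast
    qed
  qed
  have "perfect_matching G M"
    unfolding perfect_matching_def
  proof (intro conjI ballI)
    show "M \<subseteq> edges G" using N(1) C_subset alt_sub chE(1) unfolding M_def by blast
    fix v assume v: "v \<in> verts G"
    show "\<exists>!e. e \<in> M \<and> v \<in> e"
    proof (cases "\<exists>P\<in>\<P>. v \<in> set P")
      case True
      then obtain P where P: "P \<in> \<P>" "v \<in> set P" by blast
      have "v \<notin> e" if "e \<in> N" for e
      proof (cases "v \<in> set cs")
        case True
        have "length P \<ge> 2" using ch[OF P(1)] by (auto simp: chord_def)
        then obtain p where "p \<in> star v - C" using Union_path_edges[of P] P chE[OF P(1)] by blast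
        then have "card (star v - C) \<noteq> 0" by (auto simp: card_eq_0_iff)
        then have "degree G v = 3" using star_diff_C[OF True] degree[OF v] by auto
        then show ?thesis using N(3) that by blast
      next
        case False
        then show ?thesis using N(1) that Union_C by blast
      qed
      moreover have "v \<notin> e" if "e \<in> alt Q" "Q \<in> \<P>" "Q \<noteq> P" for e Q
      proof -
        have "set P \<inter> set Q = {}"
          using \<P>(1) that P(1) by (intro chord_disjoint ch) (simp_all add: chord_family_def)
        then show ?thesis
          using P(2) alt_sub[of Q] Union_path_edges_subset[of Q] that(1) by blast
      qed
      ultimately have "e \<in> M \<and> v \<in> e \<longleftrightarrow> e \<in> alt P \<and> v \<in> e" for e
        using P(1) unfolding M_def by blast
      then show ?thesis using alt_at[OF P] by simp
    next
      case False
      have notalt: "e \<notin> alt P \<or> v \<notin> e" if "P \<in> \<P>" for e P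
        using False that alt_sub[of P] Union_path_edges_subset[of P] by blast
      have off: "star v \<subseteq> C"
        using False Union_path_edges_subset unfolding \<P>(2) by fast
      have deg: "degree G v = card (star v)" by (simp add: degree_def)
      have vcs: "v \<in> set cs"
      proof (rule ccontr)
        assume "v \<notin> set cs"
        then have "star v = {}" using off Union_C by blast
        then have "card (star v) = 0" by (simp only: card.empty)
        then show False using degree[OF v] deg by linarith
      qed
      have no_chord: "star v - C = {}" using off by blast
      have "degree G v - 2 = 0" using star_diff_C[OF vcs] unfolding no_chord by simp
      then have "degree G v = 2" using degree[OF v] by linarith
      moreover have "e \<in> M \<and> v \<in> e \<longleftrightarrow> e \<in> N \<and> v \<in> e" for e
        using notalt unfolding M_def by blast
      ultimately show ?thesis using N(2)[OF vcs] by simp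
    qed
  qed
  moreover have "e \<notin> C" if "degree G v = 3" "e \<in> M" "v \<in> e" for v e
  proof -
    have "e \<notin> N" using N(3) that by blast
    with that(2) obtain P where "P \<in> \<P>" "e \<in> alt P" unfolding M_def by blast
    then show ?thesis using alt_sub[of P] chE(1)[of P] by blast
  qed
  ultimately show thesis using that by blast
qed

end

section \<open>Perfect matchings and independent sets of faces\<close>

lemma card_2_other:
  assumes "card A = 2" "m \<in> A"
  obtains m' where "A = {m, m'}" "m \<noteq> m'"
proof -
  obtain x y where "A = {x, y}" "x \<noteq> y" using assms(1) by (auto simp: card_2_iff)
  then show thesis using that[of x] that[of y] assms(2) by auto
qed

text \<open>The matching \<open>M0\<close> makes every finite face resonant; it corresponds to the empty independent set.\<close>

locale rooted_face_system = face_system G cs F B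
  for G :: "('a, 'm) ugraph_scheme" and cs and F :: "'f set" and B +
  fixes M0 :: "'a set set"
  assumes M0_matching: "perfect_matching G M0"
    and M0_chord: "degree G v = 3 \<Longrightarrow> e \<in> M0 \<Longrightarrow> v \<in> e \<Longrightarrow> e \<notin> C"
begin

definition independent_faces :: "'f set set" where
  "independent_faces = {J. J \<subseteq> F \<and> (\<forall>s\<in>J. \<forall>t\<in>J. s \<noteq> t \<longrightarrow> B s \<inter> B t = {})}"

definition matching_of :: "'f set \<Rightarrow> 'a set set" where
  "matching_of J = sym_diff M0 (mod2_sum B J)"

lemma independent_facesD:
  assumes "J \<in> independent_faces" "s \<in> J" "t \<in> J" "v \<in> \<Union> (B s)" "v \<in> \<Union> (B t)"
  shows "s = t"
  using faces_share_edge[of s t v] assms unfolding independent_faces_def by blast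

lemma finite_independent_faces: "J \<in> independent_faces \<Longrightarrow> finite J"
  unfolding independent_faces_def using finite_F finite_subset by blast

lemma perfect_matching_ex1: "perfect_matching G M \<Longrightarrow> v \<in> verts G \<Longrightarrow> \<exists>!e. e \<in> M \<and> v \<in> e"
  by (simp add: perfect_matching_def)

text \<open>At a vertex of degree 2 the face uses all edges, and at a vertex of degree 3 it uses the chord,
  which is the edge of \<open>M0\<close> there.\<close>

lemma face_resonant_M0:
  assumes s: "s \<in> F" "v \<in> \<Union> (B s)" and m: "m \<in> M0" "v \<in> m"
  shows "m \<in> B s"
proof -
  have mE: "m \<in> edges G" using M0_matching m(1) by (auto simp: perfect_matching_def)
  show ?thesis
  proof (cases "degree G v = 3")
    case True
    then show ?thesis using face_uses_chord[OF s, of m] M0_chord[OF True m] m mE by blast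
  next
    case False
    then have "{e \<in> B s. v \<in> e} = star v" using degree_2_star[OF s] by blast
    then show ?thesis using m mE by blast
  qed
qed

text \<open>Independent faces are vertex disjoint, so at each vertex at most one of them exchanges its two
  edges, of which exactly one belongs to \<open>M0\<close>.\<close>

lemma matching_of_perfect:
  assumes J: "J \<in> independent_faces"
  shows "perfect_matching G (matching_of J)"
  unfolding perfect_matching_def
proof (intro conjI ballI)
  have JF: "J \<subseteq> F" using J by (simp add: independent_faces_def)
  have "M0 \<subseteq> edges G" using M0_matching by (simp add: perfect_matching_def)
  moreover have "mod2_sum B J \<subseteq> edges G" using JF B_subset by (intro mod2_sum_subset) blast
  ultimately show "matching_of J \<subseteq> edges G" unfolding matching_of_def by blast
  fix v assume v: "v \<in> verts G"
  obtain m where m: "m \<in> M0" "v \<in> m" and m_uniq: "\<And>e. e \<in> M0 \<Longrightarrow> v \<in> e \<Longrightarrow> e = m"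
    using perfect_matching_ex1[OF M0_matching v] by blast
  show "\<exists>!e. e \<in> matching_of J \<and> v \<in> e"
  proof (cases "\<exists>s\<in>J. v \<in> \<Union> (B s)")
    case True
    then obtain s where s: "s \<in> J" "v \<in> \<Union> (B s)" by blast
    then have sF: "s \<in> F" using JF by blast
    have mem: "e \<in> mod2_sum B J \<longleftrightarrow> e \<in> B s" if "v \<in> e" for e
    proof -
      have "{t \<in> J. e \<in> B t} = (if e \<in> B s then {s} else {})"
        using independent_facesD[OF J s(1)] s that by auto
      then show ?thesis by (simp add: mod2_sum_def)
    qed
    have "m \<in> {e \<in> B s. v \<in> e}" using face_resonant_M0[OF sF s(2) m] m(2) by blast
    with B_star[OF sF s(2)] obtain m' where m': "{e \<in> B s. v \<in> e} = {m, m'}" "m \<noteq> m'"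
      by (rule card_2_other)
    have in_s: "e \<in> B s \<longleftrightarrow> e = m \<or> e = m'" if "v \<in> e" for e
      using m'(1) that by blast
    have "v \<in> m'" using m'(1) by blast
    have "e \<in> matching_of J \<longleftrightarrow> e = m'" if "v \<in> e" for e
      unfolding matching_of_def using mem[OF that] in_s[OF that] m m_uniq[OF _ that] m'(2) by blast
    then show ?thesis using \<open>v \<in> m'\<close> by blast
  next
    case False
    have "e \<notin> mod2_sum B J" if "v \<in> e" for e
    proof -
      have "{t \<in> J. e \<in> B t} = {}" using False that by blast
      then show ?thesis by (simp only: mod2_sum_def mem_Collect_eq card.empty even_zero not_True_eq_False not_False_eq_True)
    qed
    then show ?thesis using m m_uniq unfolding matching_of_def by blast
  qed
qed

text \<open>Following a common edge through vertices of degree 2, the faces stay together.  If they did not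
  reach a vertex of degree 3, connectedness would give them an edge of the periphery in common.\<close>

lemma common_edge_common_degree_3:
  assumes s: "s \<in> F" and t: "t \<in> F" and st: "s \<noteq> t" "B s \<inter> B t \<noteq> {}"
  obtains v where "v \<in> \<Union> (B s)" "v \<in> \<Union> (B t)" "degree G v = 3"
proof -
  have "\<exists>v\<in>\<Union> (B s \<inter> B t). degree G v = 3"
  proof (rule ccontr)
    assume no: "\<not> ?thesis"
    have sub: "B s \<inter> B t \<subseteq> edges G" using B_subset[OF s] by blast
    have "B s \<inter> B t = edges G"
    proof (rule edge_closed[OF sub st(2)])
      fix e e' v assume *: "e \<in> B s \<inter> B t" "e' \<in> edges G" "v \<in> e" "v \<in> e'"
      then have "degree G v \<noteq> 3" using no by blast
      then have "{e \<in> B s. v \<in> e} = star v" "{e \<in> B t. v \<in> e} = star v"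
        using degree_2_star s t * by blast+
      then show "e' \<in> B s \<inter> B t" using * by blast
    qed
    moreover obtain e where "e \<in> C" using C_nonempty by blast
    ultimately show False using outer_edge_face_unique[OF _ s t, of e] C_subset st(1) by blast
  qed
  then show thesis using that by blast
qed

text \<open>The sum of two perfect matchings is even, hence a sum of face boundaries.  Two of these faces
  cannot be adjacent: at a vertex of degree 3 common to both, the sum would contain two edges of the
  periphery, neither of which belongs to \<open>M0\<close>.\<close>

lemma matching_of_surj:
  assumes M: "perfect_matching G M"
  obtains J where "J \<in> independent_faces" "M = matching_of J"
proof -
  let ?Z = "sym_diff M0 M"
  have sub: "M0 \<subseteq> edges G" "M \<subseteq> edges G" using M M0_matching by (simp_all add: perfect_matching_def)
  then have fin: "finite M0" "finite M" using finite_E finite_subset by blast+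
  have one: "card {e \<in> N. v \<in> e} = (if v \<in> verts G then 1 else 0)" if N: "perfect_matching G N" for N v
  proof (cases "v \<in> verts G")
    case True
    then obtain m where "m \<in> N" "v \<in> m" "\<And>e. e \<in> N \<Longrightarrow> v \<in> e \<Longrightarrow> e = m"
      using perfect_matching_ex1[OF N] by blast
    then have "{e \<in> N. v \<in> e} = {m}" by blast
    then show ?thesis using True by simp
  next
    case False
    then have "{e \<in> N. v \<in> e} = {}" using N edge_V unfolding perfect_matching_def by blast
    then show ?thesis using False by (simp only: card.empty if_False)
  qed
  have Z_even: "even_edges ?Z"
    unfolding even_edges_def
  proof (intro conjI allI)
    show "finite ?Z" using fin by blast
    fix v
    have "{e \<in> ?Z. v \<in> e} = sym_diff {e \<in> M0. v \<in> e} {e \<in> M. v \<in> e}" by blast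
    moreover have "even (card (sym_diff {e \<in> M0. v \<in> e} {e \<in> M. v \<in> e}))"
      using odd_card_sym_diff[of "{e \<in> M0. v \<in> e}" "{e \<in> M. v \<in> e}"] fin
      by (simp add: one[OF M] one[OF M0_matching])
    ultimately show "even (card {e \<in> ?Z. v \<in> e})" by (simp only:)
  qed
  have "?Z \<subseteq> edges G" using sub by blast
  from face_span[OF this Z_even] obtain J where J: "J \<subseteq> F" "?Z = mod2_sum B J" by blast
  have "B s \<inter> B t = {}" if st: "s \<in> J" "t \<in> J" "s \<noteq> t" for s t
  proof (rule ccontr)
    assume ne: "B s \<inter> B t \<noteq> {}"
    have F: "s \<in> F" "t \<in> F" using st J(1) by auto
    obtain v where v: "v \<in> \<Union> (B s)" "v \<in> \<Union> (B t)" "degree G v = 3"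
      using common_edge_common_degree_3[OF F st(3) ne] .
    have outer: "\<exists>e. e \<in> C \<and> e \<in> B r \<and> v \<in> e \<and> e \<in> M" if r: "r \<in> J" "v \<in> \<Union> (B r)" for r
    proof -
      have rF: "r \<in> F" using r(1) J(1) by blast
      obtain p e where e: "e \<in> C" "{f \<in> B r. v \<in> f} = {p, e}"
        using degree_3_face_edges[OF rF r(2) v(3)] .
      then have e': "e \<in> B r" "v \<in> e" by blast+
      have "e \<in> ?Z" unfolding J(2) using outer_edge_mem_mod2_sum[OF e(1) rF e'(1) J(1)] r(1) by simp
      moreover have "e \<notin> M0" using M0_chord[OF v(3) _ e'(2)] e(1) by blast
      ultimately show ?thesis using e(1) e' by blast
    qed
    obtain e e' where e: "e \<in> C" "e \<in> B s" "v \<in> e" "e \<in> M" "e' \<in> C" "e' \<in> B t" "v \<in> e'" "e' \<in> M"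
      using outer[OF st(1) v(1)] outer[OF st(2) v(2)] by blast
    have "v \<in> verts G" using v(1) B_subset[OF F(1)] edge_V by blast
    then have "e = e'" using perfect_matching_ex1[OF M] e by blast
    then show False using outer_edge_face_unique[OF e(1) F] e st(3) by blast
  qed
  then have "J \<in> independent_faces" using J(1) by (simp add: independent_faces_def)
  moreover have "M = matching_of J" unfolding matching_of_def J(2)[symmetric] by blast
  ultimately show thesis using that by blast
qed

lemma matching_of_sym_diff:
  assumes "I \<subseteq> F" "J \<subseteq> F"
  shows "sym_diff (matching_of I) (matching_of J) = mod2_sum B (sym_diff I J)"
proof -
  have "finite I" "finite J" using assms finite_F finite_subset by blast+
  then show ?thesis unfolding matching_of_def mod2_sum_sym_diff[OF \<open>finite I\<close> \<open>finite J\<close>] by blast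
qed

lemma matching_of_flip_iff:
  assumes "I \<in> independent_faces" "J \<in> independent_faces" "s \<in> F"
  shows "sym_diff (matching_of I) (matching_of J) = B s \<longleftrightarrow> sym_diff I J = {s}"
proof -
  have IJ: "I \<subseteq> F" "J \<subseteq> F" using assms by (simp_all add: independent_faces_def)
  have "sym_diff (matching_of I) (matching_of J) = B s \<longleftrightarrow> mod2_sum B (sym_diff I J) = mod2_sum B {s}"
    using matching_of_sym_diff[OF IJ] by simp
  also have "\<dots> \<longleftrightarrow> sym_diff I J = {s}"
    using inj_on_eq_iff[OF mod2_sum_inj, of "sym_diff I J" "{s}"] IJ assms(3) by blast
  finally show ?thesis .
qed

lemma matching_of_inj: "inj_on matching_of independent_faces"
proof (rule inj_onI)
  fix I J assume IJ: "I \<in> independent_faces" "J \<in> independent_faces" "matching_of I = matching_of J"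
  then have F: "I \<subseteq> F" "J \<subseteq> F" by (simp_all add: independent_faces_def)
  have "mod2_sum B I = sym_diff M0 (matching_of I)" "mod2_sum B J = sym_diff M0 (matching_of J)"
    unfolding matching_of_def by blast+
  then have "mod2_sum B I = mod2_sum B J" using IJ(3) by simp
  then show "I = J" using inj_on_eq_iff[OF mod2_sum_inj, of I J] F by blast
qed

lemma matching_of_image: "matching_of ` independent_faces = {M. perfect_matching G M}"
  using matching_of_perfect matching_of_surj by blast

lemma face_alternating_M0:
  assumes s: "s \<in> F" and vs: "is_cycle G vs" "cycle_edges vs = B s"
  shows "alternating_cycle G M0 vs"
  unfolding alternating_cycle_def
proof (intro conjI allI impI vs(1))
  fix i assume i: "i < length vs"
  define j where "j = Suc i mod length vs"
  let ?a = "{vs ! i, vs ! j}" and ?b = "{vs ! j, vs ! (Suc j mod length vs)}"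
  have "length vs \<ge> 3" using vs(1) by (simp add: is_cycle_def)
  then have "j < length vs" unfolding j_def by (intro mod_less_divisor) linarith
  have star: "{e \<in> B s. vs ! j \<in> e} = {?a, ?b}" "?a \<noteq> ?b"
    using cycle_star[OF vs(1) i j_def[symmetric]] vs(2) unfolding j_def[symmetric] by blast+
  then have v: "vs ! j \<in> \<Union> (B s)" by blast
  then have "vs ! j \<in> verts G" using B_subset[OF s] edge_V by blast
  then obtain m where m: "m \<in> M0" "vs ! j \<in> m" "\<And>e. e \<in> M0 \<Longrightarrow> vs ! j \<in> e \<Longrightarrow> e = m"
    using perfect_matching_ex1[OF M0_matching] by blast
  have "m \<in> {e \<in> B s. vs ! j \<in> e}" using face_resonant_M0[OF s v m(1,2)] m(2) by blast
  then have "m = ?a \<or> m = ?b" unfolding star(1) by blast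
  moreover have "?a \<in> M0 \<longleftrightarrow> m = ?a" "?b \<in> M0 \<longleftrightarrow> m = ?b" using m by blast+
  ultimately have "(?a \<in> M0) \<noteq> (?b \<in> M0)" using star(2) by blast
  moreover have "Suc (Suc i) mod length vs = Suc j mod length vs" by (simp add: j_def mod_Suc_eq)
  ultimately show "({vs ! i, vs ! (Suc i mod length vs)} \<in> M0) \<noteq>
      ({vs ! (Suc i mod length vs), vs ! (Suc (Suc i) mod length vs)} \<in> M0)"
    unfolding j_def by metis
qed

end

section \<open>Hypercubes in the covering graph of a simplicial complex\<close>

abbreviation flip :: "bool list \<Rightarrow> nat \<Rightarrow> bool list" where
  "flip x i \<equiv> x[i := \<not> x ! i]"

lemma verts_hypercube: "verts (hypercube k) = {x. length x = k}"
  by (auto simp: hypercube_def cartesian_power_def K2_def)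

lemma hypercube_edge_iff:
  assumes "length x = k" "length y = k"
  shows "{x, y} \<in> edges (hypercube k) \<longleftrightarrow> (\<exists>i<k. \<forall>j<k. x ! j \<noteq> y ! j \<longleftrightarrow> j = i)"
proof -
  have K: "{a, b} \<in> edges K2 \<longleftrightarrow> a \<noteq> b" for a b :: bool
    by (auto simp: K2_def doubleton_eq_iff)
  have V: "set z \<subseteq> verts K2" for z
    by (auto simp: K2_def)
  have "{x, y} \<in> edges (hypercube k) \<longleftrightarrow>
    (\<exists>xs ys. {x, y} = {xs, ys} \<and> length xs = k \<and> length ys = k \<and>
      (\<exists>i<k. xs ! i \<noteq> ys ! i \<and> (\<forall>j<k. j \<noteq> i \<longrightarrow> xs ! j = ys ! j)))"
    unfolding hypercube_def cartesian_power_def by (simp add: K V)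
  also have "\<dots> \<longleftrightarrow> (\<exists>i<k. x ! i \<noteq> y ! i \<and> (\<forall>j<k. j \<noteq> i \<longrightarrow> x ! j = y ! j))"
    using assms unfolding doubleton_eq_iff by (auto; metis)
  finally show ?thesis by blast
qed

lemma flip_edge:
  assumes "length x = k" "i < k"
  shows "{x, flip x i} \<in> edges (hypercube k)"
  using assms by (subst hypercube_edge_iff) (auto simp: nth_list_update)

lemma xor_twice: "sym_diff (sym_diff X {a}) {a} = X"
  by auto

lemma bool_list_flip_induct:
  assumes "length x = k"
    and base: "P (replicate k False)"
    and step: "\<And>x i. length x = k \<Longrightarrow> i < k \<Longrightarrow> P x \<Longrightarrow> P (flip x i)"
  shows "P x"
  using assms(1)
proof (induction "card {i. i < k \<and> x ! i}" arbitrary: x)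
  case 0
  then have "x = replicate k False"
    by (intro nth_equalityI) auto
  then show ?case using base by simp
next
  case (Suc n)
  then obtain i where i: "i < k" "x ! i"
    by (metis (mono_tags, lifting) Collect_empty_eq card.empty nat.distinct(1))
  have "{j. j < k \<and> flip x i ! j} = {j. j < k \<and> x ! j} - {i}"
    using i Suc.prems by (auto simp: nth_list_update)
  then have "card {j. j < k \<and> flip x i ! j} = n"
    using Suc.hyps(2) i by simp
  then have "P (flip x i)"
    using Suc.hyps(1) Suc.prems by simp
  then have "P (flip (flip x i) i)"
    using step[of "flip x i" i] i(1) Suc.prems by (simp only: length_list_update)
  moreover have "flip (flip x i) i = x"
    using i Suc.prems list_update_id[of x i] by simp
  ultimately show ?case by metis
qed

text \<open>\<open>K\<close> is a simplicial complex, and \<open>R\<close> is the covering relation of \<open>K\<close>, ordered by inclusion, as a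
  graph whose vertices are renamed by \<open>\<Phi>\<close>.\<close>

locale cube_complex =
  fixes K :: "'f set set" and \<Phi> :: "'f set \<Rightarrow> 'v" and R :: "'v ugraph"
  assumes empty_mem: "{} \<in> K"
    and down: "I \<in> K \<Longrightarrow> J \<subseteq> I \<Longrightarrow> J \<in> K"
    and fin: "I \<in> K \<Longrightarrow> finite I"
    and inj: "inj_on \<Phi> K"
    and verts_R: "verts R = \<Phi> ` K"
    and edges_R: "edges R = {{\<Phi> I, \<Phi> J} | I J. I \<in> K \<and> J \<in> K \<and> (\<exists>s. sym_diff I J = {s})}"
begin

definition cube :: "'f set \<Rightarrow> 'f set \<Rightarrow> 'v ugraph" where
  "cube A S = \<lparr>verts = \<Phi> ` {J. A \<subseteq> J \<and> J \<subseteq> A \<union> S},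
     edges = {{\<Phi> I, \<Phi> J} | I J. A \<subseteq> I \<and> I \<subseteq> A \<union> S \<and> A \<subseteq> J \<and> J \<subseteq> A \<union> S \<and>
                (\<exists>s. sym_diff I J = {s})}\<rparr>"

lemma edge_R_iff:
  assumes "I \<in> K" "J \<in> K"
  shows "{\<Phi> I, \<Phi> J} \<in> edges R \<longleftrightarrow> (\<exists>s. sym_diff I J = {s})"
proof
  assume "{\<Phi> I, \<Phi> J} \<in> edges R"
  then obtain I' J' s where *: "{\<Phi> I, \<Phi> J} = {\<Phi> I', \<Phi> J'}" "I' \<in> K" "J' \<in> K" "sym_diff I' J' = {s}"
    unfolding edges_R by blast
  then have "(I = I' \<and> J = J') \<or> (I = J' \<and> J = I')"
    using assms inj unfolding doubleton_eq_iff by (auto dest: inj_onD)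
  then show "\<exists>s. sym_diff I J = {s}" using *(4) by (auto simp: Un_commute)
qed (use assms edges_R in blast)

text \<open>The label of an edge is the element in which the two sets differ.  Edges in the same direction
  have the same label, since opposite edges of a square do.  So the vertices arise from one of them
  by toggling an arbitrary part of the set of labels, and they form an interval.\<close>

lemma hypercube_is_interval:
  assumes Q: "subgraph Q R" and \<phi>: "graph_iso \<phi> Q (hypercube k)"
  obtains A lab where "inj_on lab {..<k}" "A \<inter> lab ` {..<k} = {}" "A \<union> lab ` {..<k} \<in> K"
    "Q = cube A (lab ` {..<k})"
    "\<And>I J i. I \<in> K \<Longrightarrow> J \<in> K \<Longrightarrow> {\<Phi> I, \<Phi> J} \<in> edges Q \<Longrightarrow> i < k \<Longrightarrow>
       \<phi> (\<Phi> I) ! i \<noteq> \<phi> (\<Phi> J) ! i \<longleftrightarrow> sym_diff I J = {lab i}"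
proof -
  have bij: "bij_betw \<phi> (verts Q) {x. length x = k}"
    using \<phi> by (simp add: graph_iso_def verts_hypercube)
  have VQ: "verts Q \<subseteq> \<Phi> ` K" and EQ: "edges Q \<subseteq> edges R"
    and simpleQ: "simple_graph Q"
    using Q by (auto simp: subgraph_def verts_R)
  define N where "N x = inv_into K \<Phi> (inv_into (verts Q) \<phi> x)" for x
  have N: "N x \<in> K" "\<Phi> (N x) \<in> verts Q" "\<phi> (\<Phi> (N x)) = x" if "length x = k" for x
  proof -
    have "inv_into (verts Q) \<phi> x \<in> verts Q" "\<phi> (inv_into (verts Q) \<phi> x) = x"
      using bij that by (auto simp: bij_betw_def intro: inv_into_into f_inv_into_f)
    moreover from this(1) VQ have "N x \<in> K" "\<Phi> (N x) = inv_into (verts Q) \<phi> x"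
      unfolding N_def by (auto intro: inv_into_into f_inv_into_f)
    ultimately show "N x \<in> K" "\<Phi> (N x) \<in> verts Q" "\<phi> (\<Phi> (N x)) = x" by auto
  qed
  have len: "length (\<phi> v) = k" if "v \<in> verts Q" for v
    using bij that by (auto simp: bij_betw_def)
  have N\<phi>: "\<Phi> (N (\<phi> v)) = v" if "v \<in> verts Q" for v
    using bij that N[OF len[OF that]] by (auto simp: bij_betw_def dest: inj_onD)
  have N_inj: "N x \<noteq> N y" if "length x = k" "length y = k" "x \<noteq> y" for x y
    using N(3)[OF that(1)] N(3)[OF that(2)] that(3) by auto
  have edge: "{\<Phi> (N x), \<Phi> (N y)} \<in> edges Q \<longleftrightarrow> {x, y} \<in> edges (hypercube k)"
    if "length x = k" "length y = k" for x y
    using \<phi> N that unfolding graph_iso_def by (metis (no_types, lifting))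
  define \<mu> where "\<mu> x i = the_elem (sym_diff (N x) (N (flip x i)))" for x i
  have \<mu>: "N (flip x i) = sym_diff (N x) {\<mu> x i}" if x: "length x = k" "i < k" for x i
  proof -
    have "{\<Phi> (N x), \<Phi> (N (flip x i))} \<in> edges R"
      using edge flip_edge x EQ by (metis length_list_update subsetD)
    then have "\<exists>s. sym_diff (N x) (N (flip x i)) = {s}"
      using edge_R_iff N(1) x by (metis length_list_update)
    then have "sym_diff (N x) (N (flip x i)) = {\<mu> x i}"
      unfolding \<mu>_def by (metis the_elem_eq)
    then show ?thesis by blast
  qed
  \<comment> \<open>Opposite edges of a square carry the same label: the two ways around the square change
      the same two elements, and the start of the second way differs from the start of the first.\<close>
  have square: "\<mu> (flip x j) i = \<mu> x i" if x: "length x = k" "i < k" "j < k" for x i j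
  proof (cases "i = j")
    case True
    have "flip (flip x i) i = x" using x by simp
    then have "N x = sym_diff (sym_diff (N x) {\<mu> x i}) {\<mu> (flip x i) i}"
      using \<mu>[of x i] \<mu>[of "flip x i" i] x by simp
    then show ?thesis using True by blast
  next
    case False
    have sw: "flip (flip x i) j = flip (flip x j) i"
      using False x by (simp add: list_update_swap)
    have N2: "N (flip (flip x i) j) = sym_diff (sym_diff (N x) {\<mu> x i}) {\<mu> (flip x i) j}"
      if "length x = k" "i < k" "j < k" for x i j
      using \<mu>[of "flip x i" j, unfolded \<mu>[OF that(1,2)]] that by (simp only: length_list_update)
    have 1: "sym_diff (sym_diff (N x) {\<mu> x i}) {\<mu> (flip x i) j}
        = sym_diff (sym_diff (N x) {\<mu> x j}) {\<mu> (flip x j) i}"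
      using N2[OF x] N2[OF x(1,3,2)] unfolding sw by (rule HOL.trans[OF sym])
    have "flip x i \<noteq> flip x j"
      using False x by (metis nth_list_update_eq nth_list_update_neq)
    then have "N (flip x i) \<noteq> N (flip x j)"
      by (intro N_inj) (simp_all add: x(1))
    then have 2: "\<mu> x i \<noteq> \<mu> x j"
      unfolding \<mu>[OF x(1,2)] \<mu>[OF x(1,3)] by metis
    have "flip (flip x i) j \<noteq> x"
      using False x by (metis nth_list_update_eq nth_list_update_neq)
    then have "N (flip (flip x i) j) \<noteq> N x"
      by (intro N_inj) (simp_all add: x(1))
    then have 3: "\<mu> (flip x i) j \<noteq> \<mu> x i"
      unfolding N2[OF x] using xor_twice[of "N x"] by metis
    have "\<mu> x i \<in> N x \<longleftrightarrow> \<mu> x i \<notin> sym_diff (sym_diff (N x) {\<mu> x i}) {\<mu> (flip x i) j}"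
      using 3 by auto
    then show ?thesis unfolding 1 using 2 by auto
  qed
  define lab where "lab i = \<mu> (replicate k False) i" for i
  have \<mu>lab: "\<mu> x i = lab i" if "length x = k" "i < k" for x i
    by (rule bool_list_flip_induct[OF that(1)]) (use lab_def square that(2) in auto)
  have injlab: "inj_on lab {..<k}"
  proof (rule inj_onI, rule ccontr)
    fix i j assume ij: "i \<in> {..<k}" "j \<in> {..<k}" "lab i = lab j" "i \<noteq> j"
    let ?z = "replicate k False"
    have "flip ?z i \<noteq> flip ?z j"
      using ij by (metis lessThan_iff length_replicate nth_list_update_eq nth_list_update_neq)
    then show False
      using N_inj[of "flip ?z i" "flip ?z j"] \<mu>[of ?z i] \<mu>[of ?z j] \<mu>lab[of ?z] ij by auto
  qed
  define N0 where "N0 = N (replicate k False)"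
  have N_eq: "N x = sym_diff N0 (lab ` {i. i < k \<and> x ! i})" if "length x = k" for x
  proof (induction rule: bool_list_flip_induct[OF that])
    case 1 then show ?case by (auto simp: N0_def)
  next
    case (2 x i)
    have "lab ` {j. j < k \<and> flip x i ! j} = sym_diff (lab ` {j. j < k \<and> x ! j}) {lab i}"
    proof -
      have *: "{j. j < k \<and> flip x i ! j} = sym_diff {j. j < k \<and> x ! j} {i}"
        using 2 by (auto simp: nth_list_update split: if_splits)
      have "lab i \<in> lab ` {j. j < k \<and> x ! j} \<longleftrightarrow> x ! i"
        using injlab 2(2) by (auto dest: inj_onD)
      moreover have "lab ` ({j. j < k \<and> x ! j} - {i}) = lab ` {j. j < k \<and> x ! j} - {lab i}"
        using injlab 2(2) by (auto dest: inj_onD)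
      ultimately show ?thesis unfolding * using 2(2) by (auto simp: image_Un)
    qed
    then show ?case using 2 \<mu>[of x i] \<mu>lab[of x i] by auto
  qed
  let ?S = "lab ` {..<k}"
  define A where "A = N0 - ?S"
  have ran: "N ` {x. length x = k} = {J. A \<subseteq> J \<and> J \<subseteq> A \<union> ?S}"
  proof (intro equalityI subsetI)
    fix J assume "J \<in> N ` {x. length x = k}"
    then show "J \<in> {J. A \<subseteq> J \<and> J \<subseteq> A \<union> ?S}"
      using N_eq by (auto simp: A_def)
  next
    fix J assume J: "J \<in> {J. A \<subseteq> J \<and> J \<subseteq> A \<union> ?S}"
    define x where "x = map (\<lambda>i. lab i \<in> sym_diff J N0) [0..<k]"
    have "lab ` {i. i < k \<and> x ! i} = sym_diff J N0"
      using J by (auto simp: x_def A_def)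
    moreover have "length x = k" by (simp add: x_def)
    ultimately have "N x = J" using N_eq by auto
    then show "J \<in> N ` {x. length x = k}" using \<open>length x = k\<close> by auto
  qed
  have VQ': "verts Q = \<Phi> ` {J. A \<subseteq> J \<and> J \<subseteq> A \<union> ?S}"
  proof -
    have "verts Q = \<Phi> ` N ` {x. length x = k}"
      using N(2) N\<phi> len by (fastforce simp: image_iff)
    then show ?thesis unfolding ran .
  qed
  have mem: "J \<in> K" if "A \<subseteq> J" "J \<subseteq> A \<union> ?S" for J
  proof -
    have "J \<in> N ` {x. length x = k}" unfolding ran using that by simp
    then show ?thesis using N(1) by auto
  qed
  have coord: "(\<phi> (\<Phi> (N x)) ! i \<noteq> \<phi> (\<Phi> (N y)) ! i) \<longleftrightarrow> lab i \<in> sym_diff (N x) (N y)"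
    if "length x = k" "length y = k" "i < k" for x y i
  proof -
    have *: "lab i \<in> lab ` {j. j < k \<and> z ! j} \<longleftrightarrow> z ! i" for z
      using injlab that(3) by (auto dest: inj_onD)
    have "lab i \<in> N z \<longleftrightarrow> (lab i \<in> N0) \<noteq> z ! i" if "length z = k" for z
      unfolding N_eq[OF that] using *[of z] by blast
    from this[OF that(1)] this[OF that(2)] show ?thesis
      unfolding N(3)[OF that(1)] N(3)[OF that(2)] by blast
  qed
  have EQ': "edges Q = {{\<Phi> I, \<Phi> J} | I J. A \<subseteq> I \<and> I \<subseteq> A \<union> ?S \<and> A \<subseteq> J \<and> J \<subseteq> A \<union> ?S \<and>
                (\<exists>s. sym_diff I J = {s})}" (is "_ = ?E")
  proof (intro equalityI subsetI)
    fix e assume e: "e \<in> edges Q"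
    then have "e \<subseteq> verts Q" "card e = 2" using simpleQ by (auto simp: simple_graph_def)
    then obtain I J where IJ: "e = {\<Phi> I, \<Phi> J}" "A \<subseteq> I \<and> I \<subseteq> A \<union> ?S" "A \<subseteq> J \<and> J \<subseteq> A \<union> ?S"
      unfolding VQ' card_2_iff by auto
    have "I \<in> K" "J \<in> K" using IJ mem by simp_all
    moreover have "{\<Phi> I, \<Phi> J} \<in> edges R" using e EQ IJ(1) by auto
    ultimately have "\<exists>s. sym_diff I J = {s}" by (simp only: edge_R_iff)
    then show "e \<in> ?E" using IJ by blast
  next
    fix e assume "e \<in> ?E"
    then obtain I J s where IJ: "e = {\<Phi> I, \<Phi> J}" "A \<subseteq> I \<and> I \<subseteq> A \<union> ?S" "A \<subseteq> J \<and> J \<subseteq> A \<union> ?S"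
      "sym_diff I J = {s}" by blast
    have "I \<in> N ` {x. length x = k}" "J \<in> N ` {x. length x = k}" unfolding ran using IJ by auto
    then obtain x y where xy: "length x = k" "length y = k" "I = N x" "J = N y" by auto
    have "s \<in> ?S" using IJ by blast
    then obtain i where i: "i < k" "s = lab i" by blast
    have "\<forall>j<k. x ! j \<noteq> y ! j \<longleftrightarrow> j = i"
    proof (intro allI impI)
      fix j assume "j < k"
      from coord[OF xy(1,2) this] have "x ! j \<noteq> y ! j \<longleftrightarrow> lab j \<in> sym_diff I J"
        unfolding N(3)[OF xy(1)] N(3)[OF xy(2)] xy(3,4) .
      then show "x ! j \<noteq> y ! j \<longleftrightarrow> j = i"
        unfolding IJ(4) i(2) using injlab i(1) \<open>j < k\<close> by (auto dest: inj_onD)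
    qed
    then have "{x, y} \<in> edges (hypercube k)"
      using hypercube_edge_iff xy i by blast
    then show "e \<in> edges Q" using edge xy IJ(1) by simp
  qed
  show thesis
  proof
    show "inj_on lab {..<k}" by fact
    show "A \<inter> ?S = {}" by (auto simp: A_def)
    show "A \<union> ?S \<in> K" using mem by blast
    show "Q = cube A ?S" unfolding cube_def using VQ' EQ' by (cases Q) auto
    fix I J i assume IJ: "I \<in> K" "J \<in> K" "{\<Phi> I, \<Phi> J} \<in> edges Q" "i < k"
    then have V: "\<Phi> I \<in> verts Q" "\<Phi> J \<in> verts Q" using simpleQ by (auto simp: simple_graph_def)
    then have "N (\<phi> (\<Phi> I)) = I" "N (\<phi> (\<Phi> J)) = J"
      using N\<phi> N(1) len inj IJ(1,2) by (metis inj_onD)+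
    then have "(\<phi> (\<Phi> I) ! i \<noteq> \<phi> (\<Phi> J) ! i) \<longleftrightarrow> lab i \<in> sym_diff I J"
      using coord[of "\<phi> (\<Phi> I)" "\<phi> (\<Phi> J)" i] len V IJ(4) by metis
    moreover have "\<exists>s. sym_diff I J = {s}" using IJ(3) EQ edge_R_iff[OF IJ(1,2)] by auto
    ultimately show "\<phi> (\<Phi> I) ! i \<noteq> \<phi> (\<Phi> J) ! i \<longleftrightarrow> sym_diff I J = {lab i}" by (metis singletonD singletonI)
  qed
qed

lemma interval_eq_iff:
  assumes "A \<inter> S = {}" "B \<inter> T = {}"
    and "{J. A \<subseteq> J \<and> J \<subseteq> A \<union> S} \<subseteq> {J. B \<subseteq> J \<and> J \<subseteq> B \<union> T}"
  shows "B \<subseteq> A" "A \<union> S \<subseteq> B \<union> T"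
proof -
  have "A \<in> {J. A \<subseteq> J \<and> J \<subseteq> A \<union> S}" "A \<union> S \<in> {J. A \<subseteq> J \<and> J \<subseteq> A \<union> S}" by auto
  then show "B \<subseteq> A" "A \<union> S \<subseteq> B \<union> T" using assms(3) by blast+
qed

lemma cube_verts_mono:
  assumes "A \<inter> S = {}" "B \<inter> T = {}" "A \<union> S \<in> K" "B \<union> T \<in> K"
    and "verts (cube A S) \<subseteq> verts (cube B T)"
  shows "B \<subseteq> A" "A \<union> S \<subseteq> B \<union> T"
proof -
  have "{J. A \<subseteq> J \<and> J \<subseteq> A \<union> S} \<subseteq> K" "{J. B \<subseteq> J \<and> J \<subseteq> B \<union> T} \<subseteq> K"
    using assms(3,4) down by auto
  then have "{J. A \<subseteq> J \<and> J \<subseteq> A \<union> S} \<subseteq> {J. B \<subseteq> J \<and> J \<subseteq> B \<union> T}"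
    using assms(5) inj by (simp add: cube_def inj_on_image_subset_iff)
  then show "B \<subseteq> A" "A \<union> S \<subseteq> B \<union> T" using interval_eq_iff assms(1,2) by auto
qed

lemma cube_inject:
  assumes "A \<inter> S = {}" "B \<inter> T = {}" "A \<union> S \<in> K" "B \<union> T \<in> K" "cube A S = cube B T"
  shows "A = B" "S = T"
  using cube_verts_mono[OF assms(1-4)] cube_verts_mono[OF assms(2,1,4,3)] assms by auto

lemma cube_is_hypercube:
  assumes S: "S \<in> K"
  shows "is_hypercube_of R (card S) (cube {} S)"
proof -
  let ?k = "card S" and ?Q = "cube {} S"
  obtain lab where lab: "bij_betw lab {..<?k} S"
    using ex_bij_betw_nat_finite[OF fin[OF S]] by (auto simp: atLeast0LessThan)
  have PK: "Pow S \<subseteq> K" using S down by auto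
  have VQ: "verts ?Q = \<Phi> ` Pow S" by (auto simp: cube_def)
  have EQ: "edges ?Q = {{\<Phi> I, \<Phi> J} | I J. I \<subseteq> S \<and> J \<subseteq> S \<and> (\<exists>s. sym_diff I J = {s})}"
    by (simp add: cube_def)
  have injS: "inj_on \<Phi> (Pow S)" using inj PK by (rule inj_on_subset)
  have EQ_iff: "{\<Phi> I, \<Phi> J} \<in> edges ?Q \<longleftrightarrow> (\<exists>s. sym_diff I J = {s})" if "I \<subseteq> S" "J \<subseteq> S" for I J
  proof
    assume "{\<Phi> I, \<Phi> J} \<in> edges ?Q"
    then have "{\<Phi> I, \<Phi> J} \<in> edges R"
      unfolding EQ edges_R using PK by blast
    then show "\<exists>s. sym_diff I J = {s}" using edge_R_iff PK that by (simp add: subset_iff)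
  qed (use that EQ in blast)
  have sub: "subgraph ?Q R"
    unfolding subgraph_def simple_graph_def
  proof (intro conjI ballI)
    show "finite (verts ?Q)" unfolding VQ using fin[OF S] by simp
    show "verts ?Q \<subseteq> verts R" unfolding VQ verts_R using PK by auto
    show "edges ?Q \<subseteq> edges R" unfolding EQ edges_R using PK by blast
    fix e assume "e \<in> edges ?Q"
    then obtain I J s where e: "e = {\<Phi> I, \<Phi> J}" "I \<subseteq> S" "J \<subseteq> S" "sym_diff I J = {s}"
      unfolding EQ by blast
    then have "I \<noteq> J" by auto
    then have "\<Phi> I \<noteq> \<Phi> J" using inj_onD[OF injS, of I J] e(2,3) by auto
    then show "card e = 2" using e(1) by simp
    show "e \<subseteq> verts ?Q" unfolding VQ using e by auto
  qed
  define \<phi> where "\<phi> v = map (\<lambda>i. lab i \<in> inv_into (Pow S) \<Phi> v) [0..<?k]" for v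
  have \<phi>\<Phi>: "\<phi> (\<Phi> J) = map (\<lambda>i. lab i \<in> J) [0..<?k]" if "J \<subseteq> S" for J
    using injS that by (simp add: \<phi>_def inv_into_f_f)
  have lab_S: "s \<in> S \<longleftrightarrow> (\<exists>i<?k. s = lab i)" for s
    using lab by (auto simp: bij_betw_def)
  have lab_inj: "lab i = lab j \<longleftrightarrow> i = j" if "i < ?k" "j < ?k" for i j
    using lab that by (auto simp: bij_betw_def dest: inj_onD)
  have "graph_iso \<phi> ?Q (hypercube ?k)"
    unfolding graph_iso_def verts_hypercube
  proof (intro conjI ballI)
    show "bij_betw \<phi> (verts ?Q) {x. length x = ?k}"
    proof (rule bij_betwI')
      fix u v assume "u \<in> verts ?Q" "v \<in> verts ?Q"
      then obtain I J where IJ: "u = \<Phi> I" "v = \<Phi> J" "I \<subseteq> S" "J \<subseteq> S" unfolding VQ by auto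
      have "I = J" if "\<phi> u = \<phi> v"
      proof -
        have "\<forall>i<?k. lab i \<in> I \<longleftrightarrow> lab i \<in> J"
          using that \<phi>\<Phi> IJ by (simp add: list_eq_iff_nth_eq)
        then have "s \<in> I \<longleftrightarrow> s \<in> J" if "s \<in> S" for s using lab_S[of s] that by auto
        then show ?thesis using IJ(3,4) by auto
      qed
      then show "\<phi> u = \<phi> v \<longleftrightarrow> u = v" using IJ by auto
    next
      fix v show "\<phi> v \<in> {x. length x = ?k}" by (simp add: \<phi>_def)
    next
      fix x :: "bool list" assume x: "x \<in> {x. length x = ?k}"
      let ?J = "lab ` {i. i < ?k \<and> x ! i}"
      have "?J \<subseteq> S" using lab_S by auto
      moreover have "lab i \<in> ?J \<longleftrightarrow> x ! i" if "i < ?k" for i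
        using lab_inj that by auto
      ultimately have "\<phi> (\<Phi> ?J) = x" using x \<phi>\<Phi> by (simp add: list_eq_iff_nth_eq)
      then show "\<exists>v\<in>verts ?Q. x = \<phi> v" unfolding VQ using \<open>?J \<subseteq> S\<close>
        by (metis PowI imageI)
    qed
    fix u v assume "u \<in> verts ?Q" "v \<in> verts ?Q"
    then obtain I J where IJ: "u = \<Phi> I" "v = \<Phi> J" "I \<subseteq> S" "J \<subseteq> S" unfolding VQ by auto
    have "{\<phi> u, \<phi> v} \<in> edges (hypercube ?k) \<longleftrightarrow>
        (\<exists>i<?k. \<forall>j<?k. lab j \<in> sym_diff I J \<longleftrightarrow> j = i)"
      using IJ by (subst hypercube_edge_iff) (auto simp: \<phi>\<Phi>)
    also have "\<dots> \<longleftrightarrow> (\<exists>i<?k. sym_diff I J = {lab i})"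
    proof (intro iffI; elim exE conjE)
      fix i assume i: "i < ?k" "\<forall>j<?k. lab j \<in> sym_diff I J \<longleftrightarrow> j = i"
      have "sym_diff I J \<subseteq> S" using IJ by blast
      have "s \<in> sym_diff I J \<longleftrightarrow> s = lab i" for s
        using i lab_S[of s] \<open>sym_diff I J \<subseteq> S\<close> by (metis subsetD)
      then show "\<exists>i<?k. sym_diff I J = {lab i}" using i by blast
    next
      fix i assume i: "i < ?k" "sym_diff I J = {lab i}"
      then show "\<exists>i<?k. \<forall>j<?k. lab j \<in> sym_diff I J \<longleftrightarrow> j = i"
        unfolding i(2) using lab_inj i(1) by auto
    qed
    also have "\<dots> \<longleftrightarrow> (\<exists>s. sym_diff I J = {s})"
    proof -
      have "s \<in> S" if "sym_diff I J = {s}" for s using that IJ by blast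
      then show ?thesis using lab_S by metis
    qed
    finally show "{u, v} \<in> edges ?Q \<longleftrightarrow> {\<phi> u, \<phi> v} \<in> edges (hypercube ?k)"
      using EQ_iff IJ by simp
  qed
  with sub show ?thesis unfolding is_hypercube_of_def by blast
qed

definition labelled :: "'v set \<Rightarrow> 'f \<Rightarrow> bool" where
  "labelled e s \<longleftrightarrow> (\<exists>I\<in>K. \<exists>J\<in>K. e = {\<Phi> I, \<Phi> J} \<and> sym_diff I J = {s})"

lemma labelled_iff:
  assumes "I \<in> K" "J \<in> K"
  shows "labelled {\<Phi> I, \<Phi> J} s \<longleftrightarrow> sym_diff I J = {s}"
proof
  assume "labelled {\<Phi> I, \<Phi> J} s"
  then obtain I' J' where *: "{\<Phi> I, \<Phi> J} = {\<Phi> I', \<Phi> J'}" "I' \<in> K" "J' \<in> K" "sym_diff I' J' = {s}"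
    unfolding labelled_def by blast
  then have "(I = I' \<and> J = J') \<or> (I = J' \<and> J = I')"
    using assms inj unfolding doubleton_eq_iff by (auto dest: inj_onD)
  then show "sym_diff I J = {s}" using *(4) by (auto simp: Un_commute)
qed (use assms labelled_def in blast)

lemma labelled_unique:
  assumes "labelled e s" "labelled e t"
  shows "s = t"
proof -
  obtain I J where "I \<in> K" "J \<in> K" "e = {\<Phi> I, \<Phi> J}" "sym_diff I J = {s}"
    using assms(1) unfolding labelled_def by blast
  then show ?thesis using labelled_iff[of I J t] assms(2) by simp
qed

lemma hypercube_is_cube:
  assumes "is_hypercube_of R k Q"
  obtains A S where "A \<inter> S = {}" "A \<union> S \<in> K" "card S = k" "Q = cube A S"
  using assms hypercube_is_interval unfolding is_hypercube_of_def
  by (metis card_image card_lessThan)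

text \<open>Every isomorphism to a hypercube leads to the same interval, hence to the same labels, so the
  classes do not depend on the isomorphism.\<close>

lemma theta_classes_cube:
  assumes Q: "is_hypercube_of R k Q" and A: "A \<inter> S = {}" "A \<union> S \<in> K" "Q = cube A S"
  shows "theta_classes Q = (\<lambda>s. {e \<in> edges Q. labelled e s}) ` S"
proof -
  have sub: "subgraph Q R" using Q by (simp add: is_hypercube_of_def)
  have memK: "I \<in> K" if "A \<subseteq> I" "I \<subseteq> A \<union> S" for I using that A(2) down by blast
  have classes: "\<exists>lab. S = lab ` {..<k'} \<and> (\<forall>i<k'. {{x, y} | x y. {x, y} \<in> edges Q \<and> \<phi> x ! i \<noteq> \<phi> y ! i}
      = {e \<in> edges Q. labelled e (lab i)})" if iso: "graph_iso \<phi> Q (hypercube k')" for \<phi> k'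
  proof -
    obtain B lab where B: "B \<inter> lab ` {..<k'} = {}" "B \<union> lab ` {..<k'} \<in> K" "Q = cube B (lab ` {..<k'})"
      and coord: "\<And>I J i. I \<in> K \<Longrightarrow> J \<in> K \<Longrightarrow> {\<Phi> I, \<Phi> J} \<in> edges Q \<Longrightarrow> i < k' \<Longrightarrow>
       \<phi> (\<Phi> I) ! i \<noteq> \<phi> (\<Phi> J) ! i \<longleftrightarrow> sym_diff I J = {lab i}"
      using hypercube_is_interval[OF sub iso] by metis
    have S: "S = lab ` {..<k'}"
      using cube_inject[OF A(1) B(1) A(2) B(2)] A(3) B(3) by simp
    have "{{x, y} | x y. {x, y} \<in> edges Q \<and> \<phi> x ! i \<noteq> \<phi> y ! i} = {e \<in> edges Q. labelled e (lab i)}"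
      if i: "i < k'" for i
    proof (intro equalityI subsetI)
      fix e assume "e \<in> {{x, y} | x y. {x, y} \<in> edges Q \<and> \<phi> x ! i \<noteq> \<phi> y ! i}"
      then obtain x y where xy: "e = {x, y}" "{x, y} \<in> edges Q" "\<phi> x ! i \<noteq> \<phi> y ! i" by blast
      have "{x, y} \<subseteq> verts R" using sub xy(2) unfolding subgraph_def simple_graph_def by blast
      then obtain I J where IJ: "x = \<Phi> I" "y = \<Phi> J" "I \<in> K" "J \<in> K" unfolding verts_R by auto
      then show "e \<in> {e \<in> edges Q. labelled e (lab i)}"
        using coord[OF IJ(3,4) _ i] labelled_iff[OF IJ(3,4)] xy by simp
    next
      fix e assume "e \<in> {e \<in> edges Q. labelled e (lab i)}"
      then have e: "e \<in> edges Q" "labelled e (lab i)" by auto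
      then obtain I J where IJ: "I \<in> K" "J \<in> K" "e = {\<Phi> I, \<Phi> J}" "sym_diff I J = {lab i}"
        unfolding labelled_def by blast
      then show "e \<in> {{x, y} | x y. {x, y} \<in> edges Q \<and> \<phi> x ! i \<noteq> \<phi> y ! i}"
        using coord[OF IJ(1,2) _ i] e(1) by blast
    qed
    with S show ?thesis by blast
  qed
  obtain \<phi> where iso: "graph_iso \<phi> Q (hypercube k)" using Q by (auto simp: is_hypercube_of_def)
  show ?thesis
  proof (intro equalityI subsetI)
    fix T assume "T \<in> theta_classes Q"
    then obtain k' \<phi>' i where T: "graph_iso \<phi>' Q (hypercube k')" "i < k'"
      "T = {{x, y} | x y. {x, y} \<in> edges Q \<and> \<phi>' x ! i \<noteq> \<phi>' y ! i}"
      unfolding theta_classes_def by blast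
    with classes[OF T(1)] show "T \<in> (\<lambda>s. {e \<in> edges Q. labelled e s}) ` S" by blast
  next
    fix T assume "T \<in> (\<lambda>s. {e \<in> edges Q. labelled e s}) ` S"
    with classes[OF iso] obtain i where
      "i < k" "T = {{x, y} | x y. {x, y} \<in> edges Q \<and> \<phi> x ! i \<noteq> \<phi> y ! i}" by auto
    with iso show "T \<in> theta_classes Q" unfolding theta_classes_def by blast
  qed
qed

lemma label_occurs:
  assumes "A \<inter> S = {}" "A \<union> S \<in> K" "s \<in> S"
  obtains e where "e \<in> edges (cube A S)" "labelled e s"
proof
  have d: "sym_diff A (insert s A) = {s}" using assms by auto
  show "{\<Phi> A, \<Phi> (insert s A)} \<in> edges (cube A S)"
    unfolding cube_def using d assms(3) by auto
  have "A \<in> K" "insert s A \<in> K" using assms down[OF assms(2)] by auto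
  then show "labelled {\<Phi> A, \<Phi> (insert s A)} s" using d labelled_iff by blast
qed

text \<open>An interval from \<open>A\<close> to \<open>A \<union> S\<close> lies in the interval from \<open>{}\<close> to any simplex above \<open>A \<union> S\<close>.\<close>

lemma maximal_hypercubes_eq:
  "maximal_hypercubes R = cube {} ` {S \<in> K. \<forall>J\<in>K. \<not> S \<subset> J}"
proof (intro equalityI subsetI)
  fix Q assume "Q \<in> maximal_hypercubes R"
  then obtain k where Q: "is_hypercube_of R k Q"
    and max: "\<And>k' Q'. is_hypercube_of R k' Q' \<Longrightarrow> subgraph Q Q' \<Longrightarrow> Q' = Q"
    unfolding maximal_hypercubes_def by blast
  obtain A S where AS: "A \<inter> S = {}" "A \<union> S \<in> K" "Q = cube A S"
    using hypercube_is_cube[OF Q] by metis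
  have simple: "simple_graph Q" using Q by (simp add: is_hypercube_of_def subgraph_def)
  have big: "A = {} \<and> S = T" if "T \<in> K" "A \<union> S \<subseteq> T" for T
  proof -
    have "subgraph Q (cube {} T)"
    proof -
      have le: "A \<subseteq> J \<and> J \<subseteq> A \<union> S \<longrightarrow> {} \<subseteq> J \<and> J \<subseteq> {} \<union> T" for J using that(2) by blast
      then have "verts Q \<subseteq> verts (cube {} T)" unfolding AS(3) cube_def by auto
      moreover have "edges Q \<subseteq> edges (cube {} T)"
        unfolding AS(3) cube_def ugraph.simps using le by blast
      ultimately show ?thesis using simple by (simp add: subgraph_def)
    qed
    then have "cube {} T = cube A S" using max cube_is_hypercube[OF that(1)] AS(3) by blast
    then show ?thesis using cube_inject[of "{}" T A S] that(1) AS by simp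
  qed
  have "A = {}" using big[OF AS(2)] by simp
  moreover have "\<forall>J\<in>K. \<not> S \<subset> J" using big \<open>A = {}\<close> by auto
  ultimately show "Q \<in> cube {} ` {S \<in> K. \<forall>J\<in>K. \<not> S \<subset> J}" using AS by auto
next
  fix Q assume "Q \<in> cube {} ` {S \<in> K. \<forall>J\<in>K. \<not> S \<subset> J}"
  then obtain S where S: "S \<in> K" "\<And>J. J \<in> K \<Longrightarrow> \<not> S \<subset> J" "Q = cube {} S" by blast
  have "Q' = Q" if Q': "is_hypercube_of R k' Q'" and sub: "subgraph Q Q'" for k' Q'
  proof -
    obtain B T where BT: "B \<inter> T = {}" "B \<union> T \<in> K" "Q' = cube B T"
      using hypercube_is_cube[OF Q'] by metis
    have "verts (cube {} S) \<subseteq> verts (cube B T)" using sub S(3) BT(3) by (simp add: subgraph_def)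
    then have "B = {}" "S \<subseteq> T" using cube_verts_mono[of "{}" S B T] S(1) BT by auto
    then show ?thesis using S(2)[of T] BT S(3) by auto
  qed
  then show "Q \<in> maximal_hypercubes R"
    unfolding maximal_hypercubes_def using cube_is_hypercube[OF S(1)] S(3) by blast
qed

end

section \<open>The faces of a peripherally 2-colorable graph\<close>

lemma (in plane) drawing_eq:
  assumes "\<And>v. v \<in> verts G \<Longrightarrow> degree G v \<noteq> 0"
  shows "drawing G = drawn G (edges G)"
proof -
  have "verts G \<subseteq> drawn G (edges G)"
  proof
    fix v assume "v \<in> verts G"
    then have "card {e \<in> edges G. v \<in> e} \<noteq> 0" using assms by (simp add: degree_def)
    then obtain e where "e \<in> edges G" "v \<in> e" by (auto simp: card_eq_0_iff)
    then show "v \<in> drawn G (edges G)" using drawn_verts[of "edges G"] by blast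
  qed
  then show ?thesis by (auto simp: drawing_def drawn_def)
qed

context plane_chorded
begin

lemma inside_frontier:
  assumes "is_cycle G vs" "cycle_edges vs = D"
  shows "boundary_edges G (inside (drawn G D)) = D" "boundary_verts G (inside (drawn G D)) = \<Union> D"
proof -
  have D: "D \<subseteq> edges G" using assms by (auto simp: is_cycle_def)
  have fr: "frontier (inside (drawn G D)) = drawn G D" using jordan(10)[OF assms(1)] assms(2) by simp
  show "boundary_edges G (inside (drawn G D)) = D"
    unfolding boundary_edges_def fr using curve_subset_drawn_iff[OF _ D] D by blast
  show "boundary_verts G (inside (drawn G D)) = \<Union> D"
    unfolding boundary_verts_def fr using drawn_verts[OF D] by blast
qed

text \<open>The inside of each face cycle is a component of the complement of the drawing, because its
  frontier is drawn.  Any other component lies outside the periphery; as everything is drawn inside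
  the periphery or on it, that component is unbounded.\<close>

lemma finite_faces_eq:
  assumes fc: "face_cycles (edges G) \<D>"
  shows "finite_faces G = (\<lambda>D. inside (drawn G D)) ` \<D>"
proof -
  have cyc: "\<exists>vs. is_cycle G vs \<and> cycle_edges vs = D" if "D \<in> \<D>" for D
    using fc that unfolding face_cycles_def by simp
  have cover: "inside (drawn G C) - drawn G (edges G) = (\<Union>D\<in>\<D>. inside (drawn G D))"
    using fc unfolding face_cycles_def by simp
  have drawing_E: "drawing G = drawn G (edges G)" using degree by (intro drawing_eq) fastforce
  note JC = jordan[OF outer_cycle]
  have face: "inside (drawn G D) \<in> components (- drawn G (edges G))" "bounded (inside (drawn G D))"
    if D: "D \<in> \<D>" for D
  proof -
    obtain vs where vs: "is_cycle G vs" "cycle_edges vs = D" using cyc[OF D] by blast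
    note J = jordan[OF vs(1), unfolded vs(2)]
    have DE: "D \<subseteq> edges G" using vs by (auto simp: is_cycle_def)
    show "bounded (inside (drawn G D))" by (rule J(4))
    show "inside (drawn G D) \<in> components (- drawn G (edges G))"
      unfolding in_components_maximal
    proof (intro conjI allI impI)
      show "inside (drawn G D) \<subseteq> - drawn G (edges G)" using cover D by blast
      fix T assume T: "T \<noteq> {} \<and> inside (drawn G D) \<subseteq> T \<and> T \<subseteq> - drawn G (edges G) \<and> connected T"
      have "T \<inter> frontier (inside (drawn G D)) = {}"
        using T drawn_mono[OF DE, of G] J(10) by blast
      moreover have "T \<inter> inside (drawn G D) \<noteq> {}" using T J(1) by blast
      ultimately show "T = inside (drawn G D)"
        using connected_Int_frontier[of T "inside (drawn G D)"] T by blast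
    qed (rule J(1), rule J(3))
  qed
  have drE: "drawn G (edges G) \<subseteq> drawn G C \<union> inside (drawn G C)"
  proof -
    obtain \<P> where \<P>: "chord_family \<P>" "edges G = C \<union> \<Union> (path_edges ` \<P>)"
      using chord_decomposition by blast
    have uv: "{u, v} \<subseteq> drawn G C" if "u \<in> set cs" "v \<in> set cs" for u v
      using that drawn_verts[OF C_subset] Union_C by auto
    have "drawn G (path_edges P) \<subseteq> drawn G C \<union> inside (drawn G C)" if "P \<in> \<P>" for P
    proof -
      have "chord P" using \<P>(1) that by (simp add: chord_family_def)
      then obtain u ps v where "P = u # ps @ [v]" "distinct P" "path_edges P \<subseteq> edges G - C"
        "u \<in> set cs" "v \<in> set cs" "set ps \<inter> set cs = {}" "drawn G (path_edges P) - {u, v} \<subseteq> inside (drawn G C)"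
        by (rule chord_inside)
      then show ?thesis using uv[of u v] by blast
    qed
    then have "\<Union> (drawn G ` path_edges ` \<P>) \<subseteq> drawn G C \<union> inside (drawn G C)" by blast
    moreover have "drawn G (edges G) = drawn G C \<union> \<Union> (drawn G ` path_edges ` \<P>)"
      unfolding \<P>(2) drawn_def by blast
    ultimately show ?thesis by blast
  qed
  have "s \<in> (\<lambda>D. inside (drawn G D)) ` \<D>" if s: "s \<in> components (- drawn G (edges G))" "bounded s" for s
  proof (cases "s \<inter> inside (drawn G C) = {}")
    case True
    have "s \<subseteq> - drawn G (edges G)" "s \<noteq> {}" using s(1) in_components_subset in_components_nonempty by blast+
    moreover have "drawn G C \<subseteq> drawn G (edges G)" using C_subset by (rule drawn_mono)
    ultimately have "s \<inter> outside (drawn G C) \<noteq> {}" using JC(9) True by blast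
    moreover have "outside (drawn G C) \<subseteq> - drawn G (edges G)" using drE JC(8,9) by blast
    ultimately have "outside (drawn G C) \<subseteq> s"
      using components_maximal[OF s(1) JC(6)] by blast
    then show ?thesis using s(2) JC(7) bounded_subset by blast
  next
    case False
    have "s \<subseteq> - drawn G (edges G)" using s(1) in_components_subset by blast
    then obtain D z where D: "D \<in> \<D>" "z \<in> s" "z \<in> inside (drawn G D)" using False cover by blast
    then have "s = inside (drawn G D)" using components_eq[OF s(1) face(1)[OF D(1)]] by blast
    then show ?thesis using D(1) by blast
  qed
  then show ?thesis
    unfolding finite_faces_def faces_def drawing_E using face by blast
qed

lemma face_system: "face_system G cs (finite_faces G) (boundary_edges G)"
  and face_boundary_verts: "s \<in> finite_faces G \<Longrightarrow> boundary_verts G s = \<Union> (boundary_edges G s)"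
proof -
  obtain \<P> where \<P>: "chord_family \<P>" "edges G = C \<union> \<Union> (path_edges ` \<P>)"
    using chord_decomposition by blast
  obtain \<D> where fc: "face_cycles (edges G) \<D>" using ex_face_cycles[OF \<P>] by blast
  have fin: "finite \<D>" and cyc: "\<And>D. D \<in> \<D> \<Longrightarrow> \<exists>vs. is_cycle G vs \<and> cycle_edges vs = D"
    and count: "\<And>e. e \<in> edges G \<Longrightarrow> card {D \<in> \<D>. e \<in> D} = (if e \<in> C then 1 else 2)"
    and span: "\<And>Z. Z \<subseteq> edges G \<Longrightarrow> even_edges Z \<Longrightarrow> \<exists>J\<subseteq>\<D>. Z = mod2_sum (\<lambda>D. D) J"
    using fc unfolding face_cycles_def by simp_all
  let ?I = "\<lambda>D. inside (drawn G D)"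
  note F = finite_faces_eq[OF fc]
  have BE: "boundary_edges G (?I D) = D" "boundary_verts G (?I D) = \<Union> D" if "D \<in> \<D>" for D
  proof -
    obtain vs where "is_cycle G vs" "cycle_edges vs = D" using cyc[OF \<open>D \<in> \<D>\<close>] by blast
    then show "boundary_edges G (?I D) = D" "boundary_verts G (?I D) = \<Union> D"
      by (rule inside_frontier)+
  qed
  have inj: "inj_on ?I J" if "J \<subseteq> \<D>" for J
  proof (rule inj_onI)
    fix D D' assume "D \<in> J" "D' \<in> J" "?I D = ?I D'"
    then show "D = D'" using BE(1)[of D] BE(1)[of D'] that by auto
  qed
  have card_eq: "card {s \<in> ?I ` J. e \<in> boundary_edges G s} = card {D \<in> J. e \<in> D}" if J: "J \<subseteq> \<D>" for J e
  proof -
    have "{s \<in> ?I ` J. e \<in> boundary_edges G s} = ?I ` {D \<in> J. e \<in> D}"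
      using J BE(1) by (auto simp: subset_iff)
    moreover have "inj_on ?I {D \<in> J. e \<in> D}" using J by (intro inj) blast
    ultimately show ?thesis by (simp add: card_image)
  qed
  show "face_system G cs (finite_faces G) (boundary_edges G)"
  proof
    show "finite (finite_faces G)" using F fin by simp
    show "\<exists>vs. is_cycle G vs \<and> cycle_edges vs = boundary_edges G s" if "s \<in> finite_faces G" for s
      using that cyc BE(1) unfolding F by auto
    show "card {s \<in> finite_faces G. e \<in> boundary_edges G s} = (if e \<in> C then 1 else 2)"
      if "e \<in> edges G" for e
      unfolding F using card_eq[OF subset_refl, of e] count[OF that] by simp
    show "\<exists>J\<subseteq>finite_faces G. Z = mod2_sum (boundary_edges G) J"
      if Z: "Z \<subseteq> edges G" "even_edges Z" for Z
    proof -
      obtain J where J: "J \<subseteq> \<D>" "Z = mod2_sum (\<lambda>D. D) J" using span[OF Z] by blast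
      have "mod2_sum (boundary_edges G) (?I ` J) = mod2_sum (\<lambda>D. D) J"
        unfolding mod2_sum_def using card_eq[OF J(1)] by simp
      then show ?thesis using J F by (intro exI[of _ "?I ` J"]) auto
    qed
  qed
  show "s \<in> finite_faces G \<Longrightarrow> boundary_verts G s = \<Union> (boundary_edges G s)"
    unfolding F using BE by auto
qed

end

locale colorable_faces = rooted_face_system G cs "finite_faces G" "boundary_edges G" M0
  for G :: embedded_graph and cs M0 +
  assumes face_verts: "s \<in> finite_faces G \<Longrightarrow> boundary_verts G s = \<Union> (boundary_edges G s)"

text \<open>Membership in \<open>X\<close> passes along the allowed edges, which connect all vertices because every vertex
  is covered by a perfect matching.\<close>

lemma elementary_edge_closed:
  assumes simple: "simple_graph G" and el: "elementary G"
    and X: "X \<subseteq> edges G" "X \<noteq> {}"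
      "\<And>e e' v. e \<in> X \<Longrightarrow> e' \<in> edges G \<Longrightarrow> v \<in> e \<Longrightarrow> v \<in> e' \<Longrightarrow> e' \<in> X"
  shows "X = edges G"
proof
  let ?A = "allowed_edges G"
  obtain M where M: "perfect_matching G M" using el by (auto simp: elementary_def)
  have covered: "v \<in> \<Union> ?A" if "v \<in> verts G" for v
  proof -
    obtain e where "e \<in> M" "v \<in> e" using M \<open>v \<in> verts G\<close> unfolding perfect_matching_def by blast
    then show ?thesis using M unfolding allowed_edges_def perfect_matching_def by blast
  qed
  have conn: "(u, v) \<in> {(x, y). {x, y} \<in> ?A}\<^sup>*" if "u \<in> verts G" "v \<in> verts G" for u v
  proof -
    have "\<forall>u\<in>\<Union> ?A. \<forall>v\<in>\<Union> ?A. (u, v) \<in> {(x, y). {x, y} \<in> ?A}\<^sup>*"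
      using el by (simp add: elementary_def connected_graph_def)
    then show ?thesis using covered that by blast
  qed
  have sub: "e \<subseteq> verts G" "e \<noteq> {}" if "e \<in> edges G" for e
    using simple that unfolding simple_graph_def by (blast, fastforce)
  obtain e0 u where e0: "e0 \<in> X" "u \<in> e0" "u \<in> verts G" using X(1,2) sub by blast
  have reach: "\<exists>f\<in>X. v \<in> f" if "(u, v) \<in> {(x, y). {x, y} \<in> ?A}\<^sup>*" for v
    using that
  proof (induction rule: rtrancl_induct)
    case base
    then show ?case using e0 by blast
  next
    case (step y z)
    then have "{y, z} \<in> edges G" by (simp add: allowed_edges_def)
    then have "{y, z} \<in> X" using step.IH X(3) by blast
    then show ?case by blast
  qed
  show "edges G \<subseteq> X"
  proof
    fix e assume e: "e \<in> edges G"
    then obtain v where v: "v \<in> e" "v \<in> verts G" using sub[OF e] by blast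
    then obtain f where "f \<in> X" "v \<in> f" using reach[OF conn[OF e0(3) v(2)]] by blast
    then show "e \<in> X" using X(3) e v(1) by blast
  qed
qed (rule X(1))

lemma infinite_face_unbounded:
  assumes "compact (drawing G)"
  shows "infinite_face G \<in> components (- drawing G)" "\<not> bounded (infinite_face G)"
proof -
  have b: "bounded (- (- drawing G))" using assms compact_imp_bounded by simp
  have "\<exists>!s. s \<in> faces G \<and> \<not> bounded s"
    unfolding faces_def
    using cobounded_unbounded_components[OF b] cobounded_unique_unbounded_components[OF b] by auto
  then have "infinite_face G \<in> faces G \<and> \<not> bounded (infinite_face G)"
    unfolding infinite_face_def by (rule theI')
  then show "infinite_face G \<in> components (- drawing G)" "\<not> bounded (infinite_face G)"
    by (simp_all add: faces_def)
qed

lemma peripherally_2_colorable_faces: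
  assumes G: "peripherally_2_colorable G"
  obtains cs M0 where "colorable_faces G cs M0"
proof -
  have plane: "plane_graph G" and el: "elementary G"
    and deg: "\<And>v. v \<in> verts G \<Longrightarrow> degree G v = 2 \<or> degree G v = 3"
    and deg3: "\<And>v. v \<in> verts G \<Longrightarrow> degree G v = 3 \<Longrightarrow> v \<in> exterior_verts G"
    using G unfolding peripherally_2_colorable_def by blast+
  obtain c cs where c: "proper_2_coloring G c" "cyclically_alternating c (filter (\<lambda>v. degree G v = 3) cs)"
    and cs: "periphery_cycle G (infinite_face G) cs"
    using G unfolding peripherally_2_colorable_def by blast
  interpret plane G by unfold_locales (rule plane)
  have cyc: "is_cycle G cs" "set cs = exterior_verts G" "cycle_edges cs = boundary_edges G (infinite_face G)"
    using cs by (simp_all add: periphery_cycle_def exterior_verts_def)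
  interpret chorded_cycle G cs
    by unfold_locales
      (use simple cyc deg deg3 elementary_edge_closed[OF simple el] in \<open>auto\<close>)
  have drawing_E: "drawing G = drawn G (edges G)" using deg by (intro drawing_eq) fastforce
  have "compact (drawing G)" unfolding drawing_E by (rule compact_drawn) simp
  note U = infinite_face_unbounded[OF this]
  interpret plane_chorded G cs "infinite_face G"
  proof
    show "connected (infinite_face G)" using U(1) in_components_connected by blast
    show "\<not> bounded (infinite_face G)" by (rule U(2))
    show "infinite_face G \<inter> drawn G (edges G) = {}"
      using in_components_subset[OF U(1)] unfolding drawing_E by blast
    show "drawn G (cycle_edges cs) \<subseteq> closure (infinite_face G)"
      unfolding cyc(3) drawn_def boundary_edges_def by (auto simp: frontier_def)
  qed
  interpret face_system G cs "finite_faces G" "boundary_edges G" by (rule face_system)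
  obtain M where M: "perfect_matching G M" "\<And>v e. degree G v = 3 \<Longrightarrow> e \<in> M \<Longrightarrow> v \<in> e \<Longrightarrow> e \<notin> C"
    using ex_root_matching[OF c] by blast
  have "colorable_faces G cs M"
    by unfold_locales (use M face_boundary_verts in auto)
  then show thesis using that by blast
qed

section \<open>The resonance graph\<close>

context colorable_faces
begin

lemma periphery: "s \<in> finite_faces G \<Longrightarrow> \<exists>vs. periphery_cycle G s vs"
proof -
  assume s: "s \<in> finite_faces G"
  obtain vs where vs: "is_cycle G vs" "cycle_edges vs = boundary_edges G s" using face_cycle s by blast
  then have "set vs = boundary_verts G s" using Union_cycle_edges[OF vs(1)] face_verts[OF s] by simp
  then show ?thesis using vs by (auto simp: periphery_cycle_def)
qed

lemma resonance_edge_iff: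
  "resonance_edge G e s \<longleftrightarrow> (\<exists>I\<in>independent_faces. \<exists>J\<in>independent_faces.
     e = {matching_of I, matching_of J} \<and> sym_diff I J = {s})"
proof
  assume "resonance_edge G e s"
  then obtain M N vs where *: "s \<in> finite_faces G" "perfect_matching G M" "perfect_matching G N"
    "e = {M, N}" "periphery_cycle G s vs" "sym_diff M N = cycle_edges vs"
    unfolding resonance_edge_def by blast
  obtain I where I: "I \<in> independent_faces" "M = matching_of I" using matching_of_surj[OF *(2)] .
  obtain J where J: "J \<in> independent_faces" "N = matching_of J" using matching_of_surj[OF *(3)] .
  have "sym_diff (matching_of I) (matching_of J) = boundary_edges G s"
    using * I J by (simp add: periphery_cycle_def)
  then have "sym_diff I J = {s}" using matching_of_flip_iff[OF I(1) J(1) *(1)] by simp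
  then show "\<exists>I\<in>independent_faces. \<exists>J\<in>independent_faces.
     e = {matching_of I, matching_of J} \<and> sym_diff I J = {s}" using I J *(4) by blast
next
  assume "\<exists>I\<in>independent_faces. \<exists>J\<in>independent_faces.
     e = {matching_of I, matching_of J} \<and> sym_diff I J = {s}"
  then obtain I J where IJ: "I \<in> independent_faces" "J \<in> independent_faces"
    "e = {matching_of I, matching_of J}" "sym_diff I J = {s}" by blast
  have "s \<in> I \<union> J" using IJ(4) by blast
  then have s: "s \<in> finite_faces G" using IJ(1,2) by (auto simp: independent_faces_def)
  obtain vs where vs: "periphery_cycle G s vs" using periphery[OF s] by blast
  have "sym_diff (matching_of I) (matching_of J) = cycle_edges vs"
    using matching_of_flip_iff[OF IJ(1,2) s] IJ(4) vs by (simp add: periphery_cycle_def)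
  then show "resonance_edge G e s"
    unfolding resonance_edge_def using s vs IJ(3) matching_of_perfect IJ(1,2) by blast
qed

sublocale cube_complex independent_faces matching_of "resonance_graph G"
proof
  show "{} \<in> independent_faces" by (simp add: independent_faces_def)
  show "J \<in> independent_faces" if "I \<in> independent_faces" "J \<subseteq> I" for I J
    using that by (simp add: independent_faces_def subset_iff)
  show "finite I" if "I \<in> independent_faces" for I using that by (rule finite_independent_faces)
  show "inj_on matching_of independent_faces" by (rule matching_of_inj)
  show "verts (resonance_graph G) = matching_of ` independent_faces"
    by (simp add: resonance_graph_def matching_of_image)
  show "edges (resonance_graph G) = {{matching_of I, matching_of J} | I J.
      I \<in> independent_faces \<and> J \<in> independent_faces \<and> (\<exists>s. sym_diff I J = {s})}"
    unfolding resonance_graph_def resonance_edge_iff ugraph.simps by blast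
qed

lemma resonance_edge_labelled: "resonance_edge G e s \<longleftrightarrow> labelled e s"
  unfolding labelled_def by (rule resonance_edge_iff)

lemma independent_set_iff: "independent_set (inner_dual G) J \<longleftrightarrow> J \<in> independent_faces"
proof -
  have adj: "{u, v} \<in> edges (inner_dual G) \<longleftrightarrow> u \<noteq> v \<and> boundary_edges G u \<inter> boundary_edges G v \<noteq> {}"
    if "u \<in> finite_faces G" "v \<in> finite_faces G" for u v
    using that unfolding inner_dual_def by (auto simp: doubleton_eq_iff)
  have "verts (inner_dual G) = finite_faces G" by (simp add: inner_dual_def)
  moreover have "(\<forall>u\<in>J. \<forall>v\<in>J. {u, v} \<notin> edges (inner_dual G)) \<longleftrightarrow>
      (\<forall>s\<in>J. \<forall>t\<in>J. s \<noteq> t \<longrightarrow> boundary_edges G s \<inter> boundary_edges G t = {})"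
    if "J \<subseteq> finite_faces G"
  proof (intro ball_cong refl)
    fix u v assume "u \<in> J" "v \<in> J"
    with that have "u \<in> finite_faces G" "v \<in> finite_faces G" by auto
    from adj[OF this] show "{u, v} \<notin> edges (inner_dual G) \<longleftrightarrow>
        (u \<noteq> v \<longrightarrow> boundary_edges G u \<inter> boundary_edges G v = {})" by blast
  qed
  ultimately show ?thesis
    unfolding independent_set_def independent_faces_def mem_Collect_eq by (simp only: cong: conj_cong)
qed

lemma maximal_independent_sets_eq:
  "maximal_independent_sets (inner_dual G) = {S \<in> independent_faces. \<forall>J\<in>independent_faces. \<not> S \<subset> J}"
  by (auto simp: maximal_independent_sets_def independent_set_iff)

text \<open>Independent faces are all resonant for \<open>M0\<close>, and they are vertex disjoint.  Conversely, vertex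
  disjoint faces have no common edge.\<close>

lemma resonant_set_iff: "resonant_set G S \<longleftrightarrow> S \<in> independent_faces"
proof
  assume S: "S \<in> independent_faces"
  then have F: "S \<subseteq> finite_faces G" by (simp add: independent_faces_def)
  have "resonant_face G M0 s" if "s \<in> S" for s
  proof -
    have s: "s \<in> finite_faces G" using F that by blast
    obtain vs where vs: "periphery_cycle G s vs" using periphery[OF s] by blast
    then have "alternating_cycle G M0 vs"
      using face_alternating_M0[OF s] by (simp add: periphery_cycle_def)
    then show ?thesis using vs by (auto simp: resonant_face_def)
  qed
  moreover have "boundary_verts G s \<inter> boundary_verts G t = {}" if "s \<in> S" "t \<in> S" "s \<noteq> t" for s t
    using independent_facesD[OF S that(1,2)] that F face_verts by (auto simp: subset_iff)
  ultimately show "resonant_set G S"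
    using F M0_matching unfolding resonant_set_def by blast
next
  assume S: "resonant_set G S"
  then have F: "S \<subseteq> finite_faces G"
    and dis: "\<And>s t. s \<in> S \<Longrightarrow> t \<in> S \<Longrightarrow> s \<noteq> t \<Longrightarrow> boundary_verts G s \<inter> boundary_verts G t = {}"
    unfolding resonant_set_def by simp_all
  have "boundary_edges G s \<inter> boundary_edges G t = {}" if st: "s \<in> S" "t \<in> S" "s \<noteq> t" for s t
  proof (rule ccontr)
    assume "\<not> ?thesis"
    then obtain e where e: "e \<in> boundary_edges G s" "e \<in> boundary_edges G t" by blast
    then have "e \<in> edges G" by (simp add: boundary_edges_def)
    then obtain v where "v \<in> e" using edge_card_2[of e] by fastforce
    then have "v \<in> boundary_verts G s \<inter> boundary_verts G t"
      using e st F face_verts by blast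
    then show False using dis[OF st] by blast
  qed
  then show "S \<in> independent_faces" using F by (simp add: independent_faces_def)
qed

text \<open>The edges of a class have a label in common, and no class is empty, so no other face can be the
  label of the class.\<close>

lemma hypercube_labels_cube:
  assumes Q: "is_hypercube_of (resonance_graph G) k Q"
    and A: "A \<inter> S = {}" "A \<union> S \<in> independent_faces" "Q = cube A S"
  shows "hypercube_labels G Q = S" and "s \<in> S \<Longrightarrow> \<exists>!T. T \<in> theta_classes Q \<and> class_label G T s"
proof -
  let ?T = "\<lambda>s. {e \<in> edges Q. labelled e s}"
  have theta: "theta_classes Q = ?T ` S" using theta_classes_cube[OF Q A] .
  have SF: "S \<subseteq> finite_faces G" using A(2) by (auto simp: independent_faces_def)
  have label: "class_label G (?T s) t \<longleftrightarrow> t = s" if s: "s \<in> S" for s t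
  proof
    assume *: "class_label G (?T s) t"
    obtain e where e: "e \<in> edges Q" "labelled e s" using label_occurs[OF A(1,2) s] A(3) by metis
    then have "labelled e t" using * unfolding class_label_def resonance_edge_labelled by blast
    then show "t = s" using labelled_unique e(2) by blast
  next
    assume "t = s"
    then show "class_label G (?T s) t"
      using s SF unfolding class_label_def resonance_edge_labelled by blast
  qed
  have "(\<exists>T\<in>?T ` S. class_label G T t) \<longleftrightarrow> (\<exists>s\<in>S. class_label G (?T s) t)" for t
    by (rule bex_simps(7))
  then show "hypercube_labels G Q = S"
    unfolding hypercube_labels_def theta using label by simp
  show "\<exists>!T. T \<in> theta_classes Q \<and> class_label G T s" if s: "s \<in> S"
  proof (rule ex1I[of _ "?T s"])
    show "?T s \<in> theta_classes Q \<and> class_label G (?T s) s"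
      using label[OF s] s unfolding theta by simp
    fix T assume T: "T \<in> theta_classes Q \<and> class_label G T s"
    then obtain t where t: "t \<in> S" "T = ?T t" unfolding theta by (elim conjE imageE)
    then have "s = t" using T label[OF t(1)] by simp
    then show "T = ?T s" using t(2) by simp
  qed
qed

lemma dual_vertices_eq: "S \<subseteq> finite_faces G \<Longrightarrow> dual_vertices G S = S"
  by (auto simp: dual_vertices_def inner_dual_def)

end

theorem corollary6:
  fixes G :: embedded_graph
    and f :: "complex set set ugraph \<Rightarrow> complex set set"
    and g :: "complex set set \<Rightarrow> complex set set"
    and h :: "complex set set ugraph \<Rightarrow> complex set set"
  assumes G: "peripherally_2_colorable G"
    and f: "\<And>Q. f Q = hypercube_labels G Q"
    and g: "\<And>S. g S = dual_vertices G S"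
    and h: "\<And>Q. h Q = g (f Q)"
  shows "f \<in> nontrivial_hypercubes (resonance_graph G) \<rightarrow> nonempty_resonant_sets G \<and>
         g \<in> nonempty_resonant_sets G \<rightarrow> nonempty_independent_sets (inner_dual G) \<and>
         maximal_hypercubes (resonance_graph G) \<subseteq> nontrivial_hypercubes (resonance_graph G) \<and>
         bij_betw h (maximal_hypercubes (resonance_graph G))
           (maximal_independent_sets (inner_dual G)) \<and>
         (\<forall>k\<ge>1. \<forall>Q\<in>maximal_hypercubes (resonance_graph G).
           is_hypercube_of (resonance_graph G) k Q \<longrightarrow>
             h Q \<in> maximal_independent_sets (inner_dual G) \<and> card (h Q) = k \<and>
             (\<forall>s\<in>h Q. \<exists>!T. T \<in> theta_classes Q \<and> class_label G T s))"
proof -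
  obtain cs M0 where "colorable_faces G cs M0" using peripherally_2_colorable_faces[OF G] .
  then interpret colorable_faces G cs M0 .
  let ?R = "resonance_graph G"
  let ?Max = "{S \<in> independent_faces. \<forall>J\<in>independent_faces. \<not> S \<subset> J}"
  have sub: "S \<subseteq> finite_faces G" if "S \<in> independent_faces" for S
    using that by (simp add: independent_faces_def)
  have f_val: "f (cube {} S) = S" and h_val: "h (cube {} S) = S" if "S \<in> independent_faces" for S
  proof -
    show "f (cube {} S) = S"
      using hypercube_labels_cube(1)[OF cube_is_hypercube[OF that], of "{}" S] that f by simp
    then show "h (cube {} S) = S" using h g dual_vertices_eq[OF sub[OF that]] by simp
  qed
  have Max_nonempty: "S \<noteq> {}" if "S \<in> ?Max" for S
  proof -
    obtain e where e: "e \<in> C" using C_nonempty by blast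
    then have "card {s \<in> finite_faces G. e \<in> boundary_edges G s} = 1"
      using face_count[of e] C_subset by auto
    then obtain s where "s \<in> finite_faces G" by (metis (mono_tags, lifting) card_1_singletonE insertI1 mem_Collect_eq)
    then have "{s} \<in> independent_faces" by (simp add: independent_faces_def)
    then show ?thesis using that by blast
  qed
  have f_range: "f \<in> nontrivial_hypercubes ?R \<rightarrow> nonempty_resonant_sets G"
  proof
    fix Q assume "Q \<in> nontrivial_hypercubes ?R"
    then obtain k where Q: "k \<ge> 1" "is_hypercube_of ?R k Q" unfolding nontrivial_hypercubes_def by blast
    obtain A S where A: "A \<inter> S = {}" "A \<union> S \<in> independent_faces" "card S = k" "Q = cube A S"
      using hypercube_is_cube[OF Q(2)] .
    have "f Q = S" using hypercube_labels_cube(1)[OF Q(2) A(1,2,4)] f by simp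
    moreover have "S \<in> independent_faces" using down[OF A(2)] by blast
    moreover have "S \<noteq> {}" using A(3) Q(1) by auto
    ultimately show "f Q \<in> nonempty_resonant_sets G"
      by (simp add: nonempty_resonant_sets_def resonant_set_iff)
  qed
  have g_range: "g \<in> nonempty_resonant_sets G \<rightarrow> nonempty_independent_sets (inner_dual G)"
  proof
    fix S assume "S \<in> nonempty_resonant_sets G"
    then have S: "S \<in> independent_faces" "S \<noteq> {}"
      by (simp_all add: nonempty_resonant_sets_def resonant_set_iff)
    then have "g S = S" using g dual_vertices_eq sub by simp
    then show "g S \<in> nonempty_independent_sets (inner_dual G)"
      using S by (simp add: nonempty_independent_sets_def independent_set_iff)
  qed
  have nontrivial: "maximal_hypercubes ?R \<subseteq> nontrivial_hypercubes ?R"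
  proof
    fix Q assume "Q \<in> maximal_hypercubes ?R"
    then obtain S where S: "S \<in> ?Max" "Q = cube {} S" unfolding maximal_hypercubes_eq by blast
    then have "card S \<ge> 1"
      using Max_nonempty[OF S(1)] fin[of S] by (simp add: Suc_le_eq card_gt_0_iff)
    then show "Q \<in> nontrivial_hypercubes ?R"
      using cube_is_hypercube[of S] S unfolding nontrivial_hypercubes_def by blast
  qed
  have bij: "bij_betw h (maximal_hypercubes ?R) (maximal_independent_sets (inner_dual G))"
    unfolding maximal_hypercubes_eq maximal_independent_sets_eq
  proof (rule bij_betwI[where g = "cube {}"])
    show "h \<in> cube {} ` ?Max \<rightarrow> ?Max" using h_val by auto
    show "cube {} (h Q) = Q" if "Q \<in> cube {} ` ?Max" for Q using that h_val by auto
  qed (use h_val in auto)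
  have labels: "h Q \<in> maximal_independent_sets (inner_dual G) \<and> card (h Q) = k \<and>
      (\<forall>s\<in>h Q. \<exists>!T. T \<in> theta_classes Q \<and> class_label G T s)"
    if Q: "Q \<in> maximal_hypercubes ?R" "is_hypercube_of ?R k Q" for k Q
  proof -
    obtain S where S: "S \<in> ?Max" "Q = cube {} S" using Q(1) unfolding maximal_hypercubes_eq by blast
    then have SK: "{} \<union> S \<in> independent_faces" by simp
    have hQ: "h Q = S" using h_val S by simp
    obtain A T where A: "A \<inter> T = {}" "A \<union> T \<in> independent_faces" "card T = k" "Q = cube A T"
      using hypercube_is_cube[OF Q(2)] .
    have "S = T" using cube_inject(2)[OF _ A(1) SK A(2)] A(4) S(2) by simp
    moreover have "\<exists>!T. T \<in> theta_classes Q \<and> class_label G T s" if "s \<in> S" for s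
      using that by (rule hypercube_labels_cube(2)[OF Q(2) Int_empty_left SK S(2)])
    ultimately show ?thesis using hQ S(1) A(3) unfolding maximal_independent_sets_eq by simp
  qed
  have "\<forall>k\<ge>1. \<forall>Q\<in>maximal_hypercubes ?R. is_hypercube_of ?R k Q \<longrightarrow>
      h Q \<in> maximal_independent_sets (inner_dual G) \<and> card (h Q) = k \<and>
      (\<forall>s\<in>h Q. \<exists>!T. T \<in> theta_classes Q \<and> class_label G T s)"
    by (intro allI ballI impI) (rule labels)
  with f_range g_range nontrivial bij show ?thesis by (intro conjI)
qed

end
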